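(* Let $k\ge 2$ be an integer, let $\mathsf{G}_1=\mathrm{SO}_0(1,k+1)$ and $\mathsf{G}_2=\mathrm{SU}(1,k+1)$. Let $l_1,l_2\in\mathbf{N}$ be such that $1\le l_1\le\lfloor k/2\rfloor$ and $1\le l_2\le k$. Then for each $i\in\{1,2\}$ there exists a sequence $(\rho_n\colon\mathbf{Z}\to\mathsf{G}_i)_{n\in\mathbf{N}}$ of convex-cocompact representations which converges algebraically to a discrete and faithful representation $\rho_\infty\colon\mathbf{Z}\to\mathsf{G}_i$ and such that the geometric limit $\Gamma_G$ of the subgroups $\rho_n(\mathbf{Z})$ is isomorphic to $\mathbf{Z}^{l_i+1}$.
   Context: $\mathrm{SO}_0(1,k+1)$ is the identity component of the group of real $(k+2)\times(k+2)$ matrices of determinant $1$ preserving a quadratic form of signature $(1,k+1)$; it acts by isometries on real hyperbolic space $\mathbb{H}^{k+1}_{\mathbf{R}}$. $\mathrm{SU}(1,k+1)$ is the group of complex $(k+2)\times(k+2)$ matrices of determinant $1$ preserving a Hermitian form of signature $(1,k+1)$; it acts by isometries on complex hyperbolic space $\mathbb{H}^{k+1}_{\mathbf{C}}$. An element of one of these groups is loxodromic if it has no fixed point in the hyperbolic space and exactly two fixed points in its boundary. A representation $\rho\colon\mathbf{Z}\to\mathsf{G}$ is convex-cocompact if $\rho(1)$ is loxodromic. Algebraic convergence of $\rho_n\colon\Gamma\to\mathsf{G}$ to $\rho_\infty\colon\Gamma\to\mathsf{G}$ means $\rho_n(\gamma)\to\rho_\infty(\gamma)$ for all $\gamma\in\Gamma$.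 A sequence of closed subgroups $H_n<\mathsf{G}$ converges geometrically to a closed subgroup $H$ (its geometric limit) if it converges in the Chabauty topology: (1) every $h\in H$ is a limit of some sequence $h_n\in H_n$; (2) if $h_{n_i}\in H_{n_i}$ for a subsequence and $h_{n_i}\to\hat h$ in $\mathsf{G}$, then $\hat h\in H$. A representation is discrete and faithful if it is injective with discrete image. *)

theory Defs
  imports "HOL-Analysis.Analysis" "HOL-Algebra.Elementary_Groups" "HOL-Algebra.Product_Groups"
begin

text \<open>
  Vectors are indexed by the type \<open>'m option\<close>, where \<open>'m\<close> has \<open>k + 1\<close> elements: the
  coordinate \<open>None\<close> carries the positive part of the forms below, the \<open>k + 1\<close>
  coordinates \<open>Some i\<close> the negative part. This gives the standard forms of signature
  \<open>(1, k + 1)\<close>; by Sylvester's law any other choice leads to conjugate groups.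
\<close>

definition quad_form :: "real ^ 'm::finite option \<Rightarrow> real"
  where "quad_form v = (v $ None)\<^sup>2 - (\<Sum>i\<in>UNIV. (v $ Some i)\<^sup>2)"

definition herm_form :: "complex ^ 'm::finite option \<Rightarrow> complex ^ 'm option \<Rightarrow> complex"
  where "herm_form v w =
    v $ None * cnj (w $ None) - (\<Sum>i\<in>UNIV. v $ Some i * cnj (w $ Some i))"

definition herm_quad :: "complex ^ 'm::finite option \<Rightarrow> real"
  where "herm_quad v = Re (herm_form v v)"

definition SO_set :: "(real ^ 'm::finite option ^ 'm option) set"
  where "SO_set = {A. det A = 1 \<and> (\<forall>v. quad_form (A *v v) = quad_form v)}"

definition SO0 :: "(real ^ 'm::finite option ^ 'm option) monoid"
  where "SO0 = \<lparr>carrier = connected_component_set SO_set (mat 1), mult = (**), one = mat 1\<rparr>"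

definition SU :: "(complex ^ 'm::finite option ^ 'm option) monoid"
  where "SU = \<lparr>carrier = {A. det A = 1 \<and> (\<forall>v w. herm_form (A *v v) (A *v w) = herm_form v w)},
               mult = (**), one = mat 1\<rparr>"

text \<open>
  Projective model: hyperbolic space is the set of lines on which the form \<open>q\<close> is positive, its
  boundary the set of isotropic lines, and matrices act on lines by taking images. It is used
  with \<open>q = quad_form\<close> over the reals and \<open>q = herm_quad\<close> over the complex numbers.
\<close>

definition hyperbolic_space :: "('a::field ^ 'n \<Rightarrow> real) \<Rightarrow> ('a ^ 'n) set set"
  where "hyperbolic_space q = {vec.span {v} |v. q v > 0}"

definition hyperbolic_boundary :: "('a::field ^ 'n \<Rightarrow> real) \<Rightarrow> ('a ^ 'n) set set"
  where "hyperbolic_boundary q = {vec.span {v} |v. v \<noteq> 0 \<and> q v = 0}"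

definition loxodromic :: "('a::field ^ 'n \<Rightarrow> real) \<Rightarrow> 'a ^ 'n ^ 'n \<Rightarrow> bool"
  where "loxodromic q A \<longleftrightarrow>
    (\<forall>L\<in>hyperbolic_space q. (*v) A ` L \<noteq> L) \<and>
    card {L \<in> hyperbolic_boundary q. (*v) A ` L = L} = 2"

definition convex_cocompact ::
    "('a::field ^ 'n ^ 'n) monoid \<Rightarrow> ('a ^ 'n \<Rightarrow> real) \<Rightarrow> (int \<Rightarrow> 'a ^ 'n ^ 'n) \<Rightarrow> bool"
  where "convex_cocompact G q \<rho> \<longleftrightarrow> \<rho> \<in> hom integer_group G \<and> loxodromic q (\<rho> 1)"

definition discrete_faithful :: "('a::topological_space) monoid \<Rightarrow> (int \<Rightarrow> 'a) \<Rightarrow> bool"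
  where "discrete_faithful G \<rho> \<longleftrightarrow> \<rho> \<in> hom integer_group G \<and> inj \<rho> \<and> discrete (range \<rho>)"

definition algebraically_converges ::
    "(nat \<Rightarrow> int \<Rightarrow> 'a::topological_space) \<Rightarrow> (int \<Rightarrow> 'a) \<Rightarrow> bool"
  where "algebraically_converges \<rho> \<rho>_lim \<longleftrightarrow> (\<forall>\<gamma>. (\<lambda>n. \<rho> n \<gamma>) \<longlonglongrightarrow> \<rho>_lim \<gamma>)"

definition closed_subgroup :: "'a::topological_space set \<Rightarrow> 'a monoid \<Rightarrow> bool"
  where "closed_subgroup H G \<longleftrightarrow> subgroup H G \<and> closedin (top_of_set (carrier G)) H"

definition geometric_limit ::
    "'a::topological_space monoid \<Rightarrow> (nat \<Rightarrow> 'a set) \<Rightarrow> 'a set \<Rightarrow> bool"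
  where "geometric_limit G Hs H \<longleftrightarrow>
    (\<forall>n. closed_subgroup (Hs n) G) \<and> closed_subgroup H G \<and>
    (\<forall>h\<in>H. \<exists>x. (\<forall>n. x n \<in> Hs n) \<and> x \<longlonglongrightarrow> h) \<and>
    (\<forall>r x. \<forall>h\<in>carrier G. strict_mono (r :: nat \<Rightarrow> nat) \<longrightarrow> (\<forall>i. x i \<in> Hs (r i)) \<longrightarrow> x \<longlonglongrightarrow> h
       \<longrightarrow> h \<in> H)"

end

theory Submission
  imports Defs
begin

text \<open>
  A loxodromic isometry fixing the boundary point \<open>\<infinity>\<close> is a dilation by \<open>exp s\<close> combined with
  rotations by angles \<open>\<theta>\<^sub>j\<close> about the geodesic from \<open>\<infinity>\<close> to its other fixed point. When that other
  fixed point lies at distance \<open>c\<close> from a fixed base region, a small dilation \<open>s\<close> and small angles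
  \<open>\<theta>\<^sub>j\<close> are seen from the base region as a translation of size about \<open>c\<close> times \<open>(s, \<theta>)\<close>. Angles only
  matter modulo \<open>2\<pi>\<close>. Hence the powers of the isometry act near the base region through the lattice
  of rank \<open>l + 1\<close> that is generated by the vector \<open>(s, \<theta>)\<close> and the \<open>l\<close> full turns. The parameters
  depend on \<open>c\<close> in such a way that, as \<open>c\<close> tends to infinity, this lattice, suitably rescaled, converges
  to a lattice of the same rank \<open>l + 1\<close> consisting of commuting parabolic elements, and that the
  generator itself converges to one of them. This larger lattice is the geometric limit.

  In the real case the boundary without \<open>\<infinity>\<close> is Euclidean space of dimension \<open>k\<close>, which contains
  \<open>l\<close> orthogonal planes if \<open>2 l \<le> k\<close>. With \<open>\<theta>\<^sub>j = 2\<pi> / c^(j + 1)\<close> for \<open>j < l\<close> and \<open>s = 1 / c^(l + 1)\<close>,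
  the power \<open>c^j\<close> rotates the plane \<open>j\<close> by \<open>1 / c\<close> of a turn, makes full turns in the preceding
  planes and turns the following ones by only \<open>O(1 / c^2)\<close>; the power \<open>c^l\<close> dilates by \<open>exp (1 / c)\<close>.
  So the powers \<open>c^0, \<dots>, c^l\<close> converge to independent translations. Conversely a power \<open>m\<close> that
  stays bounded has \<open>m / c^(j + 1)\<close> within \<open>O(1 / c)\<close> of an integer for each \<open>j\<close> and
  \<open>\<bar>m\<bar> = O(c^l)\<close>, which says that the digits of \<open>m\<close> in base \<open>c\<close> are bounded.

  In the complex case the boundary without \<open>\<infinity>\<close> is a Heisenberg group over a complex vector space of
  dimension \<open>k\<close>, so up to \<open>k\<close> rotation angles are available. A rotation by \<open>\<theta>\<close> about a point at horizontal
  distance \<open>c\<close> however moves the base region vertically by about \<open>c^2 \<theta>\<close>, much more than the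
  horizontal displacement \<open>c \<theta>\<close>. The other fixed point is therefore also given a height, of size
  \<open>c^2\<close>, so that the dilation contributes to the vertical displacement as well, and the angles are
  chosen such that the linear part of the vertical displacement is \<open>2\<pi> (c^2 N - m)\<close> for some
  integer \<open>N\<close>. Bounded powers are then of the form \<open>m = d\<^sub>0 + c^2 N\<close> with \<open>d\<^sub>0\<close> bounded, where \<open>N\<close> is
  treated as in the real case. The generator converges to a vertical translation and the powers
  \<open>c^2, c^3, \<dots>\<close> converge to horizontal translations, up to a scalar of modulus one that determinant
  one forces upon the matrices.

  Both cases are reduced to such statements about powers by \<open>geometric_limit_of_cyclic_groups\<close>: if
  powers with fixed digits converge and bounded powers have bounded digits, then the geometric limit
  is free abelian on the digit positions. The matrices of both cases come from one construction,
  \<open>isometry_matrix\<close>, over a field with a conjugation; convergence and boundedness of these matrices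
  are read off their entries in isotropic coordinates (\<open>convergent_isometry_matrix\<close> and
  \<open>isometry_matrix_bounds\<close>). The estimates on the digits are \<open>bounded_digits_expansion\<close> and its use in
  \<open>rotation_planes.flow_proper\<close> and \<open>rotation_torus.digits_bounded\<close>.
\<close>

section \<open>Geometric limits of cyclic groups\<close>

text \<open>
  A convergent sequence is bounded, so its terms lie in a finite and therefore closed subset.
\<close>
lemma closed_if_finite_in_balls:
  fixes S :: "'a::real_normed_vector set"
  assumes "\<And>B. finite {x \<in> S. norm x \<le> B}"
  shows "closed S"
  unfolding closed_sequential_limits
proof (intro allI impI; elim conjE)
  fix x l assume x: "\<forall>n. x n \<in> S" and l: "x \<longlonglongrightarrow> l"
  obtain B where B: "\<And>n. norm (x n) \<le> B"
    using convergent_imp_bounded[OF l] by (auto simp: bounded_iff)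
  have "closed {y \<in> S. norm y \<le> B}" using assms by (rule finite_imp_closed)
  moreover have "\<forall>n. x n \<in> {y \<in> S. norm y \<le> B}" using x B by auto
  ultimately have "l \<in> {y \<in> S. norm y \<le> B}"
    using l unfolding closed_sequential_limits by blast
  then show "l \<in> S" by simp
qed

lemma discrete_if_finite_in_balls:
  fixes S :: "'a::real_normed_vector set"
  assumes "\<And>B. finite {x \<in> S. norm x \<le> B}"
  shows "discrete S"
proof (rule discreteI)
  fix x assume x: "x \<in> S"
  have "closed (S - {x})"
    by (rule closed_if_finite_in_balls, rule finite_subset[OF _ assms]) auto
  then have "open (- (S - {x}))" by (rule open_Compl)
  then show "x isolated_in S"
    by (rule isolated_inI[OF x]) (use x in auto)
qed

lemma limits_equal_if_frequently_equal:
  fixes x y :: "nat \<Rightarrow> 'a::real_normed_vector"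
  assumes "x \<longlonglongrightarrow> a" "y \<longlonglongrightarrow> b" "\<exists>\<^sub>F n in sequentially. x n = y n"
  shows "a = b"
proof (rule ccontr)
  assume "a \<noteq> b"
  have "(\<lambda>n. x n - y n) \<longlonglongrightarrow> a - b" using assms by (intro tendsto_diff)
  then have "\<forall>\<^sub>F n in sequentially. x n - y n \<noteq> 0"
    using \<open>a \<noteq> b\<close> by (intro tendsto_imp_eventually_ne) auto
  then show False
    using assms(3) by (simp add: frequently_def)
qed

text \<open>
  The sum is the value at \<open>c n\<close> of a polynomial with the coefficients \<open>d i\<close>. A nonzero polynomial has
  finitely many roots, whereas \<open>c n\<close> becomes arbitrarily large.
\<close>
lemma digits_zero_if_frequently_zero:
  fixes c e :: "nat \<Rightarrow> nat" and d :: "nat \<Rightarrow> int"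
  assumes c: "filterlim c at_top sequentially" and e: "inj_on e {..<L}"
    and z: "\<exists>\<^sub>F n in sequentially. (\<Sum>i<L. d i * int (c n) ^ e i) = 0" and i: "i < L"
  shows "d i = 0"
proof -
  define p where "p = (\<Sum>i<L. monom (d i) (e i))"
  have root: "poly p (int k) = (\<Sum>i<L. d i * int k ^ e i)" for k
    by (simp add: p_def poly_sum poly_monom)
  have "p = 0"
  proof (rule ccontr)
    assume "p \<noteq> 0"
    then have "finite {x. poly p x = 0}" by (rule poly_roots_finite)
    then have "finite {k. poly p (int k) = 0}"
      using finite_vimageI[of "{x. poly p x = 0}" int] by (simp add: vimage_def)
    then obtain b where b: "\<And>k. poly p (int k) = 0 \<Longrightarrow> k \<le> b"
      by (auto simp: finite_nat_set_iff_bounded_le)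
    have "\<forall>\<^sub>F n in sequentially. c n > b"
      using c eventually_gt_at_top[of b] unfolding filterlim_iff by blast
    then have "\<forall>\<^sub>F n in sequentially. poly p (int (c n)) \<noteq> 0"
      by eventually_elim (use b in force)
    then show False using z by (simp add: frequently_def root)
  qed
  moreover have "coeff p (e i) = (\<Sum>j<L. if j = i then d j else 0)"
    unfolding p_def coeff_sum coeff_monom
    by (rule sum.cong[OF refl]) (use e i in \<open>auto simp: inj_on_def\<close>)
  ultimately show ?thesis using i by simp
qed

text \<open>
  The bases \<open>c n\<close> tend to infinity, and an exponent \<open>m\<close> of the \<open>n\<close>-th cyclic group is described by digits
  at the \<open>L\<close> positions \<open>c n ^ e i\<close>. The hypothesis \<open>conv\<close> provides, for each digit vector, a limit
  of the powers with these digits; the hypothesis \<open>proper\<close> says that a bounded element has bounded digits, so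
  that by pigeonhole every accumulation point of the cyclic groups is one of these limits. Properness also
  passes to the limit: only finitely many digit vectors have a limit in a given ball. This makes the limit
  group closed and discrete, and the map from digit vectors to limits injective, because
  a homomorphism with a nonzero kernel vector would be constant on its infinitely many multiples. As
  \<open>e 0 = 0\<close>, the digit at position 0 alone gives the algebraic limit.
\<close>
theorem geometric_limit_of_cyclic_groups:
  fixes G :: "('a::real_normed_vector) monoid" (structure)
    and \<rho> :: "nat \<Rightarrow> int \<Rightarrow> 'a" and c e :: "nat \<Rightarrow> nat" and L :: nat
  assumes G: "group G" "closed (carrier G)"
    and mult_tendsto: "\<And>x y a b. x \<longlonglongrightarrow> a \<Longrightarrow> y \<longlonglongrightarrow> b \<Longrightarrow> (\<lambda>n. x n \<otimes> y n) \<longlonglongrightarrow> a \<otimes> b"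
    and hom: "\<And>n. \<rho> n \<in> hom integer_group G"
    and c: "filterlim c at_top sequentially"
    and e: "inj_on e {..<L}" "e 0 = 0" "0 < L"
    and conv: "\<And>d :: nat \<Rightarrow> int. convergent (\<lambda>n. \<rho> n (\<Sum>i<L. d i * int (c n) ^ e i))"
    and proper: "\<And>B. \<exists>K. \<forall>n m. norm (\<rho> n m) \<le> B \<longrightarrow>
        (\<exists>d. m = (\<Sum>i<L. d i * int (c n) ^ e i) \<and> (\<forall>i<L. \<bar>d i\<bar> \<le> K))"
  shows "\<exists>\<rho>_lim \<Gamma>. algebraically_converges \<rho> \<rho>_lim \<and> discrete_faithful G \<rho>_lim \<and>
      geometric_limit G (\<lambda>n. range (\<rho> n)) \<Gamma> \<and>
      G\<lparr>carrier := \<Gamma>\<rparr> \<cong> product_group {..<L} (\<lambda>_. integer_group)"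
proof -
  interpret group G by fact
  define P where "P n d = (\<Sum>i<L. d i * int (c n) ^ e i)" for n and d :: "nat \<Rightarrow> int"
  have P_add: "P n (\<lambda>i. d i + d' i) = P n d + P n d'" for n d d'
    by (simp add: P_def ring_distribs sum.distrib)
  have P_diff: "P n (\<lambda>i. d i - d' i) = P n d - P n d'" for n d d'
    by (simp add: P_def left_diff_distrib sum_subtractf)
  have P_cong: "P n d = P n d'" if "\<And>i. i < L \<Longrightarrow> d i = d' i" for n d d'
    using that by (simp add: P_def)
  have \<rho>_closed: "\<rho> n m \<in> carrier G" for n m
    using hom[of n] by (auto simp: hom_def integer_group_def)
  have \<rho>_add: "\<rho> n (m + m') = \<rho> n m \<otimes> \<rho> n m'" for n m m'
    using hom[of n] by (auto simp: hom_def integer_group_def)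
  have \<rho>_0: "\<rho> n 0 = \<one>" for n
    using \<rho>_add[of n 0 0] \<rho>_closed by (metis add.right_neutral r_cancel_one)
  obtain K where K: "\<And>B n m. norm (\<rho> n m) \<le> B \<Longrightarrow> \<exists>d. m = P n d \<and> (\<forall>i<L. \<bar>d i\<bar> \<le> K B)"
    using proper unfolding P_def by metis

  define \<gamma> where "\<gamma> d = lim (\<lambda>n. \<rho> n (P n d))" for d
  have \<gamma>: "(\<lambda>n. \<rho> n (P n d)) \<longlonglongrightarrow> \<gamma> d" for d
    using conv[of d] by (simp add: \<gamma>_def P_def convergent_LIMSEQ_iff)
  have \<gamma>_closed: "\<gamma> d \<in> carrier G" for d
    by (rule closed_sequentially[OF G(2) _ \<gamma>]) (rule \<rho>_closed)
  have \<gamma>_add: "\<gamma> (\<lambda>i. d i + d' i) = \<gamma> d \<otimes> \<gamma> d'" for d d'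
    using LIMSEQ_unique[OF \<gamma>[of "\<lambda>i. d i + d' i"]] mult_tendsto[OF \<gamma> \<gamma>]
    by (simp add: P_add \<rho>_add)
  have \<gamma>_cong: "\<gamma> d = \<gamma> d'" if "\<And>i. i < L \<Longrightarrow> d i = d' i" for d d'
    unfolding \<gamma>_def using P_cong[OF that] by simp
  have \<gamma>_0: "\<gamma> (\<lambda>_. 0) = \<one>"
    using \<gamma>[of "\<lambda>_. 0"] by (simp add: P_def \<rho>_0 LIMSEQ_const_iff)

  define digits where "digits k = PiE {..<L} (\<lambda>_. {-k..k::int})" for k
  have fin: "finite (digits k)" for k by (auto simp: digits_def intro: finite_PiE)
  have repr: "\<exists>d\<in>digits (K B). m = P n d" if b: "norm (\<rho> n m) \<le> B" for B n m
  proof -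
    obtain d where d: "m = P n d" "\<forall>i<L. \<bar>d i\<bar> \<le> K B" using K[OF b] by blast
    have "restrict d {..<L} \<in> digits (K B)"
      using d(2) by (fastforce simp: digits_def)
    moreover have "m = P n (restrict d {..<L})"
      using d(1) P_cong[of d "restrict d {..<L}"] by simp
    ultimately show ?thesis by blast
  qed

  \<comment> \<open>A bounded limit element already has bounded digits: by pigeonhole, one bounded digit vector
     represents the same exponent for infinitely many \<open>n\<close>.\<close>
  have bounded: "\<bar>d i\<bar> \<le> K (B + 1)" if "norm (\<gamma> d) \<le> B" "i < L" for d B i
  proof -
    have "\<forall>\<^sub>F n in sequentially. norm (\<rho> n (P n d)) < B + 1"
      using tendsto_norm[OF \<gamma>[of d]] that(1) by (intro order_tendstoD) auto
    then have "\<forall>\<^sub>F n in sequentially. \<exists>d'\<in>digits (K (B + 1)). P n d = P n d'"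
      by eventually_elim (meson repr less_imp_le)
    then have "\<exists>\<^sub>F n in sequentially. \<exists>d'\<in>digits (K (B + 1)). P n d = P n d'"
      by (rule eventually_frequently[rotated]) simp
    from frequently_bex_finite[OF fin this]
    obtain d' where d': "d' \<in> digits (K (B + 1))"
      and freq: "\<exists>\<^sub>F n in sequentially. P n d = P n d'" by blast
    have "\<exists>\<^sub>F n in sequentially. P n (\<lambda>i. d i - d' i) = 0"
      using freq by (simp add: P_diff)
    then have "d i - d' i = 0"
      using digits_zero_if_frequently_zero[of c e L "\<lambda>i. d i - d' i" i] c e(1) that(2)
      by (simp only: P_def)
    moreover have "\<bar>d' i\<bar> \<le> K (B + 1)"
      using PiE_mem[OF d'[unfolded digits_def], of i] that(2) by auto
    ultimately show ?thesis by simp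
  qed
  \<comment> \<open>All multiples of a digit vector in the kernel have the limit \<open>\<one>\<close>, hence bounded digits.\<close>
  have inj: "d i = d' i" if "\<gamma> d = \<gamma> d'" "i < L" for d d' i
  proof -
    define u where "u j = (\<lambda>i. int j * (d i - d' i))" for j
    have \<gamma>u: "\<gamma> (u j) = \<one>" for j
    proof (induction j)
      case (Suc j)
      have "\<gamma> (u (Suc j)) = \<gamma> (\<lambda>i. u j i + (d i - d' i))"
        by (simp add: u_def algebra_simps)
      also have "\<dots> = \<gamma> (\<lambda>i. d i - d' i)"
        by (simp add: \<gamma>_add Suc.IH \<gamma>_closed)
      also have "\<dots> = \<one>"
      proof -
        have "\<gamma> (\<lambda>i. d i - d' i) \<otimes> \<gamma> d' = \<gamma> d'"
          using \<gamma>_add[of "\<lambda>i. d i - d' i" d'] that(1) by simp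
        then show ?thesis using \<gamma>_closed r_cancel_one by blast
      qed
      finally show ?case .
    qed (simp add: u_def \<gamma>_0)
    have *: "int j * \<bar>d i - d' i\<bar> \<le> K (norm \<one> + 1)" for j
    proof -
      have "\<bar>u j i\<bar> \<le> K (norm \<one> + 1)" by (rule bounded) (simp_all add: \<gamma>u that(2))
      then show ?thesis by (simp add: u_def abs_mult)
    qed
    show ?thesis
    proof (rule ccontr)
      assume "d i \<noteq> d' i"
      then have "1 \<le> \<bar>d i - d' i\<bar>" by arith
      then have "int j \<le> int j * \<bar>d i - d' i\<bar>" for j
        using mult_left_mono[of 1 "\<bar>d i - d' i\<bar>" "int j"] by simp
      then have "int j \<le> K (norm \<one> + 1)" for j using * order_trans by blast
      from this[of "nat (K (norm \<one> + 1)) + 1"] show False by (simp split: if_splits)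
    qed
  qed

  define \<Gamma> where "\<Gamma> = range \<gamma>"
  have fin_\<Gamma>: "finite {x \<in> \<Gamma>. norm x \<le> B}" for B
  proof (rule finite_subset)
    show "{x \<in> \<Gamma>. norm x \<le> B} \<subseteq> \<gamma> ` digits (K (B + 1))"
    proof
      fix x assume "x \<in> {x \<in> \<Gamma>. norm x \<le> B}"
      then obtain d where d: "x = \<gamma> d" "norm (\<gamma> d) \<le> B" by (auto simp: \<Gamma>_def)
      have "restrict d {..<L} \<in> digits (K (B + 1))"
        using bounded[OF d(2)] by (fastforce simp: digits_def)
      moreover have "x = \<gamma> (restrict d {..<L})"
        using d(1) \<gamma>_cong[of d "restrict d {..<L}"] by simp
      ultimately show "x \<in> \<gamma> ` digits (K (B + 1))" by blast
    qed
  qed (simp add: fin)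
  have \<gamma>_inv: "inv \<gamma> d = \<gamma> (\<lambda>i. - d i)" for d
    using \<gamma>_add[of "\<lambda>i. - d i" d] \<gamma>_0 \<gamma>_closed by (intro inv_equality) auto
  have sub_\<Gamma>: "subgroup \<Gamma> G"
  proof (rule subgroupI)
    show "\<Gamma> \<noteq> {}" by (auto simp: \<Gamma>_def)
  qed (use \<gamma>_closed in \<open>auto simp: \<Gamma>_def \<gamma>_inv simp flip: \<gamma>_add\<close>)
  have closedin: "closedin (top_of_set (carrier G)) H" if "subgroup H G" "closed H" for H
    using that subgroup.subset by (auto simp: closedin_closed)
  have closed_\<Gamma>: "closed_subgroup \<Gamma> G"
    using closedin[OF sub_\<Gamma>] closed_if_finite_in_balls[OF fin_\<Gamma>] sub_\<Gamma>
    by (simp add: closed_subgroup_def)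
  have closed_range: "closed_subgroup (range (\<rho> n)) G" for n
  proof -
    have "group_hom integer_group G (\<rho> n)"
      using hom by (simp add: group_hom_def group_hom_axioms_def)
    then have "subgroup (range (\<rho> n)) G"
      using group_hom.img_is_subgroup[of integer_group G "\<rho> n"] by (simp add: integer_group_def)
    moreover have "closed (range (\<rho> n))"
    proof (rule closed_if_finite_in_balls, rule finite_subset)
      show "{x \<in> range (\<rho> n). norm x \<le> B} \<subseteq> (\<lambda>d. \<rho> n (P n d)) ` digits (K B)" for B
        using repr by fastforce
    qed (simp add: fin)
    ultimately show ?thesis
      using closedin by (simp add: closed_subgroup_def)
  qed

  have accum: "h \<in> \<Gamma>" if r: "strict_mono r" and x: "\<forall>i. x i \<in> range (\<rho> (r i))" "x \<longlonglongrightarrow> h" for r x h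
  proof -
    obtain B where B: "\<And>n. norm (x n) \<le> B"
      using convergent_imp_bounded[OF x(2)] by (auto simp: bounded_iff)
    have "\<exists>d\<in>digits (K B). x i = \<rho> (r i) (P (r i) d)" for i
      using x(1) B[of i] repr by (metis (no_types, lifting) rangeE)
    then have "\<exists>\<^sub>F i in sequentially. \<exists>d\<in>digits (K B). x i = \<rho> (r i) (P (r i) d)"
      by simp
    from frequently_bex_finite[OF fin this]
    obtain d where "\<exists>\<^sub>F i in sequentially. x i = \<rho> (r i) (P (r i) d)" by blast
    then have "h = \<gamma> d"
      using limits_equal_if_frequently_equal[OF x(2) LIMSEQ_subseq_LIMSEQ[OF \<gamma> r]]
      by (simp add: o_def)
    then show ?thesis by (simp add: \<Gamma>_def)
  qed
  have geom: "geometric_limit G (\<lambda>n. range (\<rho> n)) \<Gamma>"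
    unfolding geometric_limit_def
    using closed_range closed_\<Gamma> accum \<gamma> by (fastforce simp: \<Gamma>_def)

  define \<rho>_lim where "\<rho>_lim m = \<gamma> (\<lambda>i. if i = 0 then m else 0)" for m
  have P_single: "P n (\<lambda>i. if i = 0 then m else 0) = m" for n m
  proof -
    have "P n (\<lambda>i. if i = 0 then m else 0) = (\<Sum>i<L. if i = 0 then m else 0)"
      unfolding P_def by (rule sum.cong) (auto simp: e(2))
    then show ?thesis using e(3) by simp
  qed
  have alg: "algebraically_converges \<rho> \<rho>_lim"
    unfolding algebraically_converges_def \<rho>_lim_def
    using \<gamma>[of "\<lambda>i. if i = 0 then m else 0" for m] by (simp add: P_single)
  have "\<rho>_lim \<in> hom integer_group G"
  proof (rule homI)
    fix m m' :: int
    have "\<rho>_lim m \<otimes> \<rho>_lim m' = \<gamma> (\<lambda>i. (if i = 0 then m else 0) + (if i = 0 then m' else 0))"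
      unfolding \<rho>_lim_def by (rule \<gamma>_add[symmetric])
    also have "\<dots> = \<rho>_lim (m + m')"
      unfolding \<rho>_lim_def by (rule \<gamma>_cong) simp
    finally show "\<rho>_lim (m \<otimes>\<^bsub>integer_group\<^esub> m') = \<rho>_lim m \<otimes> \<rho>_lim m'"
      by (simp add: integer_group_def)
  qed (simp add: \<rho>_lim_def \<gamma>_closed)
  moreover have "inj \<rho>_lim"
  proof (rule injI)
    fix m m' assume "\<rho>_lim m = \<rho>_lim m'"
    from inj[OF this[unfolded \<rho>_lim_def] e(3)] show "m = m'" by simp
  qed
  moreover have "discrete (range \<rho>_lim)"
  proof (rule discrete_if_finite_in_balls)
    fix B
    have "{x \<in> range \<rho>_lim. norm x \<le> B} \<subseteq> {x \<in> \<Gamma>. norm x \<le> B}"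
      by (auto simp: \<rho>_lim_def \<Gamma>_def)
    then show "finite {x \<in> range \<rho>_lim. norm x \<le> B}"
      using fin_\<Gamma> by (rule finite_subset)
  qed
  ultimately have df: "discrete_faithful G \<rho>_lim" by (simp add: discrete_faithful_def)

  have "\<gamma> \<in> iso (product_group {..<L} (\<lambda>_. integer_group)) (G\<lparr>carrier := \<Gamma>\<rparr>)"
  proof (rule isoI)
    show "\<gamma> \<in> hom (product_group {..<L} (\<lambda>_. integer_group)) (G\<lparr>carrier := \<Gamma>\<rparr>)"
    proof (rule homI)
      fix x y :: "nat \<Rightarrow> int"
      have "\<gamma> (\<lambda>i\<in>{..<L}. x i + y i) = \<gamma> (\<lambda>i. x i + y i)" by (rule \<gamma>_cong) simp
      then show "\<gamma> (x \<otimes>\<^bsub>product_group {..<L} (\<lambda>_. integer_group)\<^esub> y) = \<gamma> x \<otimes>\<^bsub>G\<lparr>carrier := \<Gamma>\<rparr>\<^esub> \<gamma> y"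
        by (simp add: product_group_def integer_group_def \<gamma>_add)
    qed (simp add: \<Gamma>_def)
    have "inj_on \<gamma> (PiE {..<L} (\<lambda>_. UNIV))"
    proof (rule inj_onI)
      fix x y :: "nat \<Rightarrow> int"
      assume "x \<in> PiE {..<L} (\<lambda>_. UNIV)" "y \<in> PiE {..<L} (\<lambda>_. UNIV)" "\<gamma> x = \<gamma> y"
      then show "x = y" using inj[of x y] by (auto intro: PiE_ext)
    qed
    moreover have "\<gamma> ` (PiE {..<L} (\<lambda>_. UNIV)) = \<Gamma>"
    proof
      show "\<Gamma> \<subseteq> \<gamma> ` (PiE {..<L} (\<lambda>_. UNIV))"
      proof
        fix x assume "x \<in> \<Gamma>"
        then obtain d where "x = \<gamma> d" by (auto simp: \<Gamma>_def)
        moreover have "\<gamma> d = \<gamma> (restrict d {..<L})" by (rule \<gamma>_cong) simp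
        ultimately have "x = \<gamma> (restrict d {..<L})" by simp
        moreover have "restrict d {..<L} \<in> PiE {..<L} (\<lambda>_. UNIV)" by simp
        ultimately show "x \<in> \<gamma> ` (PiE {..<L} (\<lambda>_. UNIV))" by (rule image_eqI)
      qed
    qed (auto simp: \<Gamma>_def)
    ultimately show "bij_betw \<gamma> (carrier (product_group {..<L} (\<lambda>_. integer_group)))
        (carrier (G\<lparr>carrier := \<Gamma>\<rparr>))"
      by (simp add: bij_betw_def integer_group_def)
  qed
  then have "product_group {..<L} (\<lambda>_. integer_group) \<cong> G\<lparr>carrier := \<Gamma>\<rparr>"
    by (auto simp: is_iso_def)
  then have "G\<lparr>carrier := \<Gamma>\<rparr> \<cong> product_group {..<L} (\<lambda>_. integer_group)"
    using group.iso_sym[OF product_group[of "{..<L}" "\<lambda>_. integer_group"]] group_integer_group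
    by blast
  with alg df geom show ?thesis by blast
qed

section \<open>Digit expansions and asymptotic estimates\<close>

text \<open>
  The expansion in base \<open>c\<close> with digits of least absolute value. The distance from \<open>m / c\<close> to the integers
  bounds the lowest digit; subtracting that digit and dividing by \<open>c\<close> leaves a number that satisfies the same
  hypotheses with one digit less and with \<open>C\<close> doubled.
\<close>
lemma bounded_digits_expansion:
  fixes c l :: nat and m :: int and C :: real
  assumes "1 \<le> c" "\<bar>real_of_int m\<bar> \<le> C * real c ^ l"
    and "\<And>j. 1 \<le> j \<Longrightarrow> j \<le> l \<Longrightarrow> \<exists>z::int. \<bar>real_of_int m / real c ^ j - of_int z\<bar> \<le> C / real c"
  shows "\<exists>d. m = (\<Sum>i<Suc l. d i * int c ^ i) \<and> (\<forall>i. \<bar>real_of_int (d i)\<bar> \<le> 2 ^ l * C)"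
  using assms
proof (induction l arbitrary: m C)
  case 0
  then have "0 \<le> C" by auto
  with 0 show ?case by (intro exI[of _ "\<lambda>i. if i = 0 then m else 0"]) auto
next
  case (Suc l)
  have c: "real c \<ge> 1" using Suc.prems(1) by simp
  obtain z :: int where z: "\<bar>real_of_int m / real c - of_int z\<bar> \<le> C / real c"
    using Suc.prems(3)[of 1] by auto
  have "0 \<le> C / real c" using z by (rule order_trans[OF abs_ge_zero])
  then have C: "0 \<le> C" using c by (simp add: zero_le_divide_iff)
  define d0 where "d0 = m - int c * z"
  have "real_of_int d0 / real c = real_of_int m / real c - of_int z"
    using c by (simp add: d0_def field_simps)
  then have "\<bar>real_of_int d0\<bar> / real c \<le> C / real c"
    using z c by (metis abs_divide abs_of_nat)
  then have d0: "\<bar>real_of_int d0\<bar> \<le> C"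
    using c by (simp add: divide_le_cancel)
  have pow: "1 \<le> real c ^ j" for j using c by (rule one_le_power)
  have "real c * \<bar>real_of_int z\<bar> = \<bar>real_of_int m - real_of_int d0\<bar>"
    using c by (simp add: d0_def abs_mult)
  also have "\<dots> \<le> C * real c ^ Suc l + C" using Suc.prems(2) d0 by linarith
  also have "\<dots> \<le> real c * (2 * C * real c ^ l)"
    using mult_left_mono[OF pow[of "Suc l"] C] by simp
  finally have z_le: "\<bar>real_of_int z\<bar> \<le> 2 * C * real c ^ l"
    using c by (simp add: mult_le_cancel_left)
  have z_near: "\<exists>z'::int. \<bar>real_of_int z / real c ^ j - of_int z'\<bar> \<le> 2 * C / real c"
    if j: "1 \<le> j" "j \<le> l" for j
  proof -
    obtain z' :: int where z': "\<bar>real_of_int m / real c ^ Suc j - of_int z'\<bar> \<le> C / real c"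
      using Suc.prems(3)[of "Suc j"] j by auto
    have "real_of_int z / real c ^ j = real_of_int m / real c ^ Suc j - real_of_int d0 / real c ^ Suc j"
      using c by (simp add: d0_def field_simps)
    moreover have "\<bar>real_of_int d0 / real c ^ Suc j\<bar> \<le> C / real c"
    proof -
      have "real c * 1 \<le> real c ^ Suc j" using pow[of j] c by (simp del: mult_1_right)
      then show ?thesis using d0 c C by (auto simp: abs_divide intro!: frac_le)
    qed
    ultimately have "\<bar>real_of_int z / real c ^ j - of_int z'\<bar> \<le> 2 * C / real c"
      using z' by linarith
    then show ?thesis by blast
  qed
  obtain d where d: "z = (\<Sum>i<Suc l. d i * int c ^ i)"
    "\<forall>i. \<bar>real_of_int (d i)\<bar> \<le> 2 ^ l * (2 * C)"
    using Suc.IH[OF Suc.prems(1) z_le z_near] by blast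
  define d' where "d' i = (case i of 0 \<Rightarrow> d0 | Suc i \<Rightarrow> d i)" for i
  have "(\<Sum>i<Suc (Suc l). d' i * int c ^ i) = d0 + (\<Sum>i<Suc l. d i * int c ^ Suc i)"
    by (subst sum.lessThan_Suc_shift) (simp add: d'_def)
  also have "\<dots> = m"
    by (simp only: d0_def d(1) sum_distrib_left) (simp add: algebra_simps)
  finally have "m = (\<Sum>i<Suc (Suc l). d' i * int c ^ i)" ..
  moreover have "C * 1 \<le> C * 2 ^ Suc l" using C by (intro mult_left_mono one_le_power) auto
  then have "\<bar>real_of_int (d' i)\<bar> \<le> 2 ^ Suc l * C" for i
    using d0 d(2) C by (cases i) (auto simp: d'_def algebra_simps)
  ultimately show ?case by blast
qed

text \<open>
  The bound on \<open>exp x\<close> excludes large positive \<open>x\<close>, for which \<open>exp (- x)\<close> is nearly constant and does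
  not control \<open>x\<close>.
\<close>
lemma abs_le_if_exp_near_1:
  fixes x B \<delta> :: real
  assumes "exp x \<le> B" "1 \<le> B" "\<bar>exp (- x) - 1\<bar> \<le> \<delta>"
  shows "\<bar>x\<bar> \<le> B * \<delta>"
proof (cases "x \<ge> 0")
  case True
  have "x \<le> exp x - 1" using exp_ge_add_one_self[of x] by linarith
  also have "\<dots> = exp x * (1 - exp (- x))" by (simp add: algebra_simps flip: exp_add)
  also have "\<dots> \<le> B * \<delta>" using assms True by (intro mult_mono) auto
  finally show ?thesis using True by simp
next
  case False
  have "- x \<le> exp (- x) - 1" using exp_ge_add_one_self[of "- x"] by linarith
  also have "\<dots> \<le> \<delta>" using assms by linarith
  also have "\<dots> \<le> B * \<delta>" using assms mult_right_mono[of 1 B \<delta>] by auto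
  finally show ?thesis using False by simp
qed

text \<open>
  Third order errors matter because the vertical displacement in the Heisenberg group multiplies angles of
  size \<open>1 / c\<close> by \<open>c\<^sup>2\<close>.
\<close>
lemma abs_sin_minus_self_le:
  fixes x :: real
  shows "\<bar>sin x - x\<bar> \<le> \<bar>x\<bar> ^ 3 / 6"
  using Maclaurin_sin_bound[of x 3]
  by (simp add: numeral_eq_Suc sin_coeff_def field_simps)

lemma half_abs_le_abs_sin:
  fixes x :: real
  assumes "\<bar>x\<bar> \<le> pi / 2"
  shows "\<bar>x\<bar> / 2 \<le> \<bar>sin x\<bar>"
proof -
  have pos: "y / 2 \<le> sin y" if y: "0 \<le> y" "y \<le> pi / 2" for y :: real
  proof -
    have "pi \<le> 3.2" using pi_approx(2) by (simp add: field_simps)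
    then have "y \<le> 1.6" using y by simp
    then have "y\<^sup>2 \<le> 1.6\<^sup>2" using y by (intro power_mono) auto
    then have "y\<^sup>2 \<le> 3" by (simp add: power2_eq_square)
    then have "y * y\<^sup>2 \<le> y * 3" using y by (intro mult_left_mono) auto
    then have "\<bar>y\<bar> ^ 3 \<le> 3 * y" using y by (simp add: power3_eq_cube power2_eq_square)
    with abs_sin_minus_self_le[of y] show ?thesis using y by linarith
  qed
  show ?thesis using pos[of "\<bar>x\<bar>"] assms by (cases "x \<ge> 0") auto
qed

lemma near_integer_if_cis_near_1:
  fixes t :: real
  assumes "norm (cis (2 * pi * t) - 1) \<le> \<delta>"
  shows "\<exists>z::int. \<bar>t - of_int z\<bar> \<le> \<delta>"
proof -
  define z where "z = round t"
  define y where "y = t - of_int z"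
  have y: "\<bar>y\<bar> \<le> 1/2" using of_int_round_abs_le[of t] by (simp add: y_def z_def abs_minus_commute)
  have "cis (2 * pi * t) = cis (2 * pi * y)"
    unfolding y_def right_diff_distrib cis_divide[symmetric] by (simp add: cis_multiple_2pi)
  then have "norm (cis (2 * pi * y) - 1) \<le> \<delta>" using assms by simp
  moreover have "norm (cis (2 * pi * y) - 1) = 2 * \<bar>sin (pi * y)\<bar>"
    using dist_exp_i_1[of "2 * pi * y"] by (simp add: cis_conv_exp algebra_simps)
  moreover have "\<bar>pi * y\<bar> / 2 \<le> \<bar>sin (pi * y)\<bar>"
    by (rule half_abs_le_abs_sin) (use y in \<open>simp add: abs_mult\<close>)
  moreover have "\<bar>y\<bar> \<le> \<bar>pi * y\<bar>"
    using pi_gt3 by (simp add: abs_mult mult_le_cancel_right1)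
  ultimately show ?thesis by (intro exI[of _ z]) (simp add: y_def)
qed

lemma abs_sinh_minus_self_le:
  fixes x :: real
  assumes "\<bar>x\<bar> \<le> b"
  shows "\<bar>sinh x - x\<bar> \<le> exp b * \<bar>x\<bar> ^ 3"
proof -
  obtain t where t: "\<bar>t\<bar> \<le> \<bar>x\<bar>" "exp x = (\<Sum>m<3. (x ^ m) / fact m) + (exp t / fact 3) * x ^ 3"
    using Maclaurin_exp_le by blast
  obtain s where s: "\<bar>s\<bar> \<le> \<bar>- x\<bar>" "exp (- x) = (\<Sum>m<3. ((- x) ^ m) / fact m) + (exp s / fact 3) * (- x) ^ 3"
    using Maclaurin_exp_le by blast
  have "sinh x - x = ((exp t + exp s) / 12) * x ^ 3"
    using t(2) s(2) by (simp add: sinh_def numeral_eq_Suc field_simps)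
  then have eq: "\<bar>sinh x - x\<bar> = ((exp t + exp s) / 12) * \<bar>x\<bar> ^ 3"
    by (simp only: abs_mult power_abs) (simp add: abs_of_pos add_pos_pos)
  have "exp t \<le> exp b" "exp s \<le> exp b" using t(1) s(1) assms by auto
  then have "exp t + exp s \<le> 12 * exp b" using exp_gt_zero[of b] by linarith
  then have "(exp t + exp s) / 12 \<le> exp b" by (simp only: divide_le_eq) simp
  then have "(exp t + exp s) / 12 * \<bar>x\<bar> ^ 3 \<le> exp b * \<bar>x\<bar> ^ 3"
    by (intro mult_right_mono) auto
  then show ?thesis by (simp only: eq)
qed

lemma tendsto_zero_if_rescaled_convergent:
  fixes u c :: "nat \<Rightarrow> real"
  assumes u: "(\<lambda>n. c n * u n) \<longlonglongrightarrow> A" and c: "filterlim c at_top sequentially"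
  shows "u \<longlonglongrightarrow> 0"
proof (rule Lim_transform_eventually)
  show "(\<lambda>n. (c n * u n) / c n) \<longlonglongrightarrow> 0"
    by (rule tendsto_divide_0[OF u]) (use c filterlim_at_top_imp_at_infinity in blast)
  show "\<forall>\<^sub>F n in sequentially. c n * u n / c n = u n"
    using c[unfolded filterlim_at_top_dense, rule_format, of 0] by eventually_elim auto
qed

text \<open>
  Only the linear part of \<open>f\<close> at 0 survives, since \<open>u n\<close> tends to 0 while \<open>c n * u n\<close> converges.
\<close>
lemma tendsto_rescaled:
  fixes f :: "real \<Rightarrow> real" and u c :: "nat \<Rightarrow> real"
  assumes f: "(f has_real_derivative D) (at 0)" "f 0 = 0"
    and u: "(\<lambda>n. c n * u n) \<longlonglongrightarrow> A" and c: "filterlim c at_top sequentially"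
  shows "(\<lambda>n. c n * f (u n)) \<longlonglongrightarrow> D * A"
proof -
  obtain g where g: "\<And>z. f z = g z * z" "isCont g 0" "g 0 = D"
    using f by (auto simp: CARAT_DERIV)
  have "u \<longlonglongrightarrow> 0" by (rule tendsto_zero_if_rescaled_convergent[OF u c])
  then have "(\<lambda>n. g (u n)) \<longlonglongrightarrow> g 0" by (rule isCont_tendsto_compose[OF g(2)])
  then have "(\<lambda>n. g (u n) * (c n * u n)) \<longlonglongrightarrow> D * A"
    using u g(3) by (auto intro: tendsto_mult)
  then show ?thesis by (simp add: g(1) mult_ac)
qed


text \<open>
  In applications \<open>u n\<close> is the logarithm of a dilation factor and \<open>v n\<close> a rotation angle, both of size \<open>1 / c n\<close>.
  The second order limits belong to the vertical displacement.
\<close>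
context
  fixes c u v :: "nat \<Rightarrow> real" and A B :: real
  assumes c: "filterlim c at_top sequentially"
    and u: "(\<lambda>n. c n * u n) \<longlonglongrightarrow> A" and v: "(\<lambda>n. c n * v n) \<longlonglongrightarrow> B"
begin

lemma rescaled_exp: "(\<lambda>n. c n * (exp (u n) - 1)) \<longlonglongrightarrow> A"
proof -
  have "((\<lambda>x. exp x - 1) has_real_derivative 1) (at 0)" by (auto intro!: derivative_eq_intros)
  from tendsto_rescaled[OF this _ u c] show ?thesis by simp
qed

lemma rescaled_exp_minus: "(\<lambda>n. c n * (exp (- u n) - 1)) \<longlonglongrightarrow> - A"
proof -
  have "((\<lambda>x. exp (- x) - 1) has_real_derivative - 1) (at 0)" by (auto intro!: derivative_eq_intros)
  from tendsto_rescaled[OF this _ u c] show ?thesis by simp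
qed

lemma rescaled_sin: "(\<lambda>n. c n * sin (v n)) \<longlonglongrightarrow> B"
proof -
  have "(sin has_real_derivative 1) (at 0)" by (auto intro!: derivative_eq_intros)
  from tendsto_rescaled[OF this _ v c] show ?thesis by simp
qed

lemma rescaled_cos: "(\<lambda>n. c n * (cos (v n) - 1)) \<longlonglongrightarrow> 0"
proof -
  have "((\<lambda>x. cos x - 1) has_real_derivative 0) (at 0)" by (auto intro!: derivative_eq_intros)
  from tendsto_rescaled[OF this _ v c] show ?thesis by simp
qed

lemma rescaled_exp_cis: "(\<lambda>n. of_real (c n) * (of_real (exp (- u n)) - cis (v n))) \<longlonglongrightarrow> - of_real A - \<i> * of_real B"
proof -
  have "(\<lambda>n. of_real (c n * (exp (- u n) - 1)) - of_real (c n * (cos (v n) - 1)) - \<i> * of_real (c n * sin (v n)))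
      \<longlonglongrightarrow> of_real (- A) - of_real 0 - \<i> * of_real B"
    by (intro tendsto_intros rescaled_exp_minus rescaled_cos rescaled_sin)
  then show ?thesis by (simp add: cis_conv_exp exp_Euler cos_of_real sin_of_real algebra_simps)
qed

lemma rescaled_square: "(\<lambda>n. (c n)\<^sup>2 * ((exp (u n) + exp (- u n)) / 2 - cos (v n))) \<longlonglongrightarrow> (A\<^sup>2 + B\<^sup>2) / 2"
proof -
  have "(\<lambda>n. c n * sinh (u n / 2)) \<longlonglongrightarrow> 1 / 2 * A"
    by (rule tendsto_rescaled[OF _ _ u c, of "\<lambda>x. sinh (x / 2)"]) (auto intro!: derivative_eq_intros)
  moreover have "(\<lambda>n. c n * sin (v n / 2)) \<longlonglongrightarrow> 1 / 2 * B"
    by (rule tendsto_rescaled[OF _ _ v c, of "\<lambda>x. sin (x / 2)"]) (auto intro!: derivative_eq_intros)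
  ultimately have lim: "(\<lambda>n. 2 * (c n * sinh (u n / 2))\<^sup>2 + 2 * (c n * sin (v n / 2))\<^sup>2) \<longlonglongrightarrow>
      2 * (1 / 2 * A)\<^sup>2 + 2 * (1 / 2 * B)\<^sup>2"
    by (intro tendsto_add tendsto_mult_left tendsto_power)
  \<comment> \<open>Half angle formulas turn the second order expression into squares of first order ones.\<close>
  have "2 * (sinh (x / 2))\<^sup>2 = (exp x + exp (- x)) / 2 - 1" for x :: real
  proof -
    have "exp x = (exp (x / 2))\<^sup>2" "exp (- x) = (exp (- (x / 2)))\<^sup>2"
      by (simp_all flip: exp_double)
    moreover have "exp (x / 2) * exp (- (x / 2)) = 1" by (simp flip: exp_add)
    ultimately show ?thesis by (simp add: sinh_def power2_eq_square field_simps)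
  qed
  moreover have "2 * (sin (x / 2))\<^sup>2 = 1 - cos x" for x :: real
    using cos_double_sin[of "x / 2"] by simp
  ultimately have eq: "2 * (c n * sinh (u n / 2))\<^sup>2 + 2 * (c n * sin (v n / 2))\<^sup>2 =
      (c n)\<^sup>2 * ((exp (u n) + exp (- u n)) / 2 - 1) + (c n)\<^sup>2 * (1 - cos (v n))" for n
    by (simp only: power_mult_distrib mult.left_commute[of 2])
  from lim have "(\<lambda>n. (c n)\<^sup>2 * ((exp (u n) + exp (- u n)) / 2 - 1) + (c n)\<^sup>2 * (1 - cos (v n)))
      \<longlonglongrightarrow> 2 * (1 / 2 * A)\<^sup>2 + 2 * (1 / 2 * B)\<^sup>2"
    unfolding eq .
  moreover have "a * (x - 1) + a * (1 - y) = a * (x - y)" for a x y :: real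
    by (simp add: algebra_simps)
  moreover have "2 * (1 / 2 * A)\<^sup>2 + 2 * (1 / 2 * B)\<^sup>2 = (A\<^sup>2 + B\<^sup>2) / 2"
    by (simp add: power2_eq_square add_divide_distrib)
  ultimately show ?thesis by (simp only:)
qed

lemma rescaled_sin_error: "(\<lambda>n. (c n)\<^sup>2 * (sin (v n) - v n)) \<longlonglongrightarrow> 0"
proof (rule tendsto_rabs_zero_cancel, rule tendsto_sandwich[OF _ _ tendsto_const])
  have "v \<longlonglongrightarrow> 0" by (rule tendsto_zero_if_rescaled_convergent[OF v c])
  then have "(\<lambda>n. (c n * v n)\<^sup>2 * \<bar>v n\<bar> / 6) \<longlonglongrightarrow> B\<^sup>2 * \<bar>0\<bar> / 6"
    by (intro tendsto_intros v) auto
  then show "(\<lambda>n. (c n * v n)\<^sup>2 * \<bar>v n\<bar> / 6) \<longlonglongrightarrow> 0" by simp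
  have "\<bar>(c n)\<^sup>2 * (sin (v n) - v n)\<bar> \<le> (c n * v n)\<^sup>2 * \<bar>v n\<bar> / 6" for n
  proof -
    have "(c n)\<^sup>2 * \<bar>sin (v n) - v n\<bar> \<le> (c n)\<^sup>2 * (\<bar>v n\<bar> ^ 3 / 6)"
      by (intro mult_left_mono abs_sin_minus_self_le) simp
    also have "\<dots> = (c n * v n)\<^sup>2 * \<bar>v n\<bar> / 6"
      by (simp add: power_mult_distrib power3_eq_cube power2_eq_square)
    finally show ?thesis by (simp add: abs_mult)
  qed
  then show "\<forall>\<^sub>F n in sequentially. \<bar>(c n)\<^sup>2 * (sin (v n) - v n)\<bar> \<le> (c n * v n)\<^sup>2 * \<bar>v n\<bar> / 6"
    by simp
qed simp

lemma rescaled_sinh_error: "(\<lambda>n. (c n)\<^sup>2 * (sinh (u n) - u n)) \<longlonglongrightarrow> 0"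
proof (rule tendsto_rabs_zero_cancel, rule tendsto_sandwich[OF _ _ tendsto_const])
  have u0: "u \<longlonglongrightarrow> 0" by (rule tendsto_zero_if_rescaled_convergent[OF u c])
  then have "(\<lambda>n. exp \<bar>u n\<bar> * ((c n * u n)\<^sup>2 * \<bar>u n\<bar>)) \<longlonglongrightarrow> exp \<bar>0\<bar> * (A\<^sup>2 * \<bar>0\<bar>)"
    by (intro tendsto_intros u) auto
  then show "(\<lambda>n. exp \<bar>u n\<bar> * ((c n * u n)\<^sup>2 * \<bar>u n\<bar>)) \<longlonglongrightarrow> 0" by simp
  have "\<bar>(c n)\<^sup>2 * (sinh (u n) - u n)\<bar> \<le> exp \<bar>u n\<bar> * ((c n * u n)\<^sup>2 * \<bar>u n\<bar>)" for n
  proof -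
    have "(c n)\<^sup>2 * \<bar>sinh (u n) - u n\<bar> \<le> (c n)\<^sup>2 * (exp \<bar>u n\<bar> * \<bar>u n\<bar> ^ 3)"
      by (intro mult_left_mono abs_sinh_minus_self_le) simp_all
    also have "\<dots> = exp \<bar>u n\<bar> * ((c n * u n)\<^sup>2 * \<bar>u n\<bar>)"
      by (simp add: power_mult_distrib power3_eq_cube power2_eq_square)
    finally show ?thesis by (simp add: abs_mult)
  qed
  then show "\<forall>\<^sub>F n in sequentially. \<bar>(c n)\<^sup>2 * (sinh (u n) - u n)\<bar> \<le> exp \<bar>u n\<bar> * ((c n * u n)\<^sup>2 * \<bar>u n\<bar>)"
    by simp
qed simp

end

lemma leading_digit:
  fixes d :: "nat \<Rightarrow> int" and c :: "nat \<Rightarrow> real"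
  assumes c: "filterlim c at_top sequentially"
  shows "(\<lambda>n. (\<Sum>i<Suc j. of_int (d i) * c n ^ i) / c n ^ j) \<longlonglongrightarrow> of_int (d j)"
proof (induction j)
  case (Suc j)
  let ?S = "\<lambda>j n. \<Sum>i<Suc j. of_int (d i) * c n ^ i"
  have "(\<lambda>n. ?S j n / c n ^ j / c n + of_int (d (Suc j))) \<longlonglongrightarrow> 0 + of_int (d (Suc j))"
    by (intro tendsto_add tendsto_const tendsto_divide_0[OF Suc.IH])
       (use c filterlim_at_top_imp_at_infinity in blast)
  moreover have "\<forall>\<^sub>F n in sequentially. ?S j n / c n ^ j / c n + of_int (d (Suc j)) = ?S (Suc j) n / c n ^ Suc j"
    using c[unfolded filterlim_at_top_dense, rule_format, of 0]
    by eventually_elim (simp add: add_divide_distrib mult.commute)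
  ultimately show ?case by (simp add: Lim_transform_eventually)
qed simp

lemma digit_expansion_mod:
  fixes d :: "nat \<Rightarrow> int" and c :: int
  assumes "j \<le> l"
  shows "\<exists>N. (\<Sum>i<l. d i * c ^ i) = (\<Sum>i<j. d i * c ^ i) + c ^ j * N"
proof -
  have "(\<Sum>i<l. d i * c ^ i) = (\<Sum>i\<in>{..<j} \<union> {j..<l}. d i * c ^ i)"
    by (simp only: ivl_disj_un_one(2)[OF assms])
  also have "\<dots> = (\<Sum>i<j. d i * c ^ i) + (\<Sum>i\<in>{j..<l}. d i * c ^ i)"
    by (rule sum.union_disjoint) auto
  also have "(\<Sum>i\<in>{j..<l}. d i * c ^ i) = c ^ j * (\<Sum>i\<in>{j..<l}. d i * c ^ (i - j))"
    unfolding sum_distrib_left by (rule sum.cong) (auto simp: mult.left_commute simp flip: power_add)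
  finally show ?thesis by blast
qed

lemma cis_add_2pi_int: "cis (2 * pi * (x + of_int N)) = cis (2 * pi * x)"
  unfolding distrib_left cis_mult[symmetric] by (simp add: cis_multiple_2pi)

text \<open>
  As \<open>cis \<theta>\<close> has modulus 1, a number near it has modulus near 1. So a single estimate controls both the
  dilation and the rotation.
\<close>
lemma column_bounds:
  fixes y \<theta> B \<delta> :: real
  assumes "exp y \<le> B" "1 \<le> B" "norm (of_real (exp (- y)) - cis \<theta>) \<le> \<delta>"
  shows "\<bar>y\<bar> \<le> B * \<delta>" "norm (cis \<theta> - 1) \<le> 2 * \<delta>"
proof -
  have "\<bar>exp (- y) - 1\<bar> \<le> norm (of_real (exp (- y)) - cis \<theta>)"
    using norm_triangle_ineq3[of "of_real (exp (- y)) :: complex" "cis \<theta>"] by simp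
  with assms(3) have *: "\<bar>exp (- y) - 1\<bar> \<le> \<delta>" by simp
  then show "\<bar>y\<bar> \<le> B * \<delta>" by (rule abs_le_if_exp_near_1[OF assms(1,2)])
  have "norm (cis \<theta> - 1) \<le> norm (cis \<theta> - of_real (exp (- y))) + norm (of_real (exp (- y)) - (1::complex))"
    using norm_triangle_ineq[of "cis \<theta> - of_real (exp (- y))" "of_real (exp (- y)) - 1"] by simp
  also have "norm (of_real (exp (- y)) - (1::complex)) = \<bar>exp (- y) - 1\<bar>"
    using norm_of_real[of "exp (- y) - 1", where 'a = complex] by simp
  finally show "norm (cis \<theta> - 1) \<le> 2 * \<delta>" using assms(3) * by (simp add: norm_minus_commute)
qed

section \<open>Isometries of hyperbolic space in horospherical coordinates\<close>

text \<open>
  The forms of both groups: \<open>cj\<close> is the identity over the reals and the complex conjugation over the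
  complex numbers. Only the properties collected in the following locale are used.
\<close>
definition sesquilin :: "('a::field \<Rightarrow> 'a) \<Rightarrow> 'a ^ 'm::finite option \<Rightarrow> 'a ^ 'm option \<Rightarrow> 'a"
  where "sesquilin cj v w = v $ None * cj (w $ None) - (\<Sum>i\<in>UNIV. v $ Some i * cj (w $ Some i))"

locale conjugation =
  fixes cj :: "'a::real_normed_field \<Rightarrow> 'a"
  assumes cj_add: "cj (x + y) = cj x + cj y"
    and cj_mult: "cj (x * y) = cj x * cj y"
    and cj_of_real: "cj (of_real r) = of_real r"
    and mult_cj: "x * cj x = of_real ((norm x)\<^sup>2)"
begin

lemma cj_0 [simp]: "cj 0 = 0" using cj_of_real[of 0] by simp

lemma cj_minus: "cj (- x) = - cj x"
  using cj_add[of x "- x"] by (simp add: eq_neg_iff_add_eq_0 add.commute)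

lemma cj_diff: "cj (x - y) = cj x - cj y"
  using cj_add[of x "- y"] by (simp add: cj_minus)

lemma cj_sum: "cj (sum f A) = (\<Sum>x\<in>A. cj (f x))"
  by (induction A rule: infinite_finite_induct) (auto simp: cj_add)

lemma cj_cj [simp]: "cj (cj x) = x"
proof (cases "x = 0")
  case False
  have "cj x * cj (cj x) = cj (x * cj x)" by (simp add: cj_mult)
  also have "\<dots> = x * cj x" by (simp only: mult_cj cj_of_real)
  finally have "cj x * (cj (cj x) - x) = 0" by (simp add: algebra_simps)
  moreover have "cj x \<noteq> 0" using mult_cj[of x] False by auto
  ultimately show ?thesis by simp
qed simp

lemma norm_cj [simp]: "norm (cj x) = norm x"
proof -
  have "norm x * norm (cj x) = norm x * norm x"
    using arg_cong[OF mult_cj[of x], of norm] by (simp add: norm_mult power2_eq_square)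
  then show ?thesis using cj_cj[of x] by (cases "x = 0") auto
qed

end

lemma conjugation_real: "conjugation (\<lambda>x::real. x)"
  by unfold_locales (auto simp: power2_eq_square)

lemma conjugation_complex: "conjugation cnj"
  by unfold_locales (auto simp: complex_norm_square[symmetric])

lemma quad_form_eq: "quad_form v = sesquilin (\<lambda>x. x) v v"
  by (simp add: quad_form_def sesquilin_def power2_eq_square)

lemma herm_form_eq: "herm_form v w = sesquilin cnj v w"
  by (simp add: herm_form_def sesquilin_def)

text \<open>
  This factor makes the passage to isotropic coordinates an involution.
\<close>
definition half_root :: "'a::real_normed_field"
  where "half_root = of_real (1 / sqrt 2)"

lemma half_root_sq: "half_root * half_root = (1/2 :: 'a::real_normed_field)"
proof -
  have "(1 / sqrt 2) * (1 / sqrt 2) = (1/2 :: real)" by simp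
  then show ?thesis unfolding half_root_def of_real_mult[symmetric] by simp
qed

text \<open>
  Coordinates with respect to a basis that contains two isotropic vectors. The coordinate \<open>None\<close> belongs to
  the vector that represents the boundary point \<open>\<infinity>\<close>, the coordinate \<open>Some i0\<close> to the one that represents
  the origin of the boundary without \<open>\<infinity>\<close>; the remaining coordinates are unchanged and form the transverse
  negative definite space.
\<close>
definition isotropic_coords :: "'m \<Rightarrow> 'a::real_normed_field ^ 'm::finite option \<Rightarrow> 'a ^ 'm option"
  where "isotropic_coords i0 v = (\<chi> k. case k of
      None \<Rightarrow> half_root * (v $ None + v $ Some i0)
    | Some i \<Rightarrow> if i = i0 then half_root * (v $ None - v $ Some i0) else v $ Some i)"

text \<open>
  In isotropic coordinates, the parabolic element fixing \<open>\<infinity>\<close> that moves the origin to the boundary point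
  with the horizontal coordinates \<open>z\<close>. Isometry determines the real part of \<open>\<tau>\<close>; its imaginary part is the
  height of the image point in the Heisenberg group.
\<close>
definition heisenberg :: "('a::real_normed_field \<Rightarrow> 'a) \<Rightarrow> 'm \<Rightarrow> ('m \<Rightarrow> 'a) \<Rightarrow> 'a \<Rightarrow> 'a ^ 'm::finite option \<Rightarrow> 'a ^ 'm option"
  where "heisenberg cj i0 z \<tau> u = (\<chi> k. case k of
      None \<Rightarrow> u $ None + (\<Sum>i\<in>-{i0}. cj (z i) * u $ Some i) + \<tau> * u $ Some i0
    | Some i \<Rightarrow> if i = i0 then u $ Some i0 else u $ Some i + z i * u $ Some i0)"

text \<open>
  In isotropic coordinates, a transformation fixing both \<open>\<infinity>\<close> and the origin. The operator \<open>R\<close>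
  acts on families indexed by all of \<open>'m\<close>, of which the entry at \<open>i0\<close> has no meaning.
\<close>
definition axial :: "'m \<Rightarrow> 'a::real_normed_field \<Rightarrow> 'a \<Rightarrow> (('m \<Rightarrow> 'a) \<Rightarrow> 'm \<Rightarrow> 'a) \<Rightarrow> 'a ^ 'm::finite option \<Rightarrow> 'a ^ 'm option"
  where "axial i0 a d R u = (\<chi> k. case k of
      None \<Rightarrow> a * u $ None
    | Some i \<Rightarrow> if i = i0 then d * u $ Some i0 else R (\<lambda>j. u $ Some j) i)"

definition isotropic_form :: "('a::real_normed_field \<Rightarrow> 'a) \<Rightarrow> 'm \<Rightarrow> 'a ^ 'm::finite option \<Rightarrow> 'a ^ 'm option \<Rightarrow> 'a"
  where "isotropic_form cj i0 u w = u $ None * cj (w $ Some i0) + u $ Some i0 * cj (w $ None)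
    - (\<Sum>i\<in>-{i0}. u $ Some i * cj (w $ Some i))"

text \<open>
  The last clause expresses that the entry at \<open>i0\<close> does not influence the others, so that \<open>R\<close> is an operator
  on the transverse space.
\<close>
definition transverse_unitary :: "('a::real_normed_field \<Rightarrow> 'a) \<Rightarrow> 'm::finite \<Rightarrow> (('m \<Rightarrow> 'a) \<Rightarrow> 'm \<Rightarrow> 'a) \<Rightarrow> bool"
  where "transverse_unitary cj i0 R \<longleftrightarrow>
    (\<forall>u v i. R (\<lambda>j. u j + v j) i = R u i + R v i) \<and>
    (\<forall>k u i. R (\<lambda>j. k * u j) i = k * R u i) \<and>
    (\<forall>u v. (\<Sum>i\<in>-{i0}. R u i * cj (R v i)) = (\<Sum>i\<in>-{i0}. u i * cj (v i))) \<and>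
    (\<forall>u v i. (\<forall>j. j \<noteq> i0 \<longrightarrow> u j = v j) \<longrightarrow> i \<noteq> i0 \<longrightarrow> R u i = R v i)"

lemma isotropic_coords_None [simp]: "isotropic_coords i0 v $ None = half_root * (v $ None + v $ Some i0)"
  and isotropic_coords_i0 [simp]: "isotropic_coords i0 v $ Some i0 = half_root * (v $ None - v $ Some i0)"
  and isotropic_coords_Some [simp]: "i \<noteq> i0 \<Longrightarrow> isotropic_coords i0 v $ Some i = v $ Some i"
  by (simp_all add: isotropic_coords_def)

lemma heisenberg_None [simp]: "heisenberg cj i0 z \<tau> u $ None =
      u $ None + (\<Sum>i\<in>-{i0}. cj (z i) * u $ Some i) + \<tau> * u $ Some i0"
  and heisenberg_i0 [simp]: "heisenberg cj i0 z \<tau> u $ Some i0 = u $ Some i0"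
  and heisenberg_Some [simp]: "i \<noteq> i0 \<Longrightarrow> heisenberg cj i0 z \<tau> u $ Some i = u $ Some i + z i * u $ Some i0"
  by (simp_all add: heisenberg_def)

lemma axial_None [simp]: "axial i0 a d R u $ None = a * u $ None"
  and axial_i0 [simp]: "axial i0 a d R u $ Some i0 = d * u $ Some i0"
  and axial_Some [simp]: "i \<noteq> i0 \<Longrightarrow> axial i0 a d R u $ Some i = R (\<lambda>j. u $ Some j) i"
  by (simp_all add: axial_def)

lemma vec_option_eqI:
  fixes u v :: "'a ^ 'm::finite option"
  assumes "u $ None = v $ None" "u $ Some i0 = v $ Some i0" "\<And>i. i \<noteq> i0 \<Longrightarrow> u $ Some i = v $ Some i"
  shows "u = v"
  using assms by (metis vec_eq_iff option.exhaust)

lemma sum_split_point: "sum f (UNIV :: 'm::finite set) = f i0 + sum f (- {i0})"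
  by (subst sum.remove[of _ i0]) (auto simp: Compl_eq_Diff_UNIV)

lemma isotropic_coords_involution [simp]: "isotropic_coords i0 (isotropic_coords i0 v) = v"
proof -
  have "half_root * (half_root * x + half_root * y) = (x + y) / (2::'a)"
    and "half_root * (half_root * x - half_root * y) = (x - y) / (2::'a)" for x y :: 'a
    by (simp_all only: distrib_left right_diff_distrib mult.assoc[symmetric] half_root_sq)
       (simp_all add: add_divide_distrib diff_divide_distrib)
  note * = this
  show ?thesis
    by (intro vec_option_eqI[of _ _ i0]) (simp_all add: * del: eq_divide_eq_numeral1 divide_eq_eq_numeral1)
qed

context conjugation
begin

lemma isotropic_form_coords:
  "isotropic_form cj i0 (isotropic_coords i0 v) (isotropic_coords i0 w) = sesquilin cj v w"
proof -
  have h: "cj half_root = (half_root :: 'a)" unfolding half_root_def by (rule cj_of_real)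
  have "isotropic_form cj i0 (isotropic_coords i0 v) (isotropic_coords i0 w) =
      half_root * half_root * ((v $ None + v $ Some i0) * (cj (w $ None) - cj (w $ Some i0))
       + (v $ None - v $ Some i0) * (cj (w $ None) + cj (w $ Some i0)))
      - (\<Sum>i\<in>-{i0}. v $ Some i * cj (w $ Some i))"
    by (simp add: isotropic_form_def cj_mult cj_add cj_diff h algebra_simps)
  also have "\<dots> = sesquilin cj v w"
    unfolding half_root_sq sesquilin_def sum_split_point[of _ i0] by (simp add: algebra_simps)
  finally show ?thesis .
qed

lemma sesquilin_coords:
  "sesquilin cj (isotropic_coords i0 v) (isotropic_coords i0 w) = isotropic_form cj i0 v w"
  using isotropic_form_coords[of i0 "isotropic_coords i0 v" "isotropic_coords i0 w"] by simp

text \<open>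
  The hypothesis on \<open>\<tau>\<close> says that the image of the isotropic vector that represents the origin, which
  has the coordinates \<open>\<tau>\<close>, \<open>1\<close> and \<open>z\<close>, is isotropic.
\<close>
lemma heisenberg_isometry:
  assumes "\<tau> + cj \<tau> = (\<Sum>i\<in>-{i0}. z i * cj (z i))"
  shows "isotropic_form cj i0 (heisenberg cj i0 z \<tau> u) (heisenberg cj i0 z \<tau> w) = isotropic_form cj i0 u w"
proof -
  define u0 w0 where "u0 = u $ Some i0" and "w0 = cj (w $ Some i0)"
  define S where "S = (\<Sum>i\<in>-{i0}. (u $ Some i + z i * u0) * cj (w $ Some i + z i * w $ Some i0))"
  have "S = (\<Sum>i\<in>-{i0}. u $ Some i * cj (w $ Some i)) + (\<Sum>i\<in>-{i0}. cj (z i) * u $ Some i) * w0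
      + u0 * (\<Sum>i\<in>-{i0}. z i * cj (w $ Some i)) + u0 * w0 * (\<Sum>i\<in>-{i0}. z i * cj (z i))"
    by (simp add: S_def w0_def cj_add cj_mult algebra_simps sum.distrib sum_distrib_left)
  also have "u0 * w0 * (\<Sum>i\<in>-{i0}. z i * cj (z i)) = u0 * w0 * \<tau> + u0 * w0 * cj \<tau>"
    unfolding assms[symmetric] by (simp add: algebra_simps)
  finally have S: "S = (\<Sum>i\<in>-{i0}. u $ Some i * cj (w $ Some i)) + (\<Sum>i\<in>-{i0}. cj (z i) * u $ Some i) * w0
      + u0 * (\<Sum>i\<in>-{i0}. z i * cj (w $ Some i)) + (u0 * w0 * \<tau> + u0 * w0 * cj \<tau>)" .
  have "isotropic_form cj i0 (heisenberg cj i0 z \<tau> u) (heisenberg cj i0 z \<tau> w) =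
      (u $ None + (\<Sum>i\<in>-{i0}. cj (z i) * u $ Some i) + \<tau> * u0) * w0
      + u0 * (cj (w $ None) + (\<Sum>i\<in>-{i0}. z i * cj (w $ Some i)) + cj \<tau> * w0) - S"
    by (simp add: isotropic_form_def S_def u0_def w0_def cj_add cj_mult cj_sum)
  also have "\<dots> = isotropic_form cj i0 u w"
    unfolding S isotropic_form_def u0_def w0_def by (simp add: algebra_simps)
  finally show ?thesis .
qed

lemma heisenberg_inverse:
  assumes "\<tau> + cj \<tau> = (\<Sum>i\<in>-{i0}. z i * cj (z i))"
  shows "heisenberg cj i0 z \<tau> (heisenberg cj i0 (\<lambda>i. - z i) (cj \<tau>) u) = u"
    and "heisenberg cj i0 (\<lambda>i. - z i) (cj \<tau>) (heisenberg cj i0 z \<tau> u) = u"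
proof -
  have *: "(\<Sum>i\<in>-{i0}. cj (z i) * (u $ Some i + z i * k)) =
      (\<Sum>i\<in>-{i0}. cj (z i) * u $ Some i) + (\<tau> + cj \<tau>) * k" for k
    unfolding assms by (simp add: algebra_simps sum.distrib sum_distrib_left)
  show "heisenberg cj i0 z \<tau> (heisenberg cj i0 (\<lambda>i. - z i) (cj \<tau>) u) = u"
    using *[of "- u $ Some i0"]
    by (intro vec_option_eqI[of _ _ i0]) (simp_all add: cj_minus sum_negf distrib_right)
  show "heisenberg cj i0 (\<lambda>i. - z i) (cj \<tau>) (heisenberg cj i0 z \<tau> u) = u"
    using *[of "u $ Some i0"]
    by (intro vec_option_eqI[of _ _ i0]) (simp_all add: cj_minus sum_negf distrib_right)
qed

lemma axial_isometry:
  assumes "transverse_unitary cj i0 R" "a * cj d = 1"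
  shows "isotropic_form cj i0 (axial i0 a d R u) (axial i0 a d R w) = isotropic_form cj i0 u w"
proof -
  have "d * cj a = 1" using arg_cong[OF assms(2), of cj] cj_of_real[of 1]
    by (simp add: cj_mult mult.commute)
  have *: "a * x * (cj d * y) = x * y" "d * x * (cj a * y) = x * y" for x y
  proof -
    have "a * x * (cj d * y) = (a * cj d) * (x * y)" "d * x * (cj a * y) = (d * cj a) * (x * y)"
      by (simp_all only: ac_simps)
    then show "a * x * (cj d * y) = x * y" "d * x * (cj a * y) = x * y"
      using assms(2) \<open>d * cj a = 1\<close> by simp_all
  qed
  have "(\<Sum>i\<in>-{i0}. R (\<lambda>j. u $ Some j) i * cj (R (\<lambda>j. w $ Some j) i)) =
      (\<Sum>i\<in>-{i0}. u $ Some i * cj (w $ Some i))"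
    using assms(1) by (auto simp: transverse_unitary_def)
  then show ?thesis by (simp add: isotropic_form_def cj_mult *)
qed

end

text \<open>
  The transformation fixing \<open>\<infinity>\<close> and the boundary point with coordinates \<open>z\<close> and \<open>\<tau>\<close>, first in isotropic
  and then in the standard coordinates. The map with parameters \<open>- z\<close> and \<open>cj \<tau>\<close> inverts the parabolic
  element with parameters \<open>z\<close> and \<open>\<tau>\<close>.
\<close>
definition conj_axial where
  "conj_axial cj i0 z \<tau> a d R u =
     heisenberg cj i0 z \<tau> (axial i0 a d R (heisenberg cj i0 (\<lambda>i. - z i) (cj \<tau>) u))"

definition isometry_map where
  "isometry_map cj i0 z \<tau> a d R v =
     isotropic_coords i0 (conj_axial cj i0 z \<tau> a d R (isotropic_coords i0 v))"

lemma linear_vecI: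
  assumes "\<And>x y. f (x + y) = f x + f y" "\<And>c x. f (c *s x) = c *s f x"
  shows "Vector_Spaces.linear (*s) (*s) f"
  unfolding Vector_Spaces.linear_iff
  by (intro conjI allI assms) (rule vec.vector_space_axioms)+

lemma linear_isotropic_coords: "Vector_Spaces.linear (*s) (*s) (isotropic_coords i0)"
  by (auto intro!: linear_vecI vec_option_eqI[of _ _ i0] simp: algebra_simps)

lemma linear_heisenberg: "Vector_Spaces.linear (*s) (*s) (heisenberg cj i0 z \<tau>)"
  by (auto intro!: linear_vecI vec_option_eqI[of _ _ i0] simp: algebra_simps sum.distrib sum_distrib_left)

lemma linear_axial:
  assumes "transverse_unitary cj i0 R"
  shows "Vector_Spaces.linear (*s) (*s) (axial i0 a d R)"
  using assms
  by (auto intro!: linear_vecI vec_option_eqI[of _ _ i0] simp: algebra_simps transverse_unitary_def)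

lemma isometry_map_compose:
  "isometry_map cj i0 z \<tau> a d R = isotropic_coords i0 \<circ> heisenberg cj i0 z \<tau> \<circ> axial i0 a d R \<circ>
     heisenberg cj i0 (\<lambda>i. - z i) (cj \<tau>) \<circ> isotropic_coords i0"
  by (auto simp: isometry_map_def conj_axial_def)

lemma linear_isometry_map:
  assumes "transverse_unitary cj i0 R"
  shows "Vector_Spaces.linear (*s) (*s) (isometry_map cj i0 z \<tau> a d R)"
  unfolding isometry_map_compose
  by (intro Vector_Spaces.linear_compose[of "(*s)" "(*s)" _ "(*s)"] linear_isotropic_coords
      linear_heisenberg linear_axial[OF assms])


definition isometry_matrix where
  "isometry_matrix cj i0 z \<tau> a d R = matrix (isometry_map cj i0 z \<tau> a d R)"

lemma isometry_matrix_apply: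
  assumes "transverse_unitary cj i0 R"
  shows "isometry_matrix cj i0 z \<tau> a d R *v v = isometry_map cj i0 z \<tau> a d R v"
  unfolding isometry_matrix_def by (rule matrix_works[OF linear_isometry_map[OF assms]])

context conjugation
begin

lemma isometry_map_isometry:
  assumes "transverse_unitary cj i0 R" "a * cj d = 1"
    and "\<tau> + cj \<tau> = (\<Sum>i\<in>-{i0}. z i * cj (z i))"
  shows "sesquilin cj (isometry_map cj i0 z \<tau> a d R v) (isometry_map cj i0 z \<tau> a d R w) = sesquilin cj v w"
proof -
  have inv: "cj \<tau> + cj (cj \<tau>) = (\<Sum>i\<in>-{i0}. - z i * cj (- z i))"
    using assms(3) by (simp add: cj_minus add.commute)
  show ?thesis
    by (simp only: isometry_map_def conj_axial_def sesquilin_coords heisenberg_isometry[OF assms(3)]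
        axial_isometry[OF assms(1,2)] heisenberg_isometry[OF inv] isotropic_form_coords)
qed

lemma axial_axial:
  assumes "transverse_unitary cj i0 R"
  shows "axial i0 a d R (axial i0 a' d' R' u) = axial i0 (a * a') (d * d') (\<lambda>u. R (R' u)) u"
  using assms unfolding transverse_unitary_def
  by (intro vec_option_eqI[of _ _ i0]) (auto simp: mult.assoc)

lemma isometry_matrix_mult:
  assumes "transverse_unitary cj i0 R" "transverse_unitary cj i0 R'"
    and "\<tau> + cj \<tau> = (\<Sum>i\<in>-{i0}. z i * cj (z i))"
  shows "isometry_matrix cj i0 z \<tau> a d R ** isometry_matrix cj i0 z \<tau> a' d' R' =
    isometry_matrix cj i0 z \<tau> (a * a') (d * d') (\<lambda>u. R (R' u))"
proof -
  have RR': "transverse_unitary cj i0 (\<lambda>u. R (R' u))"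
  proof -
    have "R' (\<lambda>j. u j + v j) = (\<lambda>j. R' u j + R' v j)" for u v
      using assms(2) by (auto simp: transverse_unitary_def)
    then have "R (R' (\<lambda>j. u j + v j)) i = R (R' u) i + R (R' v) i" for u v i
      using assms(1) by (auto simp: transverse_unitary_def)
    moreover have "R' (\<lambda>j. k * u j) = (\<lambda>j. k * R' u j)" for k u
      using assms(2) by (auto simp: transverse_unitary_def)
    then have "R (R' (\<lambda>j. k * u j)) i = k * R (R' u) i" for k u i
      using assms(1) by (auto simp: transverse_unitary_def)
    moreover have "R (R' u) i = R (R' v) i" if "\<forall>j. j \<noteq> i0 \<longrightarrow> u j = v j" "i \<noteq> i0" for u v i
    proof -
      have "\<forall>j. j \<noteq> i0 \<longrightarrow> R' u j = R' v j"
        using assms(2) that(1) unfolding transverse_unitary_def by blast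
      then show ?thesis using assms(1) that(2) unfolding transverse_unitary_def by blast
    qed
    moreover have "(\<Sum>i\<in>-{i0}. R (R' u) i * cj (R (R' v) i)) = (\<Sum>i\<in>-{i0}. u i * cj (v i))" for u v
      using assms by (simp add: transverse_unitary_def)
    ultimately show ?thesis unfolding transverse_unitary_def by blast
  qed
  have "isometry_map cj i0 z \<tau> a d R (isometry_map cj i0 z \<tau> a' d' R' v) =
    isometry_map cj i0 z \<tau> (a * a') (d * d') (\<lambda>u. R (R' u)) v" for v
    by (simp add: isometry_map_def conj_axial_def heisenberg_inverse[OF assms(3)] axial_axial[OF assms(1)])
  then show ?thesis
    by (simp add: matrix_eq isometry_matrix_apply assms RR' flip: matrix_vector_mul_assoc)
qed

lemma isometry_matrix_one:
  assumes "\<tau> + cj \<tau> = (\<Sum>i\<in>-{i0}. z i * cj (z i))"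
  shows "isometry_matrix cj i0 z \<tau> 1 1 (\<lambda>u. u) = mat 1"
proof -
  have "transverse_unitary cj i0 (\<lambda>u. u)" by (simp add: transverse_unitary_def)
  moreover have "axial i0 1 1 (\<lambda>u. u) u = u" for u :: "'a ^ _ option"
    by (intro vec_option_eqI[of _ _ i0]) simp_all
  then have "isometry_map cj i0 z \<tau> 1 1 (\<lambda>u. u) v = v" for v
    by (simp add: isometry_map_def conj_axial_def heisenberg_inverse[OF assms])
  ultimately show ?thesis by (simp add: matrix_eq isometry_matrix_apply)
qed

lemma conj_axial_i0: "conj_axial cj i0 z \<tau> a d R u $ Some i0 = d * u $ Some i0"
  by (simp add: conj_axial_def)

lemma conj_axial_Some:
  assumes "transverse_unitary cj i0 R" "i \<noteq> i0"
  shows "conj_axial cj i0 z \<tau> a d R u $ Some i = R (\<lambda>j. u $ Some j) i + (d * z i - R z i) * u $ Some i0"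
proof -
  have add: "R (\<lambda>j. u j + v j) i = R u i + R v i" and scale: "R (\<lambda>j. k * u j) i = k * R u i" for u v k
    using assms(1) by (auto simp: transverse_unitary_def)
  have "R (\<lambda>j. heisenberg cj i0 (\<lambda>i. - z i) (cj \<tau>) u $ Some j) i =
      R (\<lambda>j. u $ Some j + (- u $ Some i0) * z j) i"
    using assms unfolding transverse_unitary_def by (auto simp: mult.commute)
  also have "\<dots> = R (\<lambda>j. u $ Some j) i - u $ Some i0 * R z i"
    unfolding add scale by simp
  finally show ?thesis using assms(2) by (simp add: conj_axial_def algebra_simps)
qed

text \<open>
  The coefficient of \<open>u $ Some i0\<close> in the last summand is the displacement of the origin in the direction of
  \<open>\<infinity>\<close>; its imaginary part gives the vertical displacement.
\<close>
lemma conj_axial_None: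
  assumes "transverse_unitary cj i0 R"
  shows "conj_axial cj i0 z \<tau> a d R u $ None = a * u $ None
    + (\<Sum>i\<in>-{i0}. cj (z i) * (R (\<lambda>j. u $ Some j) i - a * u $ Some i))
    + (d * \<tau> + a * cj \<tau> - (\<Sum>i\<in>-{i0}. cj (z i) * R z i)) * u $ Some i0"
proof -
  let ?w = "heisenberg cj i0 (\<lambda>i. - z i) (cj \<tau>) u"
  have R_w: "R (\<lambda>j. ?w $ Some j) i = R (\<lambda>j. u $ Some j) i - R z i * u $ Some i0" if "i \<noteq> i0" for i
    using conj_axial_Some[OF assms that, of z \<tau> a d u] that by (simp add: conj_axial_def algebra_simps)
  have "(\<Sum>i\<in>-{i0}. cj (z i) * R (\<lambda>j. ?w $ Some j) i) =
      (\<Sum>i\<in>-{i0}. cj (z i) * (R (\<lambda>j. u $ Some j) i - R z i * u $ Some i0))"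
  proof (rule sum.cong[OF refl])
    fix i assume "i \<in> -{i0}"
    then have "i \<noteq> i0" by simp
    from R_w[OF this] show "cj (z i) * R (\<lambda>j. ?w $ Some j) i = cj (z i) * (R (\<lambda>j. u $ Some j) i - R z i * u $ Some i0)"
      by (simp only:)
  qed
  then have "(\<Sum>i\<in>-{i0}. cj (z i) * R (\<lambda>j. ?w $ Some j) i) =
      (\<Sum>i\<in>-{i0}. cj (z i) * R (\<lambda>j. u $ Some j) i) - (\<Sum>i\<in>-{i0}. cj (z i) * R z i) * u $ Some i0"
    by (simp add: algebra_simps sum_subtractf sum_distrib_left)
  then show ?thesis
    by (simp add: conj_axial_def cj_minus sum_negf algebra_simps sum_subtractf sum_distrib_left)
qed

end

lemma invariant_line_eigenvector:
  fixes A :: "'a::field ^ 'n ^ 'n"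
  assumes "(*v) A ` vec.span {v} = vec.span {v}"
  obtains \<mu> where "A *v v = \<mu> *s v"
proof -
  have "v \<in> vec.span {v}" by (simp add: vec.span_base)
  then have "A *v v \<in> vec.span {v}" using assms by blast
  then show thesis using that by (auto simp: vec.span_singleton)
qed

text \<open>
  The vectors \<open>e\<close> and \<open>f\<close> span the two fixed boundary points, \<open>\<alpha>\<close> and \<open>\<beta>\<close> are the coordinates along them
  and \<open>\<nu>\<close> is the square of the norm of the transverse part. An eigenvector has \<open>\<alpha> v = 0\<close> or \<open>\<beta> v = 0\<close>, because
  the eigenvalues \<open>a\<close> and \<open>d\<close> differ. On such vectors the form is \<open>- \<nu>\<close>, so there is no positive
  eigenvector, and the isotropic ones are multiples of \<open>e\<close> or of \<open>f\<close>.
\<close>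
lemma loxodromicI:
  fixes A :: "'a::real_normed_field ^ 'n ^ 'n" and q :: "'a ^ 'n \<Rightarrow> real"
    and a d :: 'a and e f :: "'a ^ 'n"
    and \<alpha> \<beta> :: "'a ^ 'n \<Rightarrow> 'a" and \<nu> :: "'a ^ 'n \<Rightarrow> real"
  assumes scale: "\<And>k v. \<alpha> (k *s v) = k * \<alpha> v" "\<And>k v. \<beta> (k *s v) = k * \<beta> v"
    and A: "\<And>v. \<alpha> (A *v v) = a * \<alpha> v" "\<And>v. \<beta> (A *v v) = d * \<beta> v" "\<And>v. \<nu> (A *v v) = \<nu> v"
    and ad: "norm a > 1" "norm d < 1" "d \<noteq> 0"
    and \<nu>: "\<And>v. \<nu> v \<ge> 0"
    and q: "\<And>v. \<alpha> v = 0 \<or> \<beta> v = 0 \<Longrightarrow> q v = - \<nu> v"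
    and e: "\<alpha> e = 1" "\<beta> e = 0" "\<nu> e = 0" and f: "\<alpha> f = 0" "\<beta> f = 1" "\<nu> f = 0"
    and span: "\<And>v. \<nu> v = 0 \<Longrightarrow> v = \<alpha> v *s e + \<beta> v *s f"
  shows "loxodromic q A"
proof -
  have eigen: "q v = 0 \<and> (vec.span {v} = vec.span {e} \<or> vec.span {v} = vec.span {f}) \<or> q v < 0"
    if "A *v v = \<mu> *s v" "v \<noteq> 0" for v \<mu>
  proof -
    have "\<mu> * \<alpha> v = a * \<alpha> v" "\<mu> * \<beta> v = d * \<beta> v"
      using A(1)[of v] A(2)[of v] unfolding that(1) scale by blast+
    then have "(\<mu> = a \<or> \<alpha> v = 0) \<and> (\<mu> = d \<or> \<beta> v = 0)"
      by auto
    moreover have "a \<noteq> d" using ad by auto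
    ultimately have ab: "\<alpha> v = 0 \<or> \<beta> v = 0" by auto
    show ?thesis
    proof (cases "\<nu> v = 0")
      case False
      then show ?thesis using \<nu>[of v] q[OF ab] by auto
    next
      case True
      have v: "v = \<alpha> v *s e + \<beta> v *s f" by (rule span[OF True])
      have sp: "vec.span {k *s x} = vec.span {x}" if "k \<noteq> 0" for k and x :: "'a ^ 'n"
        using that vec.span_image_scale[of "{x}" "\<lambda>_. k"] by simp
      from ab show ?thesis
      proof
        assume "\<alpha> v = 0"
        with v that(2) have "v = \<beta> v *s f" "\<beta> v \<noteq> 0" by auto
        then have "vec.span {v} = vec.span {f}" using sp[of "\<beta> v" f] by simp
        then show ?thesis using q[OF ab] True by simp
      next
        assume "\<beta> v = 0"
        with v that(2) have "v = \<alpha> v *s e" "\<alpha> v \<noteq> 0" by auto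
        then have "vec.span {v} = vec.span {e}" using sp[of "\<alpha> v" e] by simp
        then show ?thesis using q[OF ab] True by simp
      qed
    qed
  qed
  have zero: "\<alpha> 0 = 0" "\<beta> 0 = 0"
    using scale(1)[of 0 0] scale(2)[of 0 0] by simp_all
  have ef: "A *v e = a *s e" "A *v f = d *s f"
    using span[of "A *v e"] span[of "A *v f"] by (simp_all add: A e f)
  have inv: "(*v) A ` vec.span {x} = vec.span {x}" if "A *v x = k *s x" "k \<noteq> 0" for x k
  proof -
    have *: "A *v (c *s x) = (c * k) *s x" for c
      using that(1) by (simp add: vec.scale vector_smult_assoc)
    show ?thesis
    proof
      show "(*v) A ` vec.span {x} \<subseteq> vec.span {x}"
        by (auto simp: vec.span_singleton *)
      show "vec.span {x} \<subseteq> (*v) A ` vec.span {x}"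
      proof
        fix y assume "y \<in> vec.span {x}"
        then obtain c where "y = c *s x" by (auto simp: vec.span_singleton)
        then have "y = A *v ((c / k) *s x)" using that(2) by (simp add: *)
        then show "y \<in> (*v) A ` vec.span {x}" by (auto simp: vec.span_singleton)
      qed
    qed
  qed
  have "a \<noteq> 0" using ad by auto
  have "{L \<in> hyperbolic_boundary q. (*v) A ` L = L} = {vec.span {e}, vec.span {f}}"
  proof (intro equalityI subsetI)
    fix L assume "L \<in> {L \<in> hyperbolic_boundary q. (*v) A ` L = L}"
    then obtain v where v: "L = vec.span {v}" "v \<noteq> 0" "q v = 0" "(*v) A ` vec.span {v} = vec.span {v}"
      by (auto simp: hyperbolic_boundary_def)
    then show "L \<in> {vec.span {e}, vec.span {f}}"
      using invariant_line_eigenvector[OF v(4)] eigen[of v] by (metis insert_iff less_irrefl)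
  next
    fix L assume "L \<in> {vec.span {e}, vec.span {f}}"
    moreover have "e \<noteq> 0" "f \<noteq> 0" using e f zero by auto
    moreover have "q e = 0" "q f = 0" using q[of e] q[of f] e f by simp_all
    ultimately show "L \<in> {L \<in> hyperbolic_boundary q. (*v) A ` L = L}"
      using inv[OF ef(1) \<open>a \<noteq> 0\<close>] inv[OF ef(2) ad(3)] by (auto simp: hyperbolic_boundary_def)
  qed
  moreover have "vec.span {e} \<noteq> vec.span {f}"
  proof
    assume "vec.span {e} = vec.span {f}"
    then have "e \<in> vec.span {f}" by (metis insertI1 vec.span_base)
    then obtain k where "e = k *s f" by (auto simp: vec.span_singleton)
    then have "\<alpha> e = k * \<alpha> f" by (simp add: scale)
    then show False using e f by simp
  qed
  moreover have "(*v) A ` L \<noteq> L" if L: "L \<in> hyperbolic_space q" for L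
  proof
    assume "(*v) A ` L = L"
    moreover obtain v where v: "L = vec.span {v}" "q v > 0" using L by (auto simp: hyperbolic_space_def)
    ultimately obtain \<mu> where "A *v v = \<mu> *s v" using invariant_line_eigenvector by metis
    moreover have "v \<noteq> 0" using v(2) q[of 0] \<nu>[of 0] zero by auto
    ultimately show False using eigen[of v \<mu>] v(2) by auto
  qed
  ultimately show ?thesis by (simp add: loxodromic_def)
qed

context conjugation
begin

lemma isometry_matrix_loxodromic:
  assumes R: "transverse_unitary cj i0 R" and ad: "a * cj d = 1" and a: "norm a > 1"
    and \<tau>: "\<tau> + cj \<tau> = (\<Sum>i\<in>-{i0}. z i * cj (z i))"
    and q: "\<And>v r. sesquilin cj v v = of_real r \<Longrightarrow> q v = r"
  shows "loxodromic q (isometry_matrix cj i0 z \<tau> a d R)"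
proof -
  define T where "T v = heisenberg cj i0 (\<lambda>i. - z i) (cj \<tau>) (isotropic_coords i0 v)" for v
  define U where "U u = isotropic_coords i0 (heisenberg cj i0 z \<tau> u)" for u
  have TU: "T (U u) = u" and UT: "U (T u) = u" for u
    by (simp_all add: T_def U_def heisenberg_inverse[OF \<tau>])
  have T_scale: "T (k *s v) = k *s T v" and U_lin: "U (k *s v) = k *s U v" "U (v + w) = U v + U w" for k v w
    by (simp_all add: T_def U_def vec.linear_scale[OF linear_isotropic_coords] vec.linear_add[OF linear_isotropic_coords]
        vec.linear_scale[OF linear_heisenberg] vec.linear_add[OF linear_heisenberg])
  have T_form: "sesquilin cj v w = isotropic_form cj i0 (T v) (T w)" for v w
  proof -
    have "cj \<tau> + cj (cj \<tau>) = (\<Sum>i\<in>-{i0}. - z i * cj (- z i))"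
      using \<tau> by (simp add: cj_minus add.commute)
    then show ?thesis unfolding T_def by (simp only: heisenberg_isometry isotropic_form_coords)
  qed
  have TA: "T (isometry_matrix cj i0 z \<tau> a d R *v v) = axial i0 a d R (T v)" for v
    unfolding isometry_matrix_apply[OF R] T_def isometry_map_def conj_axial_def
    by (simp add: heisenberg_inverse[OF \<tau>])
  define \<nu> where "\<nu> v = (\<Sum>i\<in>-{i0}. (norm (T v $ Some i))\<^sup>2)" for v
  have \<nu>_cj: "of_real (\<nu> v) = (\<Sum>i\<in>-{i0}. T v $ Some i * cj (T v $ Some i))" for v
    by (simp add: \<nu>_def mult_cj)
  have "norm a * norm d = 1"
    using arg_cong[OF ad, of norm] by (simp add: norm_mult)
  then have d: "norm d < 1" "d \<noteq> 0"
    using a by (auto simp: field_simps) (metis a less_1_mult less_irrefl linorder_neqE_linordered_idom mult_cancel_left1 norm_ge_zero not_one_le_zero)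
  show ?thesis
  proof (rule loxodromicI[where \<alpha> = "\<lambda>v. T v $ None" and \<beta> = "\<lambda>v. T v $ Some i0" and \<nu> = \<nu>
        and a = a and d = d and e = "U (axis None 1)" and f = "U (axis (Some i0) 1)"])
    fix v
    have "of_real (\<nu> (isometry_matrix cj i0 z \<tau> a d R *v v)) = (of_real (\<nu> v) :: 'a)"
      unfolding \<nu>_cj TA using R by (simp add: transverse_unitary_def)
    then show "\<nu> (isometry_matrix cj i0 z \<tau> a d R *v v) = \<nu> v" by simp
  next
    fix v assume "T v $ None = 0 \<or> T v $ Some i0 = 0"
    then show "q v = - \<nu> v"
      by (intro q) (auto simp: T_form isotropic_form_def \<nu>_cj)
  next
    fix v assume "\<nu> v = 0"
    then have "T v $ Some i = 0" if "i \<noteq> i0" for i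
      using that by (simp add: \<nu>_def sum_nonneg_eq_0_iff)
    then have "T v = T v $ None *s axis None 1 + T v $ Some i0 *s axis (Some i0) 1"
      by (intro vec_option_eqI[of _ _ i0]) (simp_all add: axis_def)
    then have "U (T v) = T v $ None *s U (axis None 1) + T v $ Some i0 *s U (axis (Some i0) 1)"
      by (metis U_lin)
    then show "v = T v $ None *s U (axis None 1) + T v $ Some i0 *s U (axis (Some i0) 1)"
      by (simp only: UT)
  qed (use a d in \<open>simp_all add: T_scale TA TU \<nu>_def sum_nonneg axis_def\<close>)
qed

lemma norm_half_root: "norm (half_root :: 'a) \<le> 1"
  unfolding half_root_def norm_of_real by simp

lemma conj_axial_le:
  assumes R: "transverse_unitary cj i0 R" and B: "norm (isometry_matrix cj i0 z \<tau> a d R) \<le> B"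
    and k: "k = None \<or> k = Some i0"
  shows "norm (conj_axial cj i0 z \<tau> a d R (axis k 1) $ l) \<le> 4 * B"
proof -
  define M where "M = isometry_matrix cj i0 z \<tau> a d R"
  define w where "w = isotropic_coords i0 (axis k (1::'a))"
  have entry: "norm (M $ i $ j) \<le> B" for i j
    using B Finite_Cartesian_Product.norm_nth_le[of "M $ i" j] Finite_Cartesian_Product.norm_nth_le[of M i]
    by (simp add: M_def)
  then have "0 \<le> B" by (meson norm_ge_zero order_trans)
  have w: "w = w $ None *s axis None 1 + w $ Some i0 *s axis (Some i0) 1"
    using k unfolding w_def by (intro vec_option_eqI[of _ _ i0]) (auto simp: axis_def)
  have w_le: "norm (w $ None) \<le> 1" "norm (w $ Some i0) \<le> 1"
    using k norm_half_root by (auto simp: w_def axis_def)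
  have "(M *v w) $ i = M $ i $ None * w $ None + M $ i $ Some i0 * w $ Some i0" for i
  proof -
    have "(M *v axis j 1) $ i = M $ i $ j" for j
      by (simp add: matrix_vector_mult_def axis_def if_distrib cong: if_cong)
    then show ?thesis
      by (subst w) (simp add: matrix_vector_right_distrib vector_scalar_commute mult.commute)
  qed
  moreover have "norm (M $ i $ None * w $ None + M $ i $ Some i0 * w $ Some i0) \<le> B * 1 + B * 1" for i
    by (rule norm_triangle_le, rule add_mono; simp only: norm_mult; rule mult_mono)
       (use entry w_le \<open>0 \<le> B\<close> in auto)
  ultimately have Mw: "norm ((M *v w) $ i) \<le> 2 * B" for i by simp
  have "conj_axial cj i0 z \<tau> a d R (axis k 1) = isotropic_coords i0 (M *v w)"
    by (simp add: M_def isometry_matrix_apply[OF R] isometry_map_def w_def)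
  moreover have "norm (isotropic_coords i0 (M *v w) $ l) \<le> 4 * B"
  proof -
    have *: "norm (half_root * x) \<le> 4 * B" if "norm x \<le> 4 * B" for x :: 'a
      using mult_mono[OF norm_half_root that] \<open>0 \<le> B\<close> by (simp add: norm_mult)
    have "norm ((M *v w) $ None + (M *v w) $ Some i0) \<le> 4 * B"
      "norm ((M *v w) $ None - (M *v w) $ Some i0) \<le> 4 * B"
      using norm_triangle_ineq[of "(M *v w) $ None" "(M *v w) $ Some i0"]
        norm_triangle_ineq4[of "(M *v w) $ None" "(M *v w) $ Some i0"] Mw[of None] Mw[of "Some i0"]
      by linarith+
    moreover have "norm ((M *v w) $ l) \<le> 4 * B" using Mw[of l] \<open>0 \<le> B\<close> by linarith
    ultimately show ?thesis by (auto simp: isotropic_coords_def * split: option.split)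
  qed
  ultimately show ?thesis by simp
qed

text \<open>
  A bounded matrix has bounded entries in isotropic coordinates. The entries listed here are the eigenvalues
  at the two fixed points and the components of the displacement of the origin.
\<close>
lemma isometry_matrix_bounds:
  assumes R: "transverse_unitary cj i0 R" and B: "norm (isometry_matrix cj i0 z \<tau> a d R) \<le> B"
  shows "norm a \<le> 4 * B" "norm d \<le> 4 * B"
    and "i \<noteq> i0 \<Longrightarrow> norm (d * z i - R z i) \<le> 4 * B"
    and "norm (d * \<tau> + a * cj \<tau> - (\<Sum>i\<in>-{i0}. cj (z i) * R z i)) \<le> 4 * B"
proof -
  have "R (\<lambda>j. k * u j) i = k * R u i" for k u i using R by (simp add: transverse_unitary_def)
  from this[of 0 "\<lambda>_. 0"] have R0: "R (\<lambda>j. 0) i = 0" for i by simp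
  have "R (\<lambda>j. axis (Some i0) 1 $ Some j) i = R (\<lambda>j. 0) i" if "i \<noteq> i0" for i
    using R that unfolding transverse_unitary_def by (auto simp: axis_def)
  then have R1: "R (\<lambda>j. axis (Some i0) 1 $ Some j) i = 0" if "i \<noteq> i0" for i
    using R0 that by simp
  have ax: "axis None 1 $ Some j = (0::'a)" for j by (simp add: axis_def)
  have ax1: "axis (Some i0) 1 $ None = (0::'a)" "axis (Some i0) 1 $ Some i0 = (1::'a)"
    "i \<noteq> i0 \<Longrightarrow> axis (Some i0) 1 $ Some i = (0::'a)" for i by (simp_all add: axis_def)
  note le = conj_axial_le[OF R B]
  show "norm a \<le> 4 * B"
    using le[of None None] by (simp add: conj_axial_None[OF R] ax R0)
  show "norm d \<le> 4 * B"
    using le[of "Some i0" "Some i0"] by (simp add: conj_axial_i0)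
  show "norm (d * z i - R z i) \<le> 4 * B" if "i \<noteq> i0"
    using le[of "Some i0" "Some i"] that by (simp add: conj_axial_Some[OF R] R1 ax1)
  have "(\<Sum>i\<in>-{i0}. cj (z i) * (R (\<lambda>j. axis (Some i0) 1 $ Some j) i - a * axis (Some i0) 1 $ Some i)) = 0"
    by (rule sum.neutral) (simp add: R1 ax1)
  then show "norm (d * \<tau> + a * cj \<tau> - (\<Sum>i\<in>-{i0}. cj (z i) * R z i)) \<le> 4 * B"
    using le[of "Some i0" None] by (simp add: conj_axial_None[OF R] ax1)
qed

end

lemma convergent_vecI:
  fixes X :: "nat \<Rightarrow> 'a::real_normed_vector ^ 'n"
  assumes "\<And>i. convergent (\<lambda>n. X n $ i)"
  shows "convergent X"
proof -
  obtain l where "\<And>i. (\<lambda>n. X n $ i) \<longlonglongrightarrow> l i"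
    using assms unfolding convergent_def by metis
  then have "X \<longlonglongrightarrow> (\<chi> i. l i)" by (intro vec_tendstoI) simp
  then show ?thesis by (auto simp: convergent_def)
qed

context conjugation
begin

text \<open>
  The fixed point described by \<open>z\<close> and \<open>\<tau>\<close> may tend to \<open>\<infinity>\<close>, so convergence is required only of the
  combinations that occur as matrix entries.
\<close>
lemma convergent_isometry_matrix:
  fixes a d \<tau> :: "nat \<Rightarrow> 'a" and i0 :: "'m::finite"
  assumes R: "\<And>n. transverse_unitary cj i0 (R n)"
    and a: "convergent a" and d: "convergent d"
    and conv_R: "\<And>u i. i \<noteq> i0 \<Longrightarrow> convergent (\<lambda>n. R n u i)"
    and conv_col: "\<And>i. i \<noteq> i0 \<Longrightarrow> convergent (\<lambda>n. d n * z n i - R n (z n) i)"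
    and conv_row: "\<And>u. convergent (\<lambda>n. \<Sum>i\<in>-{i0}. cj (z n i) * (R n u i - a n * u i))"
    and conv_corner: "convergent (\<lambda>n. d n * \<tau> n + a n * cj (\<tau> n) - (\<Sum>i\<in>-{i0}. cj (z n i) * R n (z n) i))"
  shows "convergent (\<lambda>n. isometry_matrix cj i0 (z n) (\<tau> n) (a n) (d n) (R n))"
proof (intro convergent_vecI)
  fix k l :: "'m option"
  define v where "v = (axis l (1::'a))"
  define Y where "Y n = conj_axial cj i0 (z n) (\<tau> n) (a n) (d n) (R n) (isotropic_coords i0 v)" for n
  have Y: "convergent (\<lambda>n. Y n $ k)" for k
  proof (cases k)
    case None
    show ?thesis unfolding None Y_def conj_axial_None[OF R]
      by (intro convergent_add convergent_mult a conv_row conv_corner convergent_const)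
  next
    case (Some i)
    show ?thesis
    proof (cases "i = i0")
      case True
      show ?thesis unfolding Some True Y_def conj_axial_i0
        by (intro convergent_mult d convergent_const)
    next
      case False
      show ?thesis unfolding Some Y_def conj_axial_Some[OF R False]
        by (intro convergent_add convergent_mult conv_R conv_col False convergent_const)
    qed
  qed
  have "isometry_matrix cj i0 (z n) (\<tau> n) (a n) (d n) (R n) $ k $ l = isotropic_coords i0 (Y n) $ k" for n
    by (simp add: isometry_matrix_def matrix_def isometry_map_def Y_def v_def)
  moreover have "convergent (\<lambda>n. isotropic_coords i0 (Y n) $ k)"
  proof (cases k)
    case None
    then show ?thesis by (simp only: isotropic_coords_None) (intro convergent_mult convergent_add convergent_const Y)
  next
    case (Some i)
    show ?thesis
    proof (cases "i = i0")
      case True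
      show ?thesis unfolding Some True isotropic_coords_i0
        by (intro convergent_mult convergent_diff convergent_const Y)
    next
      case False
      show ?thesis unfolding Some isotropic_coords_Some[OF False] by (rule Y)
    qed
  qed
  ultimately show "convergent (\<lambda>n. isometry_matrix cj i0 (z n) (\<tau> n) (a n) (d n) (R n) $ k $ l)"
    by simp
qed

text \<open>
  The isotropic coordinates and the parabolic element enter together with their inverses, which leaves the
  determinant of a diagonal matrix.
\<close>
lemma det_isometry_matrix:
  fixes i0 :: "'m::finite"
  assumes R: "transverse_unitary cj i0 (\<lambda>u i. b i * u i)"
    and \<tau>: "\<tau> + cj \<tau> = (\<Sum>i\<in>-{i0}. z i * cj (z i))"
  shows "det (isometry_matrix cj i0 z \<tau> a d (\<lambda>u i. b i * u i)) = a * d * (\<Prod>i\<in>-{i0}. b i)"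
proof -
  let ?R = "\<lambda>u i. b i * u i"
  let ?C = "matrix (isotropic_coords i0) :: 'a ^ _ option ^ _ option"
  let ?T = "matrix (heisenberg cj i0 z \<tau>) :: 'a ^ _ option ^ _ option"
  let ?T' = "matrix (heisenberg cj i0 (\<lambda>i. - z i) (cj \<tau>)) :: 'a ^ _ option ^ _ option"
  let ?D = "matrix (axial i0 a d ?R) :: 'a ^ _ option ^ _ option"
  have "isometry_matrix cj i0 z \<tau> a d ?R = ?C ** ?T ** ?D ** ?T' ** ?C"
    by (simp add: matrix_eq isometry_matrix_apply[OF R] matrix_works linear_isotropic_coords
        linear_heisenberg linear_axial[OF R] isometry_map_def conj_axial_def flip: matrix_vector_mul_assoc)
  then have "det (isometry_matrix cj i0 z \<tau> a d ?R) = det (?C ** ?C) * det (?T ** ?T') * det ?D"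
    by (simp add: det_mul)
  also have "?C ** ?C = mat 1"
    by (simp add: matrix_eq matrix_works linear_isotropic_coords flip: matrix_vector_mul_assoc)
  also have "?T ** ?T' = mat 1"
    by (simp add: matrix_eq matrix_works linear_heisenberg heisenberg_inverse[OF \<tau>] flip: matrix_vector_mul_assoc)
  also have "det ?D = (\<Prod>k\<in>UNIV. ?D $ k $ k)"
  proof (rule det_diagonal)
    fix k l :: "'m option" assume "k \<noteq> l"
    then show "?D $ k $ l = 0"
      by (auto simp: matrix_def axial_def axis_def split: option.splits)
  qed
  also have "\<dots> = ?D $ None $ None * (\<Prod>i\<in>UNIV. ?D $ Some i $ Some i)"
    by (simp add: UNIV_option_conv prod.reindex)
  also have "(\<Prod>i\<in>UNIV. ?D $ Some i $ Some i) = ?D $ Some i0 $ Some i0 * (\<Prod>i\<in>-{i0}. ?D $ Some i $ Some i)"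
    by (subst prod.remove[of _ i0]) (auto simp: Compl_eq_Diff_UNIV)
  also have "(\<Prod>i\<in>-{i0}. ?D $ Some i $ Some i) = (\<Prod>i\<in>-{i0}. b i)"
    by (rule prod.cong) (auto simp: matrix_def axial_def axis_def)
  finally show ?thesis by (simp add: matrix_def axis_def)
qed

end

section \<open>The isometry groups\<close>

lemma tendsto_matrix_mult:
  fixes x :: "nat \<Rightarrow> 'a::real_normed_field ^ 'n ^ 'm" and y :: "nat \<Rightarrow> 'a ^ 'k ^ 'n"
  assumes "x \<longlonglongrightarrow> a" "y \<longlonglongrightarrow> b"
  shows "(\<lambda>n. x n ** y n) \<longlonglongrightarrow> a ** b"
  by (intro vec_tendstoI) (auto simp: matrix_matrix_mult_def intro!: tendsto_intros assms)

lemma continuous_on_det: "continuous_on S (det :: 'a::real_normed_field ^ 'n ^ 'n \<Rightarrow> 'a)"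
  unfolding det_def by (intro continuous_intros)

text \<open>
  The values of \<open>Q\<close> may lie in any type: \<open>SU\<close> is the case of the Hermitian form, and \<open>SO_set\<close> the case
  of \<open>\<lambda>v w. quad_form v\<close>.
\<close>
definition special_isometries :: "('a::real_normed_field ^ 'n \<Rightarrow> 'a ^ 'n \<Rightarrow> 'b) \<Rightarrow> ('a ^ 'n ^ 'n) monoid"
  where "special_isometries Q =
    \<lparr>carrier = {A. det A = 1 \<and> (\<forall>v w. Q (A *v v) (A *v w) = Q v w)}, mult = (**), one = mat 1\<rparr>"

lemma group_special_isometries: "group (special_isometries Q)"
proof (rule groupI)
  fix A assume "A \<in> carrier (special_isometries Q)"
  then have A: "det A = 1" "\<And>v w. Q (A *v v) (A *v w) = Q v w" by (auto simp: special_isometries_def)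
  then have "invertible A" by (simp add: invertible_det_nz)
  then obtain A' where inv: "A ** A' = mat 1" "A' ** A = mat 1"
    by (auto simp: invertible_def)
  have "det A * det A' = 1" by (metis inv(1) det_mul det_I)
  moreover have "Q (A' *v v) (A' *v w) = Q v w" for v w
    using A(2)[of "A' *v v" "A' *v w"] by (simp add: matrix_vector_mul_assoc inv)
  ultimately show "\<exists>B\<in>carrier (special_isometries Q). B \<otimes>\<^bsub>special_isometries Q\<^esub> A = \<one>\<^bsub>special_isometries Q\<^esub>"
    by (intro bexI[of _ "A'"]) (auto simp: special_isometries_def A inv)
qed (auto simp: special_isometries_def det_mul matrix_mul_assoc simp flip: matrix_vector_mul_assoc)

lemma SU_eq: "SU = special_isometries herm_form"
  by (simp add: SU_def special_isometries_def)

lemma SO_set_eq: "SO_set = carrier (special_isometries (\<lambda>v w. quad_form v))"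
  by (simp add: SO_set_def special_isometries_def)

lemma closed_SU: "closed (carrier (SU :: (complex ^ 'm::finite option ^ 'm option) monoid))"
proof -
  have "continuous_on UNIV (\<lambda>A. herm_form (A *v v) (A *v w))" for v w :: "complex ^ 'm option"
    unfolding herm_form_def matrix_vector_mult_def by (intro continuous_intros)
  then have "closed {A :: complex ^ 'm option ^ 'm option. det A = 1 \<and> (\<forall>v w. herm_form (A *v v) (A *v w) = herm_form v w)}"
    by (intro closed_Collect_conj closed_Collect_all closed_Collect_eq continuous_on_det continuous_on_const)
  then show ?thesis by (simp add: SU_def)
qed

lemma closed_SO_set: "closed (SO_set :: (real ^ 'm::finite option ^ 'm option) set)"
proof -
  have "continuous_on UNIV (\<lambda>A. quad_form (A *v v))" for v :: "real ^ 'm option"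
    unfolding quad_form_def matrix_vector_mult_def by (intro continuous_intros)
  then have "closed {A :: real ^ 'm option ^ 'm option. det A = 1 \<and> (\<forall>v. quad_form (A *v v) = quad_form v)}"
    by (intro closed_Collect_conj closed_Collect_all closed_Collect_eq continuous_on_det continuous_on_const)
  then show ?thesis by (simp add: SO_set_def)
qed

lemma closed_SO0: "closed (carrier SO0)"
  using closed_connected_component[OF closed_SO_set] by (simp add: SO0_def)

lemma continuous_on_matrix_mult_left:
  fixes A :: "'a::real_normed_field ^ 'n ^ 'n" and S :: "('a ^ 'n ^ 'n) set"
  shows "continuous_on S ((**) A)"
  unfolding matrix_matrix_mult_def by (intro continuous_intros)

text \<open>
  Left multiplication by an element of the group maps the identity component to a connected set. For
  an element of the component that set meets the component; for the inverse of such an element it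
  contains the identity.
\<close>
lemma group_SO0: "group (SO0 :: (real ^ 'm::finite option ^ 'm option) monoid)"
proof -
  define G :: "(real ^ 'm option ^ 'm option) monoid"
    where "G = special_isometries (\<lambda>v w. quad_form v)"
  interpret G: group G
    unfolding G_def by (rule group_special_isometries)
  define C where "C = connected_component_set SO_set (mat 1 :: real ^ 'm option ^ 'm option)"
  have G: "carrier G = SO_set" "mult G = (**)" "\<one>\<^bsub>G\<^esub> = mat 1"
    by (simp_all add: G_def SO_set_eq) (simp_all add: special_isometries_def)
  have one: "mat 1 \<in> C"
    using G.one_closed by (simp add: C_def G)
  have C_sub: "C \<subseteq> SO_set" unfolding C_def by (rule connected_component_subset)
  have trans: "B ** A \<in> connected_component_set SO_set (B ** A')"
    if "A \<in> C" "A' \<in> C" "B \<in> SO_set" for A A' B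
  proof -
    have "connected ((**) B ` C)"
      unfolding C_def by (intro connected_continuous_image continuous_on_matrix_mult_left) simp
    moreover have "(**) B ` C \<subseteq> SO_set"
      using C_sub that(3) G.m_closed[of B] by (auto simp: G)
    ultimately show ?thesis
      using connected_component_maximal[of "B ** A'" "(**) B ` C" SO_set] that by blast
  qed
  have "subgroup C G"
  proof (rule G.subgroupI)
    show "C \<subseteq> carrier G" using C_sub by (simp add: G)
    show "C \<noteq> {}" using one by auto
  next
    fix A assume A: "A \<in> C"
    then have "A \<in> carrier G" using C_sub by (auto simp: G)
    then have "inv\<^bsub>G\<^esub> A \<in> SO_set" "inv\<^bsub>G\<^esub> A ** A = mat 1"
      using G.inv_closed[of A] G.l_inv[of A] by (simp_all add: G)
    then show "inv\<^bsub>G\<^esub> A \<in> C"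
      using trans[OF one A, of "inv\<^bsub>G\<^esub> A"] by (simp add: C_def)
  next
    fix A B assume AB: "A \<in> C" "B \<in> C"
    then have "A ** B \<in> connected_component_set SO_set A"
      using trans[OF AB(2) one, of A] C_sub by auto
    moreover have "connected_component_set SO_set A = C"
      using AB(1) unfolding C_def by (metis connected_component_eq)
    ultimately show "A \<otimes>\<^bsub>G\<^esub> B \<in> C" by (simp add: G)
  qed
  then have "group (G\<lparr>carrier := C\<rparr>)" by (rule G.subgroup_imp_group)
  also have "G\<lparr>carrier := C\<rparr> = SO0"
    by (simp add: G_def special_isometries_def SO0_def C_def)
  finally show ?thesis .
qed

text \<open>
  By polarization, the matrix \<open>A\<close> satisfies \<open>transpose A ** J ** A = J\<close> for the Gram matrix \<open>J\<close> of the form.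
\<close>
lemma det_square_if_quad_form_preserving:
  fixes A :: "real ^ 'm::finite option ^ 'm option"
  assumes A: "\<And>v. quad_form (A *v v) = quad_form v"
  shows "(det A)\<^sup>2 = 1"
proof -
  define J :: "real ^ 'm option ^ 'm option"
    where "J = (\<chi> i j. if i = j then (if i = None then 1 else - 1) else 0)"
  have Jv: "(J *v v) $ k = (if k = None then v $ k else - v $ k)" for v k
    by (simp add: J_def matrix_vector_mult_def mult_delta_left)
  have q: "quad_form v = v \<bullet> (J *v v)" for v
    by (simp add: quad_form_def inner_vec_def UNIV_option_conv sum.reindex Jv power2_eq_square sum_negf)
  have sym: "v \<bullet> (J *v w) = w \<bullet> (J *v v)" for v w
    by (simp add: inner_vec_def Jv mult.commute cong: if_cong) (rule sum.cong, auto)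
  have polar: "4 * (v \<bullet> (J *v w)) = quad_form (v + w) - quad_form (v - w)" for v w
    by (simp add: q matrix_vector_right_distrib matrix_vector_mult_diff_distrib inner_add_left inner_add_right
        inner_diff_left inner_diff_right sym[of w v])
  have "(A *v v) \<bullet> (J *v (A *v w)) = v \<bullet> (J *v w)" for v w
    using polar[of "A *v v" "A *v w"] polar[of v w] A[of "v + w"] A[of "v - w"]
    by (simp add: matrix_vector_right_distrib matrix_vector_mult_diff_distrib)
  then have "v \<bullet> (transpose A *v (J *v (A *v w))) = v \<bullet> (J *v w)" for v w
    by (simp only: dot_lmul_matrix[of v "transpose A", symmetric] vector_transpose_matrix)
  then have "transpose A *v (J *v (A *v w)) = J *v w" for w
    using vector_eq_ldot by blast
  then have "transpose A ** J ** A = J"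
    by (simp add: matrix_eq flip: matrix_vector_mul_assoc)
  then have "det A * det J * det A = det J"
    by (metis det_mul det_transpose)
  moreover have "J ** J = mat 1"
    by (simp add: matrix_eq vec_eq_iff Jv flip: matrix_vector_mul_assoc)
  then have "det J * det J = 1" by (metis det_mul det_I)
  then have "det J \<noteq> 0" by auto
  ultimately show ?thesis by (simp add: power2_eq_square algebra_simps)
qed

text \<open>
  Along the path the determinant is continuous with values in \<open>{1, - 1}\<close>, hence constantly 1.
\<close>
lemma path_in_SO0:
  fixes f :: "real \<Rightarrow> real ^ 'm::finite option ^ 'm option"
  assumes cont: "continuous_on UNIV f" and one: "f 0 = mat 1"
    and form: "\<And>x v. quad_form (f x *v v) = quad_form v"
  shows "f x \<in> carrier SO0"
proof -
  have conn: "connected (range f)" using cont by (rule connected_continuous_image) simp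
  have "connected (det ` range f)"
    by (intro connected_continuous_image conn continuous_on_det)
  moreover have "det (f x) = 1 \<or> det (f x) = - 1" for x
    using det_square_if_quad_form_preserving[OF form, of x] by (simp add: power2_eq_1_iff)
  then have "det ` range f \<subseteq> {1, - 1}" by auto
  then have "finite (det ` range f)" by (rule finite_subset) simp
  ultimately obtain a where "det ` range f = {a}"
    using connected_finite_iff_sing[of "det ` range f"] by auto
  moreover have "1 \<in> det ` range f" using one by (metis det_I rangeI image_eqI)
  ultimately have "det (f x) = 1" for x by auto
  then have "range f \<subseteq> SO_set" using form by (auto simp: SO_set_def)
  moreover have "mat 1 \<in> range f" using one by (metis rangeI)
  ultimately have "range f \<subseteq> connected_component_set SO_set (mat 1)"
    using conn by (intro connected_component_maximal)
  then show ?thesis by (auto simp: SO0_def)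
qed

section \<open>Real hyperbolic space\<close>

lemma expansion_div_mod_int:
  fixes d :: "nat \<Rightarrow> int" and c :: nat
  assumes "j < L" "1 \<le> c"
  shows "\<exists>N. real_of_int (\<Sum>i<L. d i * int c ^ i) / real c ^ Suc j =
     (\<Sum>i<Suc j. of_int (d i) * real c ^ i) / real c ^ Suc j + of_int N"
proof -
  obtain N where "(\<Sum>i<L. d i * int c ^ i) = (\<Sum>i<Suc j. d i * int c ^ i) + int c ^ Suc j * N"
    using digit_expansion_mod[of "Suc j" L d "int c"] assms(1) by auto
  then have "real_of_int (\<Sum>i<L. d i * int c ^ i) =
      (\<Sum>i<Suc j. of_int (d i) * real c ^ i) + real c ^ Suc j * of_int N"
    by (simp only: of_int_add of_int_mult of_int_sum of_int_power of_int_of_nat_eq)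
  then show ?thesis using assms(2) by (intro exI[of _ N]) (simp only: add_divide_distrib, simp)
qed

text \<open>
  A choice of \<open>l\<close> orthogonal coordinate planes of the transverse space. The involution \<open>\<sigma>\<close> exchanges the two
  axes of each plane, \<open>sg\<close> orients the plane and vanishes on coordinates outside all planes, and \<open>pl\<close> numbers
  the planes.
\<close>
locale rotation_planes =
  fixes i0 :: "'m::finite" and \<sigma> :: "'m \<Rightarrow> 'm" and sg :: "'m \<Rightarrow> real" and pl :: "'m \<Rightarrow> nat" and l :: nat
  assumes \<sigma>_\<sigma>: "\<sigma> (\<sigma> i) = i" and \<sigma>_i0: "\<sigma> i0 = i0" and sg_\<sigma>: "sg (\<sigma> i) = - sg i"
    and sg_cases: "sg i \<in> {- 1, 0, 1}" and pl_\<sigma>: "pl (\<sigma> i) = pl i"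
    and pl_less: "sg i \<noteq> 0 \<Longrightarrow> pl i < l" and pl_surj: "j < l \<Longrightarrow> \<exists>i. sg i = - 1 \<and> pl i = j"
    and l_pos: "1 \<le> l"

text \<open>
  After numbering the coordinates by \<open>0, \<dots>, k\<close>, coordinate \<open>0\<close> serves as \<open>i0\<close> and plane \<open>j\<close> consists of the
  coordinates \<open>2 j + 1\<close> and \<open>2 j + 2\<close>.
\<close>
lemma ex_rotation_planes:
  assumes card: "CARD('m::finite) = k + 1" and l: "1 \<le> l" "2 * l \<le> k"
  shows "\<exists>(i0::'m) \<sigma> sg pl. rotation_planes i0 \<sigma> sg pl l"
proof -
  obtain h where h: "bij_betw h {0..<k + 1} (UNIV :: 'm set)"
    using ex_bij_betw_nat_finite[of "UNIV :: 'm set"] card by auto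
  define idx where "idx i = inv_into {0..<k + 1} h i" for i
  have idx_h: "idx (h x) = x" if "x < k + 1" for x
    using bij_betw_inv_into_left[OF h] that by (simp add: idx_def)
  have h_idx: "h (idx i) = i" and idx_less: "idx i < k + 1" for i
    using bij_betw_inv_into_right[OF h] bij_betw_inv_into[OF h]
    by (auto simp: idx_def bij_betw_def)
  define P where "P x \<longleftrightarrow> 1 \<le> x \<and> x \<le> 2 * l" for x :: nat
  define s where "s x = (if P x then (if odd x then x + 1 else x - 1) else x)" for x
  have s_less: "s x < k + 1" if "x < k + 1" for x
    using that l(2) by (auto simp: s_def P_def elim!: oddE) presburger
  have ss: "s (s x) = x" for x
    by (auto simp: s_def P_def elim!: oddE evenE; presburger)
  have Ps: "P (s x) = P x" for x
    by (auto simp: s_def P_def elim!: oddE evenE; presburger)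
  define \<sigma> where "\<sigma> i = h (s (idx i))" for i
  have idx_\<sigma>: "idx (\<sigma> i) = s (idx i)" for i
    unfolding \<sigma>_def by (rule idx_h[OF s_less[OF idx_less]])
  define sg where "sg i = (if P (idx i) then (if odd (idx i) then - 1 else 1) else 0 :: real)" for i
  define pl where "pl i = (idx i - 1) div 2" for i
  have "rotation_planes (h 0) \<sigma> sg pl l"
  proof
    show "\<sigma> (\<sigma> i) = i" for i
      unfolding \<sigma>_def[of "\<sigma> i"] idx_\<sigma> ss h_idx ..
    show "\<sigma> (h 0) = h 0"
      by (simp add: \<sigma>_def idx_h s_def P_def)
    show "sg (\<sigma> i) = - sg i" for i
      unfolding sg_def idx_\<sigma> Ps by (auto simp: s_def P_def)
    show "sg i \<in> {- 1, 0, 1}" for i by (simp add: sg_def)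
    show "pl (\<sigma> i) = pl i" for i
      unfolding pl_def idx_\<sigma> by (auto simp: s_def P_def elim!: oddE evenE; presburger)
    show "pl i < l" if "sg i \<noteq> 0" for i
      using that by (auto simp: sg_def pl_def P_def split: if_splits)
    show "\<exists>i. sg i = - 1 \<and> pl i = j" if "j < l" for j
      using that l(2) by (intro exI[of _ "h (2 * j + 1)"]) (simp add: sg_def pl_def idx_h P_def)
  qed (rule l(1))
  then show ?thesis by blast
qed

context rotation_planes
begin

lemma \<sigma>_neq: "i \<noteq> i0 \<Longrightarrow> \<sigma> i \<noteq> i0"
  using \<sigma>_\<sigma> \<sigma>_i0 by metis

lemma sg_neq: "sg i \<noteq> 0 \<Longrightarrow> i \<noteq> i0"
  using sg_\<sigma>[of i0] \<sigma>_i0 by auto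

definition ang :: "real \<Rightarrow> 'm \<Rightarrow> real"
  where "ang c i = (if sg i = 0 then 0 else 2 * pi / c ^ Suc (pl i))"

definition rot :: "real \<Rightarrow> real \<Rightarrow> ('m \<Rightarrow> real) \<Rightarrow> 'm \<Rightarrow> real"
  where "rot c x u i = cos (x * ang c i) * u i + sg i * sin (x * ang c i) * u (\<sigma> i)"

lemma ang_\<sigma> [simp]: "ang c (\<sigma> i) = ang c i"
  by (simp add: ang_def sg_\<sigma> pl_\<sigma>)

lemma sg_sin: "sg i * (sg i * sin (x * ang c i)) = sin (x * ang c i)"
  using sg_cases[of i] by (auto simp: ang_def)

lemma sum_\<sigma>: "(\<Sum>i\<in>-{i0}. f (\<sigma> i)) = (\<Sum>i\<in>-{i0}. f i)"
  by (rule sum.reindex_bij_witness[of _ \<sigma> \<sigma>]) (auto simp: \<sigma>_\<sigma> \<sigma>_neq)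

lemma rot_unitary: "transverse_unitary (\<lambda>x. x) i0 (rot c x)"
  unfolding transverse_unitary_def
proof (intro conjI allI impI)
  fix u v :: "'m \<Rightarrow> real"
  let ?c = "\<lambda>i. cos (x * ang c i)" and ?s = "\<lambda>i. sin (x * ang c i)"
  define f where "f i = (?s i)\<^sup>2 * u i * v i" for i
  define g where "g i = ?c i * ?s i * sg i * (u i * v (\<sigma> i) + u (\<sigma> i) * v i)" for i
  have "rot c x u i * rot c x v i = (?c i)\<^sup>2 * u i * v i + f (\<sigma> i) + g i" for i
  proof -
    have "rot c x u i * rot c x v i = (?c i)\<^sup>2 * u i * v i
       + (sg i * (sg i * ?s i)) * ?s i * u (\<sigma> i) * v (\<sigma> i) + g i"
      by (simp add: rot_def g_def algebra_simps power2_eq_square)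
    then show ?thesis by (simp only: sg_sin) (simp add: f_def power2_eq_square)
  qed
  then have "(\<Sum>i\<in>-{i0}. rot c x u i * rot c x v i) =
      (\<Sum>i\<in>-{i0}. (?c i)\<^sup>2 * u i * v i) + (\<Sum>i\<in>-{i0}. f (\<sigma> i)) + sum g (-{i0})"
    by (simp add: sum.distrib)
  also have "(\<Sum>i\<in>-{i0}. f (\<sigma> i)) = sum f (-{i0})" by (rule sum_\<sigma>)
  also have "sum g (-{i0}) = 0"
  proof -
    have "g (\<sigma> i) = - g i" for i by (simp add: g_def sg_\<sigma> \<sigma>_\<sigma> algebra_simps)
    then have "sum g (-{i0}) = - sum g (-{i0})"
      using sum_\<sigma>[of g] by (simp add: sum_negf)
    then show ?thesis by simp
  qed
  also have "(\<Sum>i\<in>-{i0}. (?c i)\<^sup>2 * u i * v i) + sum f (-{i0}) + 0 = (\<Sum>i\<in>-{i0}. u i * v i)"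
    unfolding f_def add_0_right sum.distrib[symmetric]
    by (rule sum.cong[OF refl]) (metis distrib_right mult_1 sin_cos_squared_add2)
  finally show "(\<Sum>i\<in>-{i0}. rot c x u i * rot c x v i) = (\<Sum>i\<in>-{i0}. u i * v i)" .
qed (auto simp: rot_def algebra_simps \<sigma>_neq)

lemma rot_add: "rot c (x + y) = (\<lambda>u. rot c x (rot c y u))"
proof (intro ext)
  fix u i
  have "rot c x (rot c y u) i = cos (x * ang c i) * cos (y * ang c i) * u i
     + sg i * (sin (x * ang c i) * cos (y * ang c i) + cos (x * ang c i) * sin (y * ang c i)) * u (\<sigma> i)
     - (sg i * (sg i * sin (x * ang c i))) * sin (y * ang c i) * u i"
    by (simp add: rot_def sg_\<sigma> \<sigma>_\<sigma> algebra_simps)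
  also have "\<dots> = rot c (x + y) u i"
    unfolding sg_sin by (simp add: rot_def distrib_right sin_add cos_add algebra_simps)
  finally show "rot c (x + y) u i = rot c x (rot c y u) i" ..
qed

lemma rot_0: "rot c 0 = (\<lambda>u. u)"
  by (intro ext) (simp add: rot_def)

text \<open>
  The finite fixed point has the coordinate \<open>c\<close> on the first axis of each plane, so that every
  rotation displaces the origin.
\<close>
definition fixed_point :: "real \<Rightarrow> 'm \<Rightarrow> real" where "fixed_point c i = (if sg i = - 1 then c else 0)"
definition fixed_height :: "real \<Rightarrow> real" where "fixed_height c = (\<Sum>i\<in>-{i0}. fixed_point c i * fixed_point c i) / 2"

lemma fixed_height: "fixed_height c + fixed_height c = (\<Sum>i\<in>-{i0}. fixed_point c i * fixed_point c i)"
  by (simp add: fixed_height_def)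

text \<open>
  The one-parameter group whose integral part is the cyclic group. The choice of the dilation exponent
  \<open>1 / c ^ Suc l\<close> continues the sequence of the rotation numbers \<open>1 / c ^ Suc j\<close> for \<open>j < l\<close>.
\<close>
definition flow :: "real \<Rightarrow> real \<Rightarrow> real ^ 'm option ^ 'm option"
  where "flow c x = isometry_matrix (\<lambda>x. x) i0 (fixed_point c) (fixed_height c) (exp (x / c ^ Suc l)) (exp (- (x / c ^ Suc l))) (rot c x)"

lemma flow_add: "flow c (x + y) = flow c x ** flow c y"
  unfolding flow_def
  by (subst conjugation.isometry_matrix_mult[OF conjugation_real rot_unitary rot_unitary fixed_height])
     (simp add: rot_add add_divide_distrib flip: exp_add)

lemma flow_0: "flow c 0 = mat 1"
  unfolding flow_def rot_0 using conjugation.isometry_matrix_one[OF conjugation_real fixed_height, of c]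
  by simp

lemma flow_quad_form: "quad_form (flow c x *v v) = quad_form v"
  unfolding flow_def isometry_matrix_apply[OF rot_unitary] quad_form_eq
  by (rule conjugation.isometry_map_isometry[OF conjugation_real rot_unitary _ fixed_height])
     (simp flip: exp_add)

lemma continuous_flow: "continuous_on UNIV (flow c)"
proof -
  obtain s where s: "\<And>x. x / c ^ Suc l = x * s" by (metis divide_inverse)
  define Y where "Y v x = conj_axial (\<lambda>x. x) i0 (fixed_point c) (fixed_height c) (exp (x * s)) (exp (- (x * s))) (rot c x)
    (isotropic_coords i0 v)" for v x
  note conj = conjugation_real
  have rot: "continuous_on UNIV (\<lambda>x. rot c x u i)" for u i
    unfolding rot_def by (intro continuous_intros)
  have Y: "continuous_on UNIV (\<lambda>x. Y v x $ k)" for v k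
  proof (cases k)
    case None
    show ?thesis
      unfolding None Y_def conjugation.conj_axial_None[OF conj rot_unitary] by (intro continuous_intros rot)
  next
    case (Some i)
    show ?thesis
    proof (cases "i = i0")
      case True
      show ?thesis unfolding Some True Y_def conjugation.conj_axial_i0[OF conj] by (intro continuous_intros)
    next
      case False
      show ?thesis unfolding Some Y_def conjugation.conj_axial_Some[OF conj rot_unitary False]
        by (intro continuous_intros rot)
    qed
  qed
  have "continuous_on UNIV (\<lambda>x. flow c x $ k $ j)" for k j
  proof -
    have "flow c x $ k $ j = isotropic_coords i0 (Y (axis j 1) x) $ k" for x
      by (simp only: flow_def isometry_matrix_def matrix_def isometry_map_def Y_def s vec_lambda_beta)
    then show ?thesis
      by (cases k; cases "the k = i0") (auto intro!: continuous_intros Y)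
  qed
  then have "continuous_on UNIV (\<lambda>x. \<chi> k j. flow c x $ k $ j)"
    by (intro continuous_on_vec_lambda)
  then show ?thesis by simp
qed

lemma flow_SO0: "flow c x \<in> carrier SO0"
  by (rule path_in_SO0[OF continuous_flow flow_0 flow_quad_form])

lemma flow_loxodromic:
  assumes "c \<ge> 1"
  shows "loxodromic quad_form (flow c 1)"
  unfolding flow_def
proof (rule conjugation.isometry_matrix_loxodromic[OF conjugation_real rot_unitary _ _ fixed_height])
  show "1 < norm (exp (1 / c ^ Suc l))" using assms by simp
qed (simp_all flip: exp_add quad_form_eq)

lemma rot_fixed_point:
  "sg i = - 1 \<Longrightarrow> rot c x (fixed_point c) i = cos (x * ang c i) * c"
  "sg i = 1 \<Longrightarrow> rot c x (fixed_point c) i = sin (x * ang c i) * c"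
  "sg i = 0 \<Longrightarrow> rot c x (fixed_point c) i = 0"
  by (simp_all add: rot_def fixed_point_def sg_\<sigma>)

lemma flow_corner:
  "d * fixed_height c + a * fixed_height c - (\<Sum>i\<in>-{i0}. fixed_point c i * rot c x (fixed_point c) i) =
    (\<Sum>i\<in>-{i0}. if sg i = - 1 then c\<^sup>2 * ((a + d) / 2 - cos (x * ang c i)) else 0)"
proof -
  have "fixed_point c i * fixed_point c i * ((a + d) / 2) - fixed_point c i * rot c x (fixed_point c) i =
      (if sg i = - 1 then c\<^sup>2 * ((a + d) / 2 - cos (x * ang c i)) else 0)" for i
    by (cases "sg i = - 1")
       (simp_all add: fixed_point_def[of c i] rot_fixed_point(1) power2_eq_square right_diff_distrib mult_ac)
  then have "(\<Sum>i\<in>-{i0}. fixed_point c i * fixed_point c i * ((a + d) / 2)) - (\<Sum>i\<in>-{i0}. fixed_point c i * rot c x (fixed_point c) i) =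
      (\<Sum>i\<in>-{i0}. if sg i = - 1 then c\<^sup>2 * ((a + d) / 2 - cos (x * ang c i)) else 0)"
    by (simp only: flip: sum_subtractf)
  moreover have "d * fixed_height c + a * fixed_height c = (\<Sum>i\<in>-{i0}. fixed_point c i * fixed_point c i * ((a + d) / 2))"
    unfolding sum_distrib_right[symmetric] by (simp add: fixed_height_def algebra_simps)
  ultimately show ?thesis by simp
qed

text \<open>
  The displacement of the origin is bounded, while the fixed point is at distance \<open>c\<close>; so the dilation and
  each rotation differ from the identity by \<open>O(1 / c)\<close>. The exponents of the dilation and of the
  rotations then supply the two hypotheses of \<open>bounded_digits_expansion\<close>.
\<close>
lemma flow_proper:
  assumes c: "1 \<le> c" and B: "norm (flow (real c) (real_of_int m)) \<le> B" and B': "B' = max 1 (4 * B)"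
  shows "\<exists>d. m = (\<Sum>i<Suc l. d i * int c ^ i) \<and> (\<forall>i. \<bar>real_of_int (d i)\<bar> \<le> 2 ^ l * (4 * B'\<^sup>2))"
proof -
  let ?c = "real c" and ?m = "real_of_int m"
  define y where "y = ?m / ?c ^ Suc l"
  have c1: "?c \<ge> 1" using c by simp
  have B'1: "1 \<le> B'" and B'4: "4 * B \<le> B'" by (auto simp: B')
  note bounds = conjugation.isometry_matrix_bounds[OF conjugation_real rot_unitary B[unfolded flow_def], folded y_def]
  have exp_y: "exp y \<le> B'" using bounds(1) B'4 by simp
  have column: "norm (of_real (exp (- y)) - cis (?m * (2 * pi / ?c ^ Suc j))) \<le> 2 * B' / ?c" if "j < l" for j
  proof -
    obtain i where i: "sg i = - 1" "pl i = j" using pl_surj[OF \<open>j < l\<close>] by auto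
    then have neq: "i \<noteq> i0" "\<sigma> i \<noteq> i0" using sg_neq[of i] \<sigma>_neq[of i] by auto
    have ang: "ang ?c i = 2 * pi / ?c ^ Suc j" using i by (simp add: ang_def)
    have "\<bar>(exp (- y) - cos (?m * ang ?c i)) * ?c\<bar> \<le> B'"
      using bounds(3)[OF neq(1)] B'4 rot_fixed_point(1)[OF i(1), of ?c ?m] i(1)
      by (simp add: fixed_point_def left_diff_distrib)
    moreover have "\<bar>sin (?m * ang ?c i) * ?c\<bar> \<le> B'"
      using bounds(3)[OF neq(2)] B'4 rot_fixed_point(2)[of "\<sigma> i" ?c ?m] i(1)
      by (simp add: fixed_point_def sg_\<sigma>)
    moreover have "\<bar>r * ?c\<bar> \<le> B' \<Longrightarrow> \<bar>r\<bar> \<le> B' / ?c" for r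
      using c1 by (simp only: abs_mult abs_of_nat) (simp add: pos_le_divide_eq)
    ultimately have "\<bar>exp (- y) - cos (?m * ang ?c i)\<bar> + \<bar>sin (?m * ang ?c i)\<bar> \<le> B' / ?c + B' / ?c"
      by (intro add_mono) blast+
    then have "\<bar>exp (- y) - cos (?m * ang ?c i)\<bar> + \<bar>sin (?m * ang ?c i)\<bar> \<le> 2 * B' / ?c"
      by simp
    moreover have "norm (of_real (exp (- y)) - cis (?m * ang ?c i)) \<le>
        \<bar>exp (- y) - cos (?m * ang ?c i)\<bar> + \<bar>sin (?m * ang ?c i)\<bar>"
      using cmod_le[of "of_real (exp (- y)) - cis (?m * ang ?c i)"] by simp
    ultimately show ?thesis by (simp add: ang)
  qed
  have "\<bar>y\<bar> \<le> B' * (2 * B' / ?c)"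
    by (rule column_bounds(1)[OF exp_y B'1 column[of 0]]) (use l_pos in simp)
  then have "\<bar>?m\<bar> \<le> 2 * B'\<^sup>2 * ?c ^ l"
    using c1 by (simp add: y_def field_simps power2_eq_square)
  also have "\<dots> \<le> 4 * B'\<^sup>2 * ?c ^ l" by simp
  finally have m_le: "\<bar>?m\<bar> \<le> 4 * B'\<^sup>2 * ?c ^ l" .
  show ?thesis
  proof (rule bounded_digits_expansion[OF c m_le])
    fix j assume j: "1 \<le> j" "j \<le> l"
    then obtain j' where j': "j = Suc j'" "j' < l" by (cases j) auto
    have "norm (cis (?m * (2 * pi / ?c ^ Suc j')) - 1) \<le> 2 * (2 * B' / ?c)"
      by (rule column_bounds(2)[OF exp_y B'1 column[OF j'(2)]])
    then have "norm (cis (2 * pi * (?m / ?c ^ j)) - 1) \<le> 4 * B' / ?c"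
      by (simp add: j'(1) mult_ac)
    then obtain z :: int where "\<bar>?m / ?c ^ j - of_int z\<bar> \<le> 4 * B' / ?c"
      using near_integer_if_cis_near_1 by blast
    also have "\<dots> \<le> 4 * B'\<^sup>2 / ?c"
      using B'1 c1 mult_left_mono[OF B'1, of B'] by (simp add: divide_right_mono power2_eq_square)
    finally show "\<exists>z::int. \<bar>?m / ?c ^ j - of_int z\<bar> \<le> 4 * B'\<^sup>2 / ?c" by blast
  qed
qed

text \<open>
  Modulo 1, the rotation number of plane \<open>j\<close> is \<open>1 / c\<close> times a number that converges to the digit \<open>d j\<close>:
  higher digits contribute full turns and lower ones are negligible. The dilation exponent likewise
  is \<open>1 / c\<close> times a number that converges to \<open>d l\<close>.
\<close>
lemma flow_convergent:
  fixes d :: "nat \<Rightarrow> int"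
  shows "convergent (\<lambda>n. flow (real (Suc n)) (real_of_int (\<Sum>i<Suc l. d i * int (Suc n) ^ i)))"
proof -
  define c where "c n = real (Suc n)" for n
  define M where "M n = real_of_int (\<Sum>i<Suc l. d i * int (Suc n) ^ i)" for n
  define u where "u n = M n / c n ^ Suc l" for n
  define v where "v j n = 2 * pi * ((\<Sum>i<Suc j. of_int (d i) * c n ^ i) / c n ^ Suc j)" for j n
  have c: "filterlim c at_top sequentially"
    unfolding c_def by (rule filterlim_compose[OF filterlim_real_sequentially filterlim_Suc])
  have c_neq: "c n \<noteq> 0" for n by (simp add: c_def)
  have "c n * u n = (\<Sum>i<Suc l. of_int (d i) * c n ^ i) / c n ^ l" for n
    using c_neq[of n] by (simp add: u_def M_def c_def)
  then have u: "(\<lambda>n. c n * u n) \<longlonglongrightarrow> of_int (d l)"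
    using leading_digit[OF c, of d l] by simp
  have "c n * v j n = 2 * pi * ((\<Sum>i<Suc j. of_int (d i) * c n ^ i) / c n ^ j)" for j n
    using c_neq[of n] by (simp add: v_def)
  then have v: "(\<lambda>n. c n * v j n) \<longlonglongrightarrow> 2 * pi * of_int (d j)" for j
    using tendsto_mult_left[OF leading_digit[OF c, of d j], of "2 * pi"] by simp
  have cis_eq: "cis (M n * ang (c n) i) = cis (v (pl i) n)" if i: "sg i \<noteq> 0" for i n
  proof -
    have "pl i < Suc l" using pl_less[OF i] by simp
    then obtain N where "M n / c n ^ Suc (pl i) = (\<Sum>j<Suc (pl i). of_int (d j) * c n ^ j) / c n ^ Suc (pl i) + of_int N"
      using expansion_div_mod_int[of "pl i" "Suc l" "Suc n" d] unfolding M_def c_def by auto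
    moreover have "M n * ang (c n) i = 2 * pi * (M n / c n ^ Suc (pl i))"
      using i by (simp add: ang_def)
    ultimately show ?thesis unfolding v_def by (simp only: cis_add_2pi_int)
  qed
  have cos_eq: "cos (M n * ang (c n) i) = cos (v (pl i) n)" and sin_eq: "sin (M n * ang (c n) i) = sin (v (pl i) n)"
    if "sg i \<noteq> 0" for i n
    using cis_eq[OF that, of n] by (simp_all add: complex_eq_iff)
  have v0: "v j \<longlonglongrightarrow> 0" for j by (rule tendsto_zero_if_rescaled_convergent[OF v c])
  have u0: "u \<longlonglongrightarrow> 0" by (rule tendsto_zero_if_rescaled_convergent[OF u c])
  have convI: "X \<longlonglongrightarrow> L \<Longrightarrow> convergent X" for X :: "nat \<Rightarrow> real" and L
    by (auto simp: convergent_def)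
  have e1: "convergent (\<lambda>n. exp (u n))" "convergent (\<lambda>n. exp (- u n))"
    using tendsto_exp[OF u0] tendsto_exp[OF tendsto_minus[OF u0]] by (auto simp: convergent_def)
  have cos_conv: "convergent (\<lambda>n. cos (v j n))" and sin_conv: "convergent (\<lambda>n. sin (v j n))" for j
    using tendsto_cos[OF v0] tendsto_sin[OF v0] by (auto intro: convI)
  have c_sin: "convergent (\<lambda>n. c n * sin (v j n))" for j
    using rescaled_sin[OF c u v] by (rule convI)
  have c_exp_cos: "convergent (\<lambda>n. c n * (exp (- u n) - cos (v j n)))" "convergent (\<lambda>n. c n * (exp (u n) - cos (v j n)))" for j
  proof -
    have "convergent (\<lambda>n. c n * (exp (- u n) - 1) - c n * (cos (v j n) - 1))"
      "convergent (\<lambda>n. c n * (exp (u n) - 1) - c n * (cos (v j n) - 1))"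
      using rescaled_exp_minus[OF c u v] rescaled_exp[OF c u v] rescaled_cos[OF c u v]
      by (auto intro!: convergent_diff intro: convI)
    then show "convergent (\<lambda>n. c n * (exp (- u n) - cos (v j n)))" "convergent (\<lambda>n. c n * (exp (u n) - cos (v j n)))"
      by (simp_all add: algebra_simps)
  qed
  have "convergent (\<lambda>n. isometry_matrix (\<lambda>x. x) i0 (fixed_point (c n)) (fixed_height (c n)) (exp (u n)) (exp (- u n)) (rot (c n) (M n)))"
  proof (rule conjugation.convergent_isometry_matrix[OF conjugation_real rot_unitary e1])
    fix w i assume "i \<noteq> i0"
    show "convergent (\<lambda>n. rot (c n) (M n) w i)"
    proof (cases "sg i = 0")
      case True
      then show ?thesis by (simp add: rot_def ang_def convergent_const)
    next
      case False
      then show ?thesis unfolding rot_def cos_eq[OF False] sin_eq[OF False]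
        by (intro convergent_add convergent_mult convergent_const cos_conv sin_conv)
    qed
    show "convergent (\<lambda>n. exp (- u n) * fixed_point (c n) i - rot (c n) (M n) (fixed_point (c n)) i)"
    proof -
      consider "sg i = 0" | "sg i = 1" | "sg i = - 1" using sg_cases[of i] by auto
      then show ?thesis
      proof cases
        case 1
        then show ?thesis by (simp add: rot_fixed_point fixed_point_def convergent_const)
      next
        case 2
        then show ?thesis
          using convergent_minus_iff[THEN iffD1, OF c_sin[of "pl i"]] sin_eq[of i]
          by (simp add: rot_fixed_point fixed_point_def mult.commute)
      next
        case 3
        then show ?thesis using c_exp_cos(1)[of "pl i"] cos_eq[of i]
          by (simp add: rot_fixed_point fixed_point_def algebra_simps)
      qed
    qed
  next
    fix w :: "'m \<Rightarrow> real"
    have "convergent (\<lambda>n. fixed_point (c n) i * (rot (c n) (M n) w i - exp (u n) * w i))" for i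
    proof (cases "sg i = - 1")
      case True
      then have "sg i \<noteq> 0" by simp
      have "convergent (\<lambda>n. - w i * (c n * (exp (u n) - cos (v (pl i) n))) - w (\<sigma> i) * (c n * sin (v (pl i) n)))"
        by (intro convergent_diff convergent_mult convergent_const c_exp_cos c_sin)
      then show ?thesis
        by (simp add: True fixed_point_def rot_def cos_eq[OF \<open>sg i \<noteq> 0\<close>] sin_eq[OF \<open>sg i \<noteq> 0\<close>] algebra_simps)
    next
      case False
      then show ?thesis by (simp add: fixed_point_def convergent_const)
    qed
    then show "convergent (\<lambda>n. \<Sum>i\<in>- {i0}. fixed_point (c n) i * (rot (c n) (M n) w i - exp (u n) * w i))"
      by (intro convergent_sum)
  next
    have "convergent (\<lambda>n. if sg i = - 1 then (c n)\<^sup>2 * ((exp (u n) + exp (- u n)) / 2 - cos (M n * ang (c n) i)) else 0)" for i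
    proof (cases "sg i = - 1")
      case True
      then show ?thesis
        using rescaled_square[OF c u v[of "pl i"]] cos_eq[of i] by (auto intro: convI)
    qed (simp add: convergent_const)
    then show "convergent (\<lambda>n. exp (- u n) * fixed_height (c n) + exp (u n) * fixed_height (c n)
        - (\<Sum>i\<in>- {i0}. fixed_point (c n) i * rot (c n) (M n) (fixed_point (c n)) i))"
      unfolding flow_corner by (intro convergent_sum)
  qed
  then show ?thesis
    by (simp only: flow_def u_def c_def M_def)
qed

theorem geometric_limit_SO0:
  shows "\<exists>(\<rho> :: nat \<Rightarrow> int \<Rightarrow> real ^ 'm option ^ 'm option) \<rho>_lim \<Gamma>.
            (\<forall>n. convex_cocompact SO0 quad_form (\<rho> n)) \<and>
            algebraically_converges \<rho> \<rho>_lim \<and>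
            discrete_faithful SO0 \<rho>_lim \<and>
            geometric_limit SO0 (\<lambda>n. range (\<rho> n)) \<Gamma> \<and>
            SO0\<lparr>carrier := \<Gamma>\<rparr> \<cong> product_group {..<l + 1} (\<lambda>_. integer_group)"
proof -
  define \<rho> :: "nat \<Rightarrow> int \<Rightarrow> real ^ 'm option ^ 'm option" where "\<rho> n m = flow (real (Suc n)) (real_of_int m)" for n m
  have hom: "\<rho> n \<in> hom integer_group SO0" for n
  proof (rule homI)
    fix x y :: int
    show "\<rho> n (x \<otimes>\<^bsub>integer_group\<^esub> y) = \<rho> n x \<otimes>\<^bsub>SO0\<^esub> \<rho> n y"
      by (simp add: \<rho>_def integer_group_def SO0_def flow_add)
  qed (simp add: \<rho>_def flow_SO0)
  have "convex_cocompact SO0 quad_form (\<rho> n)" for n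
    using hom flow_loxodromic[of "real (Suc n)"] by (simp add: convex_cocompact_def \<rho>_def)
  moreover have "\<exists>\<rho>_lim \<Gamma>. algebraically_converges \<rho> \<rho>_lim \<and> discrete_faithful SO0 \<rho>_lim \<and>
      geometric_limit SO0 (\<lambda>n. range (\<rho> n)) \<Gamma> \<and>
      SO0\<lparr>carrier := \<Gamma>\<rparr> \<cong> product_group {..<Suc l} (\<lambda>_. integer_group)"
  proof (rule geometric_limit_of_cyclic_groups[OF group_SO0 closed_SO0 _ hom filterlim_Suc, where e = "\<lambda>i. i"])
    fix x y :: "nat \<Rightarrow> real ^ 'm option ^ 'm option" and a b
    assume "x \<longlonglongrightarrow> a" "y \<longlonglongrightarrow> b"
    then show "(\<lambda>n. x n \<otimes>\<^bsub>SO0\<^esub> y n) \<longlonglongrightarrow> a \<otimes>\<^bsub>SO0\<^esub> b"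
      by (simp add: SO0_def tendsto_matrix_mult)
  next
    fix d :: "nat \<Rightarrow> int"
    show "convergent (\<lambda>n. \<rho> n (\<Sum>i<Suc l. d i * int (Suc n) ^ i))"
      unfolding \<rho>_def by (rule flow_convergent)
  next
    fix B :: real
    define K where "K = \<lfloor>2 ^ l * (4 * (max 1 (4 * B))\<^sup>2)\<rfloor>"
    show "\<exists>K. \<forall>n m. norm (\<rho> n m) \<le> B \<longrightarrow>
        (\<exists>d. m = (\<Sum>i<Suc l. d i * int (Suc n) ^ i) \<and> (\<forall>i<Suc l. \<bar>d i\<bar> \<le> K))"
    proof (intro exI[of _ K] allI impI)
      fix n m assume "norm (\<rho> n m) \<le> B"
      then obtain d where "m = (\<Sum>i<Suc l. d i * int (Suc n) ^ i)"
        and d: "\<And>i. \<bar>real_of_int (d i)\<bar> \<le> 2 ^ l * (4 * (max 1 (4 * B))\<^sup>2)"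
        using flow_proper[of "Suc n" m B, OF _ _ refl] unfolding \<rho>_def by auto
      moreover have "\<bar>d i\<bar> \<le> K" for i
        unfolding K_def le_floor_iff using d[of i] by simp
      ultimately show "\<exists>d. m = (\<Sum>i<Suc l. d i * int (Suc n) ^ i) \<and> (\<forall>i<Suc l. \<bar>d i\<bar> \<le> K)"
        by blast
    qed
  qed simp_all
  ultimately show ?thesis by auto
qed

end

section \<open>Complex hyperbolic space\<close>

lemma prod_cis: "(\<Prod>i\<in>A. cis (f i)) = cis (\<Sum>i\<in>A. f i)"
  by (induction A rule: infinite_finite_induct) (auto simp: cis_mult)

text \<open>
  The complex coordinate lines \<open>p 0, \<dots>, p h\<close> of the transverse space are rotated.
\<close>
locale rotation_torus =
  fixes i0 :: "'m::finite" and p :: "nat \<Rightarrow> 'm" and h k :: nat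
  assumes inj_p: "inj_on p {..<Suc h}" and p_neq: "j < Suc h \<Longrightarrow> p j \<noteq> i0"
    and card_m: "CARD('m) = k + 1"
begin

text \<open>
  The rotation numbers of the coordinate lines. The last one is chosen such that the sum of all of them
  is \<open>1 / c\<^sup>2 + 1 / c ^ (h + 3)\<close>: the second summand is compensated by the dilation, and the first
  summand forces exponents with a bounded vertical displacement to be near multiples of \<open>c\<^sup>2\<close>.
\<close>
definition rotnum :: "real \<Rightarrow> nat \<Rightarrow> real"
  where "rotnum c j = (if j < h then 1 / c ^ (j + 3) else 1 / c\<^sup>2 + 1 / c ^ (h + 3) - (\<Sum>j<h. 1 / c ^ (j + 3)))"

lemma sum_rotnum: "(\<Sum>j<Suc h. rotnum c j) = 1 / c\<^sup>2 + 1 / c ^ (h + 3)"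
proof -
  have "(\<Sum>j<h. rotnum c j) = (\<Sum>j<h. 1 / c ^ (j + 3))"
    by (rule sum.cong) (simp_all add: rotnum_def)
  then show ?thesis by (simp add: rotnum_def)
qed

definition supp :: "'m set" where "supp = p ` {..<Suc h}"

definition ang :: "real \<Rightarrow> 'm \<Rightarrow> real"
  where "ang c i = (if i \<in> supp then 2 * pi * rotnum c (inv_into {..<Suc h} p i) else 0)"

lemma ang_p: "j < Suc h \<Longrightarrow> ang c (p j) = 2 * pi * rotnum c j"
  using inv_into_f_f[OF inj_p, of j] by (auto simp: ang_def supp_def)

lemma supp_cases:
  obtains j where "j < Suc h" "i = p j" "i \<in> supp" | "i \<notin> supp"
  by (auto simp: supp_def)

lemma sum_supp:
  fixes g :: "'m \<Rightarrow> 'b::comm_monoid_add"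
  assumes "\<And>i. i \<notin> supp \<Longrightarrow> g i = 0"
  shows "(\<Sum>i\<in>-{i0}. g i) = (\<Sum>j<Suc h. g (p j))"
proof -
  have "(\<Sum>i\<in>-{i0}. g i) = sum g supp"
    by (rule sum.mono_neutral_right) (use assms p_neq in \<open>auto simp: supp_def\<close>)
  also have "\<dots> = (\<Sum>j<Suc h. g (p j))"
    unfolding supp_def by (subst sum.reindex[OF inj_p]) simp
  finally show ?thesis .
qed

text \<open>
  The common phase that makes the determinant equal to 1: it occurs \<open>k + 2\<close> times in the diagonal form.
\<close>
definition \<psi> :: "real \<Rightarrow> real"
  where "\<psi> c = - (2 * pi * (1 / c\<^sup>2 + 1 / c ^ (h + 3))) / real (k + 2)"

definition s :: "real \<Rightarrow> real" where "s c = pi / c ^ (h + 3)"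

definition fixed_point :: "real \<Rightarrow> 'm \<Rightarrow> complex" where "fixed_point c i = (if i \<in> supp then of_real c else 0)"

text \<open>
  The real part is forced by isometry. The imaginary part, the height of the fixed point, is large enough
  for the dilation to contribute to the vertical displacement with the order of magnitude of the rotations.
\<close>
definition fixed_height :: "real \<Rightarrow> complex" where "fixed_height c = Complex (real (Suc h) * c\<^sup>2 / 2) (- c\<^sup>2)"

lemma fixed_height: "fixed_height c + cnj (fixed_height c) = (\<Sum>i\<in>-{i0}. fixed_point c i * cnj (fixed_point c i))"
proof -
  have "(\<Sum>i\<in>-{i0}. fixed_point c i * cnj (fixed_point c i)) = (\<Sum>j<Suc h. of_real (c\<^sup>2))"
    by (subst sum_supp) (auto simp: fixed_point_def supp_def power2_eq_square intro!: sum.cong)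
  then show ?thesis by (simp add: fixed_height_def complex_eq_iff)
qed

definition rot :: "real \<Rightarrow> real \<Rightarrow> ('m \<Rightarrow> complex) \<Rightarrow> 'm \<Rightarrow> complex"
  where "rot c x = (\<lambda>u i. cis (x * (\<psi> c + ang c i)) * u i)"

lemma rot_unitary: "transverse_unitary cnj i0 (rot c x)"
  by (auto simp: transverse_unitary_def rot_def algebra_simps cis_mult cis_cnj
      simp flip: mult.assoc intro!: sum.cong)

definition flow :: "real \<Rightarrow> real \<Rightarrow> complex ^ 'm option ^ 'm option"
  where "flow c x = isometry_matrix cnj i0 (fixed_point c) (fixed_height c)
    (cis (x * \<psi> c) * of_real (exp (x * s c))) (cis (x * \<psi> c) * of_real (exp (- (x * s c)))) (rot c x)"

lemma flow_add: "flow c (x + y) = flow c x ** flow c y"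
proof -
  have "rot c (x + y) = (\<lambda>u. rot c x (rot c y u))"
    by (intro ext) (simp add: rot_def distrib_right cis_mult flip: mult.assoc)
  moreover have "cis (x * \<psi> c) * of_real (exp (x * s c)) * (cis (y * \<psi> c) * of_real (exp (y * s c))) =
      cis ((x + y) * \<psi> c) * of_real (exp ((x + y) * s c))" for s
    unfolding distrib_right exp_add cis_mult[symmetric] of_real_mult by (simp only: mult_ac)
  note this[of s] this[of "\<lambda>c. - s c"]
  ultimately show ?thesis
    unfolding flow_def
    by (subst conjugation.isometry_matrix_mult[OF conjugation_complex rot_unitary rot_unitary fixed_height]) simp
qed

lemma inverse_eigenvalues: "cis (x * \<psi> c) * of_real (exp y) * cnj (cis (x * \<psi> c) * of_real (exp (- y))) = 1"
proof -
  have 1: "of_real (exp y) * of_real (exp (- y)) = (1 :: complex)"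
    unfolding of_real_mult[symmetric] exp_add[symmetric] by simp
  have 2: "cis (x * \<psi> c) * cnj (cis (x * \<psi> c)) = 1" by (simp add: cis_cnj cis_mult)
  have "a * r * cnj (a * of_real q) = (a * cnj a) * (r * of_real q)" for a r :: complex and q
    by simp
  then show ?thesis by (simp only: 1 2) simp
qed

lemma det_flow: "det (flow c x) = 1"
proof -
  have "(\<Sum>i\<in>-{i0}. ang c i) = (\<Sum>j<Suc h. ang c (p j))"
    by (rule sum_supp) (simp add: ang_def)
  also have "\<dots> = 2 * pi * (\<Sum>j<Suc h. rotnum c j)"
    unfolding sum_distrib_left by (rule sum.cong) (simp_all add: ang_p)
  also have "\<dots> = - real (k + 2) * \<psi> c"
    unfolding sum_rotnum \<psi>_def by (simp add: field_simps del: of_nat_add of_nat_Suc)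
  finally have ang: "(\<Sum>i\<in>-{i0}. ang c i) = - real (k + 2) * \<psi> c" .
  have "card (-{i0}) = k"
    using card_m by (simp add: Compl_eq_Diff_UNIV)
  then have "(\<Sum>i\<in>-{i0}. x * (\<psi> c + ang c i)) = x * (real k * \<psi> c + - real (k + 2) * \<psi> c)"
    unfolding sum_distrib_left[symmetric] sum.distrib ang by simp
  also have "\<dots> = - (x * \<psi> c) - x * \<psi> c" by (simp add: algebra_simps)
  finally have sum: "(\<Sum>i\<in>-{i0}. x * (\<psi> c + ang c i)) = - (x * \<psi> c) - x * \<psi> c" .
  have "det (flow c x) = cis (x * \<psi> c) * of_real (exp (x * s c)) * (cis (x * \<psi> c) * of_real (exp (- (x * s c))))
      * (\<Prod>i\<in>-{i0}. cis (x * (\<psi> c + ang c i)))"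
    unfolding flow_def rot_def
    by (rule conjugation.det_isometry_matrix[OF conjugation_complex rot_unitary[unfolded rot_def] fixed_height])
  also have "(\<Prod>i\<in>-{i0}. cis (x * (\<psi> c + ang c i))) = cis (- (x * \<psi> c) - x * \<psi> c)"
    unfolding prod_cis sum ..
  also have "cis (x * \<psi> c) * of_real (exp (x * s c)) * (cis (x * \<psi> c) * of_real (exp (- (x * s c))))
      * cis (- (x * \<psi> c) - x * \<psi> c) =
      (cis (x * \<psi> c) * cis (x * \<psi> c) * cis (- (x * \<psi> c) - x * \<psi> c)) * of_real (exp (x * s c) * exp (- (x * s c)))"
    by (simp add: mult_ac)
  also have "\<dots> = 1"
    unfolding cis_mult exp_add[symmetric] by simp
  finally show ?thesis .
qed

lemma flow_SU: "flow c x \<in> carrier SU"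
proof -
  have "herm_form (flow c x *v v) (flow c x *v w) = herm_form v w" for v w
    unfolding flow_def isometry_matrix_apply[OF rot_unitary] herm_form_eq
    by (rule conjugation.isometry_map_isometry[OF conjugation_complex rot_unitary inverse_eigenvalues fixed_height])
  then show ?thesis by (simp add: SU_def det_flow)
qed

lemma flow_loxodromic:
  assumes "c \<ge> 1"
  shows "loxodromic herm_quad (flow c 1)"
  unfolding flow_def
proof (rule conjugation.isometry_matrix_loxodromic[OF conjugation_complex rot_unitary inverse_eigenvalues _ fixed_height])
  have "0 < s c" using assms by (simp add: s_def)
  then show "1 < norm (cis (1 * \<psi> c) * of_real (exp (1 * s c)))" by (simp add: norm_mult)
qed (simp add: herm_quad_def herm_form_eq)

lemma rot_fixed_point: "j < Suc h \<Longrightarrow> rot c x (fixed_point c) (p j) = cis (x * \<psi> c) * (of_real c * cis (x * ang c (p j)))"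
  by (simp add: rot_def fixed_point_def supp_def distrib_left mult.assoc mult.left_commute flip: cis_mult)

text \<open>
  Up to the unimodular factor \<open>\<mu>\<close>, the imaginary part is the vertical displacement of the origin: the
  dilation contributes through the height of the fixed point, each rotation through its horizontal distance.
\<close>
lemma flow_corner:
  fixes x y c :: real
  defines "\<mu> \<equiv> cis (x * \<psi> c)"
  shows "\<mu> * of_real (exp (- y)) * fixed_height c + \<mu> * of_real (exp y) * cnj (fixed_height c)
      - (\<Sum>i\<in>-{i0}. cnj (fixed_point c i) * rot c x (fixed_point c) i) =
    \<mu> * Complex (\<Sum>j<Suc h. c\<^sup>2 * ((exp y + exp (- y)) / 2 - cos (x * ang c (p j))))
        (2 * c\<^sup>2 * sinh y - c\<^sup>2 * (\<Sum>j<Suc h. sin (x * ang c (p j))))"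
proof -
  have "(\<Sum>i\<in>-{i0}. cnj (fixed_point c i) * rot c x (fixed_point c) i) = (\<Sum>j<Suc h. cnj (fixed_point c (p j)) * rot c x (fixed_point c) (p j))"
    by (rule sum_supp) (simp add: fixed_point_def)
  also have "\<dots> = \<mu> * (\<Sum>j<Suc h. of_real (c\<^sup>2) * cis (x * ang c (p j)))"
    unfolding sum_distrib_left
    by (rule sum.cong[OF refl]) (simp add: rot_fixed_point, simp add: fixed_point_def supp_def \<mu>_def power2_eq_square mult_ac)
  finally have "\<mu> * of_real (exp (- y)) * fixed_height c + \<mu> * of_real (exp y) * cnj (fixed_height c)
      - (\<Sum>i\<in>-{i0}. cnj (fixed_point c i) * rot c x (fixed_point c) i) =
      \<mu> * (of_real (exp (- y)) * fixed_height c + of_real (exp y) * cnj (fixed_height c)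
        - (\<Sum>j<Suc h. of_real (c\<^sup>2) * cis (x * ang c (p j))))"
    by (simp only: right_diff_distrib distrib_left mult.assoc)
  moreover have "of_real (exp (- y)) * fixed_height c + of_real (exp y) * cnj (fixed_height c)
        - (\<Sum>j<Suc h. of_real (c\<^sup>2) * cis (x * ang c (p j))) =
     Complex (\<Sum>j<Suc h. c\<^sup>2 * ((exp y + exp (- y)) / 2 - cos (x * ang c (p j))))
        (2 * c\<^sup>2 * sinh y - c\<^sup>2 * (\<Sum>j<Suc h. sin (x * ang c (p j))))"
    unfolding right_diff_distrib sum_subtractf
    by (simp add: complex_eq_iff fixed_height_def sinh_def Re_sum Im_sum sum_distrib_left del: sum.lessThan_Suc)
       (simp add: algebra_simps)
  ultimately show ?thesis by (simp only:)
qed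

text \<open>
  The sum of the rotation numbers and the dilation exponent are adjusted such that the linear part of the
  vertical displacement is \<open>2 * pi * (c\<^sup>2 * N - m)\<close>, where the integer \<open>N\<close> sums the full turns \<open>z j\<close>. As its
  cubic error terms are bounded, \<open>m\<close> differs from \<open>c\<^sup>2 * N\<close> by a bounded digit \<open>d0\<close>. The first \<open>h\<close> rotation
  numbers then show that \<open>N\<close> satisfies the hypotheses of \<open>bounded_digits_expansion\<close>.
\<close>
lemma digits_bounded:
  fixes c :: nat and m :: int and B C :: real and z :: "nat \<Rightarrow> int"
  defines "y \<equiv> real_of_int m * s (real c)"
    and "E \<equiv> B + 2 * (exp (B\<^sup>2) * (B\<^sup>2) ^ 3) + real (Suc h) * (4 * pi * B) ^ 3"
  assumes c: "1 \<le> c" and B: "1 \<le> B" and y: "\<bar>y\<bar> \<le> B\<^sup>2 / real c"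
    and z: "\<And>j. j < Suc h \<Longrightarrow> \<bar>real_of_int m * rotnum (real c) j - of_int (z j)\<bar> \<le> 2 * B / real c"
    and corner: "\<bar>2 * (real c)\<^sup>2 * sinh y - (real c)\<^sup>2 * (\<Sum>j<Suc h. sin (real_of_int m * (2 * pi * rotnum (real c) j)))\<bar> \<le> B"
  shows "\<exists>d. m = (\<Sum>i<Suc (Suc h). d i * int c ^ (if i = 0 then 0 else i + 1)) \<and>
    (\<forall>i. \<bar>real_of_int (d i)\<bar> \<le> 2 ^ h * (2 * B + B\<^sup>2 + E))"
proof -
  let ?c = "real c" and ?m = "real_of_int m"
  have c1: "?c \<ge> 1" using c by simp
  have E0: "B \<le> E" using B unfolding E_def by (simp add: add_nonneg_nonneg)
  define x where "x j = ?m * rotnum ?c j - of_int (z j)" for j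
  define N where "N = (\<Sum>j<Suc h. z j)"
  have sin_x: "sin (?m * (2 * pi * rotnum ?c j)) = sin (2 * pi * x j)" for j
  proof -
    have "cis (2 * pi * (x j + of_int (z j))) = cis (2 * pi * x j)" by (rule cis_add_2pi_int)
    then have "sin (2 * pi * (x j + of_int (z j))) = sin (2 * pi * x j)" by (simp add: complex_eq_iff)
    then show ?thesis by (simp add: x_def mult_ac)
  qed
  have cube: "?c\<^sup>2 * (r / ?c) ^ 3 \<le> r ^ 3" if "0 \<le> r" for r
  proof -
    have "?c\<^sup>2 * (r / ?c) ^ 3 = r ^ 3 / ?c" using c1 by (simp add: power_divide power2_eq_square power3_eq_cube)
    also have "\<dots> \<le> r ^ 3" using c1 that by (simp add: divide_le_eq mult_le_cancel_left1)
    finally show ?thesis .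
  qed
  have "B\<^sup>2 / ?c \<le> B\<^sup>2" using c1 by (simp add: divide_le_eq mult_le_cancel_left1)
  then have "\<bar>y\<bar> \<le> B\<^sup>2" using y by linarith
  then have "\<bar>sinh y - y\<bar> \<le> exp (B\<^sup>2) * \<bar>y\<bar> ^ 3" by (rule abs_sinh_minus_self_le)
  also have "\<dots> \<le> exp (B\<^sup>2) * (B\<^sup>2 / ?c) ^ 3" using y by (intro mult_left_mono power_mono) auto
  finally have "?c\<^sup>2 * \<bar>sinh y - y\<bar> \<le> ?c\<^sup>2 * (exp (B\<^sup>2) * (B\<^sup>2 / ?c) ^ 3)" by (intro mult_left_mono) auto
  also have "\<dots> = exp (B\<^sup>2) * (?c\<^sup>2 * (B\<^sup>2 / ?c) ^ 3)" by (simp only: mult_ac)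
  also have "\<dots> \<le> exp (B\<^sup>2) * (B\<^sup>2) ^ 3" by (intro mult_left_mono cube) auto
  finally have sinh_err: "?c\<^sup>2 * \<bar>sinh y - y\<bar> \<le> exp (B\<^sup>2) * (B\<^sup>2) ^ 3" .
  have sin_err: "?c\<^sup>2 * \<bar>sin (2 * pi * x j) - 2 * pi * x j\<bar> \<le> (4 * pi * B) ^ 3" if "j < Suc h" for j
  proof -
    have "\<bar>2 * pi * x j\<bar> \<le> 4 * pi * B / ?c"
      using mult_left_mono[OF z[OF that], of "2 * pi"] by (simp add: x_def abs_mult)
    then have "\<bar>2 * pi * x j\<bar> ^ 3 \<le> (4 * pi * B / ?c) ^ 3" by (intro power_mono) auto
    moreover have "0 \<le> \<bar>2 * pi * x j\<bar> ^ 3" by (rule zero_le_power) simp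
    ultimately have "\<bar>sin (2 * pi * x j) - 2 * pi * x j\<bar> \<le> (4 * pi * B / ?c) ^ 3"
      using abs_sin_minus_self_le[of "2 * pi * x j"] by linarith
    then have "?c\<^sup>2 * \<bar>sin (2 * pi * x j) - 2 * pi * x j\<bar> \<le> ?c\<^sup>2 * (4 * pi * B / ?c) ^ 3"
      by (intro mult_left_mono) auto
    also have "\<dots> \<le> (4 * pi * B) ^ 3" by (rule cube) (use B in simp)
    finally show ?thesis .
  qed
  have "\<bar>?c\<^sup>2 * (\<Sum>j<Suc h. sin (2 * pi * x j)) - ?c\<^sup>2 * (\<Sum>j<Suc h. 2 * pi * x j)\<bar> =
      \<bar>\<Sum>j<Suc h. ?c\<^sup>2 * (sin (2 * pi * x j) - 2 * pi * x j)\<bar>"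
    by (simp only: sum_subtractf right_diff_distrib sum_distrib_left)
  also have "\<dots> \<le> (\<Sum>j<Suc h. ?c\<^sup>2 * \<bar>sin (2 * pi * x j) - 2 * pi * x j\<bar>)"
    by (rule order_trans[OF sum_abs]) (simp only: abs_mult abs_power2 order_refl)
  also have "\<dots> \<le> (\<Sum>j<Suc h. (4 * pi * B) ^ 3)"
    by (rule sum_mono) (use sin_err in auto)
  also have "\<dots> = real (Suc h) * (4 * pi * B) ^ 3"
    by (simp del: sum.lessThan_Suc)
  finally have sum_err: "\<bar>?c\<^sup>2 * (\<Sum>j<Suc h. sin (2 * pi * x j)) - ?c\<^sup>2 * (\<Sum>j<Suc h. 2 * pi * x j)\<bar>
      \<le> real (Suc h) * (4 * pi * B) ^ 3" .
  have "\<bar>2 * ?c\<^sup>2 * y - ?c\<^sup>2 * (\<Sum>j<Suc h. 2 * pi * x j)\<bar> \<le> E"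
  proof -
    have "\<bar>2 * ?c\<^sup>2 * sinh y - 2 * ?c\<^sup>2 * y\<bar> \<le> 2 * (exp (B\<^sup>2) * (B\<^sup>2) ^ 3)"
      using sinh_err by (simp add: abs_mult flip: right_diff_distrib)
    then show ?thesis using sum_err corner unfolding E_def sin_x by linarith
  qed
  moreover have "2 * ?c\<^sup>2 * y - ?c\<^sup>2 * (\<Sum>j<Suc h. 2 * pi * x j) = 2 * pi * (?c\<^sup>2 * of_int N - ?m)"
  proof -
    have "(\<Sum>j<Suc h. 2 * pi * x j) = 2 * pi * (?m * (\<Sum>j<Suc h. rotnum ?c j) - of_int N)"
      by (simp only: x_def N_def sum_subtractf of_int_sum flip: sum_distrib_left)
    then show ?thesis
      unfolding sum_rotnum y_def s_def using c1
      by (simp add: field_simps power_add power2_eq_square power3_eq_cube)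
  qed
  ultimately have *: "2 * pi * \<bar>?c\<^sup>2 * of_int N - ?m\<bar> \<le> E" by (simp only: abs_mult) simp
  define d0 where "d0 = m - int c ^ 2 * N"
  have d0: "\<bar>real_of_int d0\<bar> \<le> E"
  proof -
    have "1 * \<bar>?c\<^sup>2 * of_int N - ?m\<bar> \<le> 2 * pi * \<bar>?c\<^sup>2 * of_int N - ?m\<bar>"
      using pi_gt3 by (intro mult_right_mono) auto
    with * show ?thesis by (simp add: d0_def abs_minus_commute)
  qed
  define C where "C = 2 * B + B\<^sup>2 + E"
  have pow: "1 \<le> ?c ^ j" for j using c1 by (rule one_le_power)
  have m_le: "\<bar>?m\<bar> \<le> B\<^sup>2 * ?c ^ (h + 2)"
  proof -
    have "\<bar>?m\<bar> * 1 \<le> \<bar>?m\<bar> * pi" using pi_gt3 by (intro mult_left_mono) auto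
    also have "\<bar>?m\<bar> * pi = \<bar>y\<bar> * ?c ^ (h + 3)"
      using c1 by (simp add: y_def s_def abs_mult)
    also have "\<dots> \<le> B\<^sup>2 / ?c * ?c ^ (h + 3)" using y by (intro mult_right_mono) auto
    also have "\<dots> = B\<^sup>2 * ?c ^ (h + 2)" using c1 by (simp add: numeral_eq_Suc)
    finally show ?thesis by simp
  qed
  have N_eq: "of_int N * ?c\<^sup>2 = ?m - of_int d0" by (simp add: d0_def)
  have N_le: "\<bar>real_of_int N\<bar> \<le> C * ?c ^ h"
  proof -
    have "\<bar>real_of_int N\<bar> * ?c\<^sup>2 = \<bar>?m - of_int d0\<bar>" unfolding N_eq[symmetric] by (simp add: abs_mult)
    also have "\<dots> \<le> B\<^sup>2 * ?c ^ (h + 2) + E * ?c ^ (h + 2)"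
      using m_le d0 mult_left_mono[OF pow[of "h + 2"], of E] E0 B by linarith
    also have "\<dots> \<le> C * ?c ^ (h + 2)"
      unfolding C_def distrib_right[symmetric] using B by (intro mult_right_mono) auto
    also have "\<dots> = C * ?c ^ h * ?c\<^sup>2" by (simp only: power_add mult.assoc)
    finally show ?thesis by (rule mult_right_le_imp_le) (use c1 in simp)
  qed
  have "\<exists>d. N = (\<Sum>i<Suc h. d i * int c ^ i) \<and> (\<forall>i. \<bar>real_of_int (d i)\<bar> \<le> 2 ^ h * C)"
  proof (rule bounded_digits_expansion[OF c N_le])
    fix j assume j: "1 \<le> j" "j \<le> h"
    then obtain j' where j': "j = Suc j'" "j' < h" by (cases j) auto
    have "real_of_int N / ?c ^ j = real_of_int N * ?c\<^sup>2 / ?c ^ (j' + 3)"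
      using c1 by (simp add: j' numeral_eq_Suc)
    also have "\<dots> = ?m * rotnum ?c j' - of_int d0 / ?c ^ (j' + 3)"
      unfolding N_eq using j' by (simp add: rotnum_def diff_divide_distrib)
    finally have eq: "real_of_int N / ?c ^ j - of_int (z j') = (?m * rotnum ?c j' - of_int (z j')) - of_int d0 / ?c ^ (j' + 3)"
      by simp
    have "\<bar>real_of_int d0 / ?c ^ (j' + 3)\<bar> \<le> E / ?c"
    proof -
      have "?c * 1 \<le> ?c * ?c ^ (j' + 2)" by (intro mult_left_mono pow) (use c1 in simp)
      then have "?c \<le> ?c ^ (j' + 3)" by (simp add: numeral_eq_Suc)
      then show ?thesis using d0 c1 E0 B by (simp only: abs_divide) (intro frac_le, auto)
    qed
    then have "\<bar>real_of_int N / ?c ^ j - of_int (z j')\<bar> \<le> 2 * B / ?c + E / ?c"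
      unfolding eq using z[of j'] j' by linarith
    also have "\<dots> \<le> C / ?c"
      unfolding add_divide_distrib[symmetric] C_def using c1 by (intro divide_right_mono) auto
    finally show "\<exists>z::int. \<bar>real_of_int N / ?c ^ j - of_int z\<bar> \<le> C / ?c" by blast
  qed
  then obtain d where d: "N = (\<Sum>i<Suc h. d i * int c ^ i)" "\<And>i. \<bar>real_of_int (d i)\<bar> \<le> 2 ^ h * C" by blast
  define d' where "d' i = (case i of 0 \<Rightarrow> d0 | Suc i \<Rightarrow> d i)" for i
  have "(\<Sum>i<Suc (Suc h). d' i * int c ^ (if i = 0 then 0 else i + 1)) = d0 + (\<Sum>i<Suc h. d i * int c ^ (i + 2))"
    by (subst sum.lessThan_Suc_shift) (simp add: d'_def)
  also have "(\<Sum>i<Suc h. d i * int c ^ (i + 2)) = int c ^ 2 * N"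
    unfolding d(1) sum_distrib_left by (rule sum.cong) (simp_all add: power_add power2_eq_square mult_ac)
  finally have "m = (\<Sum>i<Suc (Suc h). d' i * int c ^ (if i = 0 then 0 else i + 1))"
    by (simp add: d0_def)
  moreover have "\<bar>real_of_int (d' i)\<bar> \<le> 2 ^ h * C" for i
  proof (cases i)
    case 0
    have "E \<le> 1 * C" using B by (simp add: C_def)
    also have "\<dots> \<le> 2 ^ h * C" using B E0 by (intro mult_right_mono one_le_power) (auto simp: C_def)
    finally show ?thesis using d0 by (simp add: d'_def 0)
  next
    case (Suc j)
    then show ?thesis using d(2) by (simp add: d'_def)
  qed
  ultimately show ?thesis unfolding C_def by blast
qed

lemma flow_proper:
  assumes c: "1 \<le> c" and B: "norm (flow (real c) (real_of_int m)) \<le> B" and B': "B' = max 1 (4 * B)"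
  shows "\<exists>d. m = (\<Sum>i<Suc (Suc h). d i * int c ^ (if i = 0 then 0 else i + 1)) \<and>
    (\<forall>i. \<bar>real_of_int (d i)\<bar> \<le> 2 ^ h * (2 * B' + B'\<^sup>2 +
      (B' + 2 * (exp (B'\<^sup>2) * (B'\<^sup>2) ^ 3) + real (Suc h) * (4 * pi * B') ^ 3)))"
proof -
  let ?c = "real c" and ?m = "real_of_int m"
  define y where "y = ?m * s ?c"
  define \<mu> where "\<mu> = cis (?m * \<psi> ?c)"
  have c1: "?c \<ge> 1" using c by simp
  have \<mu>: "norm \<mu> = 1" by (simp add: \<mu>_def)
  have B'1: "1 \<le> B'" and B'4: "4 * B \<le> B'" by (auto simp: B')
  note bounds = conjugation.isometry_matrix_bounds[OF conjugation_complex rot_unitary B[unfolded flow_def], folded y_def \<mu>_def]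
  have exp_y: "exp y \<le> B'" using bounds(1) B'4 by (simp add: norm_mult \<mu>)
  have column: "norm (of_real (exp (- y)) - cis (?m * ang ?c (p j))) \<le> B' / ?c" if j: "j < Suc h" for j
  proof -
    have z: "fixed_point ?c (p j) = of_real ?c" using j by (auto simp: fixed_point_def supp_def)
    have "\<mu> * of_real (exp (- y)) * fixed_point ?c (p j) - rot ?c ?m (fixed_point ?c) (p j) =
        \<mu> * (of_real ?c * (of_real (exp (- y)) - cis (?m * ang ?c (p j))))"
      unfolding rot_fixed_point[OF j] z \<mu>_def by (simp add: algebra_simps)
    then have "norm (\<mu> * (of_real ?c * (of_real (exp (- y)) - cis (?m * ang ?c (p j))))) \<le> B'"
      using bounds(3)[OF p_neq[OF j]] B'4 by simp
    then have "?c * norm (of_real (exp (- y)) - cis (?m * ang ?c (p j))) \<le> B'"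
      by (simp add: norm_mult \<mu>)
    then show ?thesis using c1 by (simp only: pos_le_divide_eq) (simp add: mult.commute)
  qed
  have "\<bar>y\<bar> \<le> B' * (B' / ?c)"
    by (rule column_bounds(1)[OF exp_y B'1 column[of 0]]) simp
  then have y: "\<bar>y\<bar> \<le> B'\<^sup>2 / ?c" by (simp add: power2_eq_square)
  have "\<exists>z::int. \<bar>?m * rotnum ?c j - of_int z\<bar> \<le> 2 * B' / ?c" if "j < Suc h" for j
  proof (rule near_integer_if_cis_near_1)
    have "norm (cis (?m * ang ?c (p j)) - 1) \<le> 2 * (B' / ?c)"
      by (rule column_bounds(2)[OF exp_y B'1 column[OF that]])
    then show "norm (cis (2 * pi * (?m * rotnum ?c j)) - 1) \<le> 2 * B' / ?c"
      by (simp add: ang_p[OF that] mult_ac)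
  qed
  then obtain z :: "nat \<Rightarrow> int" where z: "\<And>j. j < Suc h \<Longrightarrow> \<bar>?m * rotnum ?c j - of_int (z j)\<bar> \<le> 2 * B' / ?c"
    by metis
  let ?S = "\<Sum>j<Suc h. sin (?m * ang ?c (p j))"
  define Z where "Z = Complex (\<Sum>j<Suc h. ?c\<^sup>2 * ((exp y + exp (- y)) / 2 - cos (?m * ang ?c (p j))))
        (2 * ?c\<^sup>2 * sinh y - ?c\<^sup>2 * ?S)"
  have "norm (\<mu> * Z) \<le> B'"
    using bounds(4) B'4 unfolding Z_def \<mu>_def flow_corner by linarith
  then have "norm Z \<le> B'" by (simp only: norm_mult \<mu> mult_1)
  then have "\<bar>Im Z\<bar> \<le> B'" by (rule order_trans[OF abs_Im_le_cmod])
  then have "\<bar>2 * ?c\<^sup>2 * sinh y - ?c\<^sup>2 * ?S\<bar> \<le> B'" by (simp only: Z_def complex.sel)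
  moreover have "?S = (\<Sum>j<Suc h. sin (?m * (2 * pi * rotnum ?c j)))"
    by (rule sum.cong) (simp_all add: ang_p)
  ultimately have corner: "\<bar>2 * ?c\<^sup>2 * sinh y - ?c\<^sup>2 * (\<Sum>j<Suc h. sin (?m * (2 * pi * rotnum ?c j)))\<bar> \<le> B'"
    by (simp only:)
  show ?thesis
    by (rule digits_bounded[OF c B'1 y[unfolded y_def] z corner[unfolded y_def]])
qed

text \<open>
  The exponent is \<open>m = d 0 + c\<^sup>2 * N\<close>. As in the real case, rotation numbers modulo 1 and the dilation exponent are
  \<open>1 / c\<close> times convergent sequences, and in the vertical displacement the terms of order \<open>c\<close>
  cancel. The phase converges because \<open>c\<close> is a multiple of \<open>k + 2\<close>: of the digits of \<open>N\<close>, all but the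
  lowest contribute full turns.
\<close>
lemma flow_convergent:
  fixes d :: "nat \<Rightarrow> int"
  shows "convergent (\<lambda>n. flow (real ((k + 2) * Suc n))
    (real_of_int (\<Sum>i<Suc (Suc h). d i * int ((k + 2) * Suc n) ^ (if i = 0 then 0 else i + 1))))"
proof -
  define cn where "cn n = (k + 2) * Suc n" for n
  define c where "c n = real (cn n)" for n
  define N where "N n = (\<Sum>i<Suc h. d (Suc i) * int (cn n) ^ i)" for n
  define m where "m n = (\<Sum>i<Suc (Suc h). d i * int (cn n) ^ (if i = 0 then 0 else i + 1))" for n
  define M where "M n = real_of_int (m n)" for n
  define d0 where "d0 = real_of_int (d 0)"
  define S where "S j n = (\<Sum>i<Suc j. of_int (d (Suc i)) * c n ^ i)" for j n
  have "filterlim (\<lambda>n. real (Suc n)) at_top sequentially"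
    by (rule filterlim_compose[OF filterlim_real_sequentially filterlim_Suc])
  then have "filterlim (\<lambda>n. real (k + 2) * real (Suc n)) at_top sequentially"
    by (rule filterlim_tendsto_pos_mult_at_top[OF tendsto_const, rotated]) simp
  then have c: "filterlim c at_top sequentially" by (simp only: c_def[abs_def] cn_def of_nat_mult)
  have cn: "1 \<le> cn n" for n by (simp add: cn_def)
  have c_pos: "c n > 0" for n using cn[of n] by (simp add: c_def)
  have small: "(\<lambda>n. a / c n ^ Suc j) \<longlonglongrightarrow> 0" for a :: real and j
  proof (induction j)
    case 0
    show ?case
      using tendsto_divide_0[OF tendsto_const filterlim_at_top_imp_at_infinity[OF c]] by simp
  next
    case (Suc j)
    have "(\<lambda>n. a / c n ^ Suc j / c n) \<longlonglongrightarrow> 0"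
      by (rule tendsto_divide_0[OF Suc.IH filterlim_at_top_imp_at_infinity[OF c]])
    then show ?case by (simp add: mult.commute)
  qed
  have m_eq: "m n = d 0 + int (cn n) ^ 2 * N n" for n
  proof -
    have "m n = d 0 + (\<Sum>i<Suc h. d (Suc i) * int (cn n) ^ (i + 2))"
      unfolding m_def by (subst sum.lessThan_Suc_shift) simp
    also have "(\<Sum>i<Suc h. d (Suc i) * int (cn n) ^ (i + 2)) = int (cn n) ^ 2 * N n"
      unfolding N_def sum_distrib_left
      by (rule sum.cong) (simp_all add: power_add power2_eq_square mult_ac)
    finally show ?thesis .
  qed
  have M_eq: "M n = d0 + (c n)\<^sup>2 * of_int (N n)" for n
    by (simp add: M_def m_eq d0_def c_def)
  have N_S: "real_of_int (N n) = S h n" for n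
    by (simp only: N_def S_def of_int_sum of_int_mult of_int_power of_int_of_nat_eq c_def)
  have "(\<lambda>n. d0 / c n ^ Suc (Suc h) * 1 + S h n / c n ^ h) \<longlonglongrightarrow> 0 * 1 + of_int (d (Suc h))"
    unfolding S_def by (intro tendsto_intros small leading_digit[OF c])
  moreover have "d0 / c n ^ Suc (Suc h) * 1 + S h n / c n ^ h = M n / c n ^ (h + 2)" for n
    using c_pos[of n] by (simp add: M_eq N_S add_divide_distrib power2_eq_square)
  ultimately have M_lim: "(\<lambda>n. M n / c n ^ (h + 2)) \<longlonglongrightarrow> of_int (d (Suc h))" by simp

  define u where "u n = M n * s (c n)" for n
  have "c n * u n = pi * (M n / c n ^ (h + 2))" for n
    using c_pos[of n] by (simp add: u_def s_def numeral_eq_Suc)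
  then have u: "(\<lambda>n. c n * u n) \<longlonglongrightarrow> pi * of_int (d (Suc h))"
    using tendsto_mult_left[OF M_lim, of pi] by simp

  \<comment> \<open>Representatives modulo 1 of the rotation numbers, chosen small.\<close>
  define w where "w j n = d0 / c n ^ (j + 3) + S j n / c n ^ Suc j" for j n
  define x where "x j n = (if j < h then w j n else d0 / (c n)\<^sup>2 + M n / c n ^ (h + 3) - (\<Sum>j<h. w j n))" for j n
  have sum_x: "(\<Sum>j<Suc h. x j n) = d0 / (c n)\<^sup>2 + M n / c n ^ (h + 3)" for n
  proof -
    have "(\<Sum>j<h. x j n) = (\<Sum>j<h. w j n)" by (rule sum.cong) (simp_all add: x_def)
    then show ?thesis by (simp add: x_def)
  qed
  have w_lim: "(\<lambda>n. c n * w j n) \<longlonglongrightarrow> of_int (d (Suc j))" for j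
  proof -
    have "(\<lambda>n. d0 / c n ^ Suc (Suc j) + S j n / c n ^ j) \<longlonglongrightarrow> 0 + of_int (d (Suc j))"
      unfolding S_def by (intro tendsto_add small leading_digit[OF c])
    moreover have "d0 / c n ^ Suc (Suc j) + S j n / c n ^ j = c n * w j n" for n
      using c_pos[of n] by (simp add: w_def distrib_left numeral_eq_Suc)
    ultimately show ?thesis by simp
  qed
  define X :: "nat \<Rightarrow> real"
    where "X j = (if j < h then of_int (d (Suc j)) else of_int (d (Suc h)) - (\<Sum>j<h. of_int (d (Suc j))))" for j
  have x_lim: "(\<lambda>n. c n * x j n) \<longlonglongrightarrow> X j" for j
  proof (cases "j < h")
    case True
    then show ?thesis using w_lim[of j] by (simp add: x_def X_def)
  next
    case False
    have "(\<lambda>n. d0 / c n ^ Suc 0 + M n / c n ^ (h + 2) - (\<Sum>j<h. c n * w j n)) \<longlonglongrightarrow>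
        0 + of_int (d (Suc h)) - (\<Sum>j<h. of_int (d (Suc j)))"
      by (intro tendsto_add tendsto_diff tendsto_sum small M_lim w_lim)
    moreover have "d0 / c n ^ Suc 0 + M n / c n ^ (h + 2) - (\<Sum>j<h. c n * w j n) = c n * x j n" for n
      using c_pos[of n] False
      by (simp add: x_def distrib_left right_diff_distrib sum_distrib_left numeral_eq_Suc)
    ultimately show ?thesis using False by (simp add: X_def)
  qed
  have w_int: "\<exists>I::int. M n / c n ^ (j + 3) = w j n + of_int I" if "j < h" for j n
  proof -
    have "j < Suc h" using that by simp
    then obtain I where I: "real_of_int (N n) / c n ^ Suc j = S j n / c n ^ Suc j + of_int I"
      using expansion_div_mod_int[of j "Suc h" "cn n" "\<lambda>i. d (Suc i)"] cn unfolding N_def c_def S_def by blast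
    have "M n / c n ^ (j + 3) = d0 / c n ^ (j + 3) + real_of_int (N n) / c n ^ Suc j"
      using c_pos[of n] by (simp add: M_eq add_divide_distrib numeral_eq_Suc)
    then show ?thesis using I by (simp add: w_def)
  qed
  then obtain I :: "nat \<Rightarrow> nat \<Rightarrow> int" where I: "\<And>j n. j < h \<Longrightarrow> M n / c n ^ (j + 3) = w j n + of_int (I j n)"
    by metis
  have "\<exists>J::int. M n * rotnum (c n) j = x j n + of_int J" for j n
  proof (cases "j < h")
    case True
    then show ?thesis using I by (auto simp: rotnum_def x_def)
  next
    case False
    have "(\<Sum>j<h. M n / c n ^ (j + 3)) = (\<Sum>j<h. w j n) + of_int (\<Sum>j<h. I j n)"
      unfolding of_int_sum sum.distrib[symmetric] by (rule sum.cong) (simp_all add: I)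
    moreover have "M n / (c n)\<^sup>2 = d0 / (c n)\<^sup>2 + of_int (N n)"
      using c_pos[of n] by (simp add: M_eq add_divide_distrib)
    moreover have "M n * rotnum (c n) j = M n / (c n)\<^sup>2 + M n / c n ^ (h + 3) - (\<Sum>j<h. M n / c n ^ (j + 3))"
      using False by (simp add: rotnum_def distrib_left right_diff_distrib sum_distrib_left)
    ultimately have "M n * rotnum (c n) j = x j n + of_int (N n - (\<Sum>j<h. I j n))"
      using False by (simp add: x_def)
    then show ?thesis by blast
  qed
  note ex_J = this
  define J where "J j n = (SOME J::int. M n * rotnum (c n) j = x j n + of_int J)" for j n
  have J: "M n * rotnum (c n) j = x j n + of_int (J j n)" for j n
    unfolding J_def by (rule someI_ex[OF ex_J])
  define v where "v j n = 2 * pi * x j n" for j n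
  have v: "(\<lambda>n. c n * v j n) \<longlonglongrightarrow> 2 * pi * X j" for j
    using tendsto_mult_left[OF x_lim[of j], of "2 * pi"] by (simp add: v_def mult_ac)
  have cis_v: "cis (M n * ang (c n) (p j)) = cis (v j n)" if "j < Suc h" for j n
  proof -
    have "M n * ang (c n) (p j) = 2 * pi * (M n * rotnum (c n) j)"
      unfolding ang_p[OF that] by simp
    then show ?thesis unfolding J v_def by (simp only: cis_add_2pi_int)
  qed
  have v0: "v j \<longlonglongrightarrow> 0" for j by (rule tendsto_zero_if_rescaled_convergent[OF v c])
  have u0: "u \<longlonglongrightarrow> 0" by (rule tendsto_zero_if_rescaled_convergent[OF u c])

  define \<mu> where "\<mu> n = cis (M n * \<psi> (c n))" for n
  have \<mu>: "convergent \<mu>"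
  proof -
    define q where "q n = - (d0 / c n ^ Suc 1 + of_int (d 1) + M n / c n ^ (h + 2) / c n ^ 1) / real (k + 2)" for n
    have "(\<lambda>n. M n / c n ^ (h + 2) / c n ^ 1) \<longlonglongrightarrow> 0"
      using tendsto_divide_0[OF M_lim filterlim_at_top_imp_at_infinity[OF c]] by simp
    then have "q \<longlonglongrightarrow> - (0 + of_int (d 1) + 0) / real (k + 2)"
      unfolding q_def by (intro tendsto_intros small) simp_all
    then have "(\<lambda>n. cis (2 * pi * q n)) \<longlonglongrightarrow> cis (2 * pi * (- (0 + of_int (d 1) + 0) / real (k + 2)))"
      by (intro tendsto_intros tendsto_cis)
    moreover have "\<mu> = (\<lambda>n. cis (2 * pi * q n))"
    proof
      fix n
      obtain N' where N': "N n = d 1 + int (cn n) * N'"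
        using digit_expansion_mod[of 1 "Suc h" "\<lambda>i. d (Suc i)" "int (cn n)"] by (auto simp: N_def)
      have "real_of_int (N n) / real (k + 2) = of_int (d 1) / real (k + 2) + of_int (int (Suc n) * N')"
        unfolding N' cn_def by (simp add: field_simps)
      moreover have "M n * \<psi> (c n) = 2 * pi * (- (d0 / (c n)\<^sup>2 + M n / c n ^ (h + 3)) / real (k + 2) - real_of_int (N n) / real (k + 2))"
      proof -
        have "M n * \<psi> (c n) = 2 * pi * (- (M n / (c n)\<^sup>2 + M n / c n ^ (h + 3)) / real (k + 2))"
          by (simp add: \<psi>_def algebra_simps add_divide_distrib diff_divide_distrib)
        also have "M n / (c n)\<^sup>2 = d0 / (c n)\<^sup>2 + of_int (N n)"
          using c_pos[of n] by (simp add: M_eq add_divide_distrib)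
        finally show ?thesis by (simp add: add_divide_distrib diff_divide_distrib)
      qed
      ultimately have "M n * \<psi> (c n) = 2 * pi * (q n + of_int (- (int (Suc n) * N')))"
        by (simp add: q_def numeral_eq_Suc add_divide_distrib diff_divide_distrib)
      then show "\<mu> n = cis (2 * pi * q n)" unfolding \<mu>_def by (simp only: cis_add_2pi_int)
    qed
    ultimately show ?thesis unfolding convergent_def by blast
  qed

  have convI: "X \<longlonglongrightarrow> L \<Longrightarrow> convergent X" for X :: "nat \<Rightarrow> 'z::topological_space" and L
    by (auto simp: convergent_def)
  have e1: "convergent (\<lambda>n. \<mu> n * of_real (exp (u n)))" "convergent (\<lambda>n. \<mu> n * of_real (exp (- u n)))"
    using tendsto_of_real[OF tendsto_exp[OF u0]] tendsto_of_real[OF tendsto_exp[OF tendsto_minus[OF u0]]]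
    by (auto intro!: convergent_mult \<mu> intro: convI)
  have col: "convergent (\<lambda>n. of_real (c n) * (of_real (exp (- u n)) - cis (v j n)))" for j
    by (rule convI[OF rescaled_exp_cis[OF c u v]])
  have row: "convergent (\<lambda>n. of_real (c n) * (of_real (exp (u n)) - cis (v j n)))" for j
  proof -
    have "(\<lambda>n. c n * - u n) \<longlonglongrightarrow> - (pi * of_int (d (Suc h)))"
      using tendsto_minus[OF u] by simp
    from convI[OF rescaled_exp_cis[OF c this v]] show ?thesis by simp
  qed
  have rot_p: "rot (c n) (M n) f (p j) = \<mu> n * cis (v j n) * f (p j)" if "j < Suc h" for n f j
    by (simp add: rot_def distrib_left \<mu>_def flip: cis_mult cis_v[OF that])
  have rot_off: "rot (c n) (M n) f i = \<mu> n * f i" if "i \<notin> supp" for n f i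
    using that by (simp add: rot_def ang_def \<mu>_def)
  have "convergent (\<lambda>n. isometry_matrix cnj i0 (fixed_point (c n)) (fixed_height (c n)) (\<mu> n * of_real (exp (u n)))
      (\<mu> n * of_real (exp (- u n))) (rot (c n) (M n)))"
  proof (rule conjugation.convergent_isometry_matrix[OF conjugation_complex rot_unitary e1])
    fix f and i :: 'm
    show "convergent (\<lambda>n. rot (c n) (M n) f i)"
    proof (cases i rule: supp_cases)
      case (1 j)
      show ?thesis unfolding 1(2) rot_p[OF 1(1)]
        by (intro convergent_mult \<mu> convergent_const convI[OF tendsto_cis[OF v0]])
    next
      case 2
      then show ?thesis unfolding rot_off[OF 2] by (intro convergent_mult \<mu> convergent_const)
    qed
    show "convergent (\<lambda>n. \<mu> n * of_real (exp (- u n)) * fixed_point (c n) i - rot (c n) (M n) (fixed_point (c n)) i)"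
    proof (cases i rule: supp_cases)
      case (1 j)
      have "\<mu> n * of_real (exp (- u n)) * fixed_point (c n) i - rot (c n) (M n) (fixed_point (c n)) i =
          \<mu> n * (of_real (c n) * (of_real (exp (- u n)) - cis (v j n)))" for n
        using 1(3) unfolding 1(2) rot_p[OF 1(1)] by (simp add: fixed_point_def algebra_simps)
      then show ?thesis using convergent_mult[OF \<mu> col[of j]] by simp
    next
      case 2
      then show ?thesis by (simp add: rot_off fixed_point_def convergent_const)
    qed
  next
    fix f :: "'m \<Rightarrow> complex"
    have "convergent (\<lambda>n. cnj (fixed_point (c n) i) * (rot (c n) (M n) f i - \<mu> n * of_real (exp (u n)) * f i))" for i
    proof (cases i rule: supp_cases)
      case (1 j)
      have "cnj (fixed_point (c n) i) * (rot (c n) (M n) f i - \<mu> n * of_real (exp (u n)) * f i) =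
          - (\<mu> n * (of_real (c n) * (of_real (exp (u n)) - cis (v j n)))) * f i" for n
        using 1(3) unfolding 1(2) rot_p[OF 1(1)] by (simp add: fixed_point_def algebra_simps)
      moreover have "convergent (\<lambda>n. - (\<mu> n * (of_real (c n) * (of_real (exp (u n)) - cis (v j n)))) * f i)"
        by (intro convergent_mult convergent_const convergent_minus_iff[THEN iffD1] \<mu> row)
      ultimately show ?thesis by simp
    next
      case 2
      then show ?thesis by (simp add: fixed_point_def convergent_const)
    qed
    then show "convergent (\<lambda>n. \<Sum>i\<in>- {i0}. cnj (fixed_point (c n) i) * (rot (c n) (M n) f i - \<mu> n * of_real (exp (u n)) * f i))"
      by (intro convergent_sum)
  next
    have cos_v: "cos (M n * ang (c n) (p j)) = cos (v j n)" and sin_v: "sin (M n * ang (c n) (p j)) = sin (v j n)"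
      if "j < Suc h" for n j
      using cis_v[OF that, of n] by (simp_all add: complex_eq_iff)
    have "convergent (\<lambda>n. \<Sum>j<Suc h. (c n)\<^sup>2 * ((exp (u n) + exp (- u n)) / 2 - cos (v j n)))"
      by (intro convergent_sum convI[OF rescaled_square[OF c u v]])
    then obtain R1 where R1: "(\<lambda>n. \<Sum>j<Suc h. (c n)\<^sup>2 * ((exp (u n) + exp (- u n)) / 2 - cos (v j n))) \<longlonglongrightarrow> R1"
      by (auto simp: convergent_def)
    \<comment> \<open>The linear terms of the vertical displacement cancel up to the lowest digit.\<close>
    have "2 * (c n)\<^sup>2 * sinh (u n) - (c n)\<^sup>2 * (\<Sum>j<Suc h. sin (v j n)) =
        2 * ((c n)\<^sup>2 * (sinh (u n) - u n)) - (\<Sum>j<Suc h. (c n)\<^sup>2 * (sin (v j n) - v j n)) + (- 2 * pi * d0)" for n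
    proof -
      have "(\<Sum>j<Suc h. v j n) = 2 * pi * (d0 / (c n)\<^sup>2 + M n / c n ^ (h + 3))"
        unfolding v_def sum_distrib_left[symmetric] sum_x ..
      then have "2 * (c n)\<^sup>2 * u n - (c n)\<^sup>2 * (\<Sum>j<Suc h. v j n) = - 2 * pi * d0"
        using c_pos[of n] by (simp add: u_def s_def distrib_left numeral_eq_Suc)
      then show ?thesis
        by (simp add: right_diff_distrib sum_subtractf sum_distrib_left del: sum.lessThan_Suc)
    qed
    moreover have "(\<lambda>n. 2 * ((c n)\<^sup>2 * (sinh (u n) - u n)) - (\<Sum>j<Suc h. (c n)\<^sup>2 * (sin (v j n) - v j n)) + (- 2 * pi * d0))
        \<longlonglongrightarrow> 2 * 0 - (\<Sum>j<Suc h. 0) + (- 2 * pi * d0)"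
      by (intro tendsto_add tendsto_diff tendsto_sum tendsto_mult_left tendsto_const
          rescaled_sinh_error[OF c u v] rescaled_sin_error[OF c u v])
    ultimately have R2: "(\<lambda>n. 2 * (c n)\<^sup>2 * sinh (u n) - (c n)\<^sup>2 * (\<Sum>j<Suc h. sin (v j n)))
        \<longlonglongrightarrow> 2 * 0 - (\<Sum>j<Suc h. 0) + (- 2 * pi * d0)"
      by (simp only:)
    have "convergent (\<lambda>n. \<mu> n * Complex (\<Sum>j<Suc h. (c n)\<^sup>2 * ((exp (u n) + exp (- u n)) / 2 - cos (v j n)))
        (2 * (c n)\<^sup>2 * sinh (u n) - (c n)\<^sup>2 * (\<Sum>j<Suc h. sin (v j n))))"
      by (intro convergent_mult \<mu> convI[OF tendsto_Complex[OF R1 R2]])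
    moreover have "\<mu> n * of_real (exp (- u n)) * fixed_height (c n) + \<mu> n * of_real (exp (u n)) * cnj (fixed_height (c n))
        - (\<Sum>i\<in>- {i0}. cnj (fixed_point (c n) i) * rot (c n) (M n) (fixed_point (c n)) i) =
      \<mu> n * Complex (\<Sum>j<Suc h. (c n)\<^sup>2 * ((exp (u n) + exp (- u n)) / 2 - cos (v j n)))
        (2 * (c n)\<^sup>2 * sinh (u n) - (c n)\<^sup>2 * (\<Sum>j<Suc h. sin (v j n)))" for n
      unfolding \<mu>_def flow_corner by (simp add: cos_v sin_v cong: sum.cong_simp del: sum.lessThan_Suc)
    ultimately show "convergent (\<lambda>n. \<mu> n * of_real (exp (- u n)) * fixed_height (c n) + \<mu> n * of_real (exp (u n)) * cnj (fixed_height (c n))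
        - (\<Sum>i\<in>- {i0}. cnj (fixed_point (c n) i) * rot (c n) (M n) (fixed_point (c n)) i))"
      by simp
  qed
  then show ?thesis
    by (simp only: flow_def u_def \<mu>_def c_def M_def m_def cn_def)
qed

theorem geometric_limit_SU:
  shows "\<exists>(\<rho> :: nat \<Rightarrow> int \<Rightarrow> complex ^ 'm option ^ 'm option) \<rho>_lim \<Gamma>.
            (\<forall>n. convex_cocompact SU herm_quad (\<rho> n)) \<and>
            algebraically_converges \<rho> \<rho>_lim \<and>
            discrete_faithful SU \<rho>_lim \<and>
            geometric_limit SU (\<lambda>n. range (\<rho> n)) \<Gamma> \<and>
            SU\<lparr>carrier := \<Gamma>\<rparr> \<cong> product_group {..<Suc (Suc h)} (\<lambda>_. integer_group)"
proof -
  define c where "c n = (k + 2) * Suc n" for n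
  have c1: "1 \<le> c n" for n by (simp add: c_def)
  define \<rho> :: "nat \<Rightarrow> int \<Rightarrow> complex ^ 'm option ^ 'm option" where "\<rho> n m = flow (real (c n)) (real_of_int m)" for n m
  have hom: "\<rho> n \<in> hom integer_group SU" for n
  proof (rule homI)
    fix x y :: int
    show "\<rho> n (x \<otimes>\<^bsub>integer_group\<^esub> y) = \<rho> n x \<otimes>\<^bsub>SU\<^esub> \<rho> n y"
      by (simp add: \<rho>_def integer_group_def SU_def flow_add)
  qed (simp add: \<rho>_def flow_SU)
  have "loxodromic herm_quad (\<rho> n 1)" for n
    using flow_loxodromic[of "real (c n)"] c1[of n] by (simp add: \<rho>_def)
  then have "convex_cocompact SU herm_quad (\<rho> n)" for n
    using hom by (simp add: convex_cocompact_def)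
  moreover have "\<exists>\<rho>_lim \<Gamma>. algebraically_converges \<rho> \<rho>_lim \<and> discrete_faithful SU \<rho>_lim \<and>
      geometric_limit SU (\<lambda>n. range (\<rho> n)) \<Gamma> \<and>
      SU\<lparr>carrier := \<Gamma>\<rparr> \<cong> product_group {..<Suc (Suc h)} (\<lambda>_. integer_group)"
  proof (rule geometric_limit_of_cyclic_groups[OF _ closed_SU _ hom, where e = "\<lambda>i. if i = 0 then 0 else i + 1" and c = c])
    show "group (SU :: (complex ^ 'm option ^ 'm option) monoid)"
      unfolding SU_eq by (rule group_special_isometries)
  next
    fix x y :: "nat \<Rightarrow> complex ^ 'm option ^ 'm option" and a b
    assume "x \<longlonglongrightarrow> a" "y \<longlonglongrightarrow> b"
    then show "(\<lambda>n. x n \<otimes>\<^bsub>SU\<^esub> y n) \<longlonglongrightarrow> a \<otimes>\<^bsub>SU\<^esub> b"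
      by (simp add: SU_def tendsto_matrix_mult)
  next
    have "n \<le> c n" for n by (simp add: c_def)
    then show "filterlim c at_top sequentially"
      by (intro filterlim_at_top_mono[OF filterlim_ident]) simp
  next
    show "inj_on (\<lambda>i. if i = 0 then 0 else i + 1) {..<Suc (Suc h)}"
      by (auto simp: inj_on_def split: if_splits)
  next
    fix d :: "nat \<Rightarrow> int"
    show "convergent (\<lambda>n. \<rho> n (\<Sum>i<Suc (Suc h). d i * int (c n) ^ (if i = 0 then 0 else i + 1)))"
      unfolding \<rho>_def c_def by (rule flow_convergent)
  next
    fix B :: real
    define K where "K = \<lfloor>2 ^ h * (2 * max 1 (4 * B) + (max 1 (4 * B))\<^sup>2 +
      (max 1 (4 * B) + 2 * (exp ((max 1 (4 * B))\<^sup>2) * ((max 1 (4 * B))\<^sup>2) ^ 3) + real (Suc h) * (4 * pi * max 1 (4 * B)) ^ 3))\<rfloor>"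
    show "\<exists>K. \<forall>n m. norm (\<rho> n m) \<le> B \<longrightarrow>
        (\<exists>d. m = (\<Sum>i<Suc (Suc h). d i * int (c n) ^ (if i = 0 then 0 else i + 1)) \<and> (\<forall>i<Suc (Suc h). \<bar>d i\<bar> \<le> K))"
    proof (intro exI[of _ K] allI impI)
      fix n m assume "norm (\<rho> n m) \<le> B"
      then have "norm (flow (real (c n)) (real_of_int m)) \<le> B" by (simp add: \<rho>_def)
      from flow_proper[OF c1 this refl]
      obtain d where d: "m = (\<Sum>i<Suc (Suc h). d i * int (c n) ^ (if i = 0 then 0 else i + 1))"
        "\<And>i. \<bar>real_of_int (d i)\<bar> \<le> 2 ^ h * (2 * max 1 (4 * B) + (max 1 (4 * B))\<^sup>2 +
      (max 1 (4 * B) + 2 * (exp ((max 1 (4 * B))\<^sup>2) * ((max 1 (4 * B))\<^sup>2) ^ 3) + real (Suc h) * (4 * pi * max 1 (4 * B)) ^ 3))"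
        by blast
      have "\<bar>d i\<bar> \<le> K" for i
        unfolding K_def le_floor_iff of_int_abs by (rule d(2))
      then show "\<exists>d. m = (\<Sum>i<Suc (Suc h). d i * int (c n) ^ (if i = 0 then 0 else i + 1)) \<and> (\<forall>i<Suc (Suc h). \<bar>d i\<bar> \<le> K)"
        using d(1) by blast
    qed
  qed simp_all
  ultimately show ?thesis by blast
qed

end

theorem theorem1:
  fixes k l1 l2 :: nat
  assumes "k \<ge> 2" and "CARD('m::finite) = k + 1"
    and "1 \<le> l1" and "l1 \<le> k div 2"
    and "1 \<le> l2" and "l2 \<le> k"
  shows "(\<exists>(\<rho> :: nat \<Rightarrow> int \<Rightarrow> real ^ 'm option ^ 'm option) \<rho>_lim \<Gamma>\<^sub>G.
            (\<forall>n. convex_cocompact SO0 quad_form (\<rho> n)) \<and>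
            algebraically_converges \<rho> \<rho>_lim \<and>
            discrete_faithful SO0 \<rho>_lim \<and>
            geometric_limit SO0 (\<lambda>n. range (\<rho> n)) \<Gamma>\<^sub>G \<and>
            SO0\<lparr>carrier := \<Gamma>\<^sub>G\<rparr> \<cong> product_group {..<l1 + 1} (\<lambda>_. integer_group))
       \<and> (\<exists>(\<rho> :: nat \<Rightarrow> int \<Rightarrow> complex ^ 'm option ^ 'm option) \<rho>_lim \<Gamma>\<^sub>G.
            (\<forall>n. convex_cocompact SU herm_quad (\<rho> n)) \<and>
            algebraically_converges \<rho> \<rho>_lim \<and>
            discrete_faithful SU \<rho>_lim \<and>
            geometric_limit SU (\<lambda>n. range (\<rho> n)) \<Gamma>\<^sub>G \<and>
            SU\<lparr>carrier := \<Gamma>\<^sub>G\<rparr> \<cong> product_group {..<l2 + 1} (\<lambda>_. integer_group))"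
proof
  have "2 * l1 \<le> k" using assms(4) by auto
  from ex_rotation_planes[OF assms(2) assms(3) this]
  obtain i0 :: 'm and \<sigma> sg pl where "rotation_planes i0 \<sigma> sg pl l1" by blast
  then show "\<exists>(\<rho> :: nat \<Rightarrow> int \<Rightarrow> real ^ 'm option ^ 'm option) \<rho>_lim \<Gamma>\<^sub>G.
            (\<forall>n. convex_cocompact SO0 quad_form (\<rho> n)) \<and>
            algebraically_converges \<rho> \<rho>_lim \<and>
            discrete_faithful SO0 \<rho>_lim \<and>
            geometric_limit SO0 (\<lambda>n. range (\<rho> n)) \<Gamma>\<^sub>G \<and>
            SO0\<lparr>carrier := \<Gamma>\<^sub>G\<rparr> \<cong> product_group {..<l1 + 1} (\<lambda>_. integer_group)"
    by (rule rotation_planes.geometric_limit_SO0)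
next
  obtain h' where h': "bij_betw h' {0..<k + 1} (UNIV :: 'm set)"
    using ex_bij_betw_nat_finite[of "UNIV :: 'm set"] assms(2) by auto
  obtain h where l2: "l2 = Suc h" using assms(5) by (cases l2) auto
  have inj: "inj_on h' {0..<k + 1}" using h' by (rule bij_betw_imp_inj_on)
  have "rotation_torus (h' k) h' h k"
  proof
    show "inj_on h' {..<Suc h}"
      by (rule inj_on_subset[OF inj]) (use assms(6) l2 in auto)
    show "h' j \<noteq> h' k" if "j < Suc h" for j
      using inj_on_eq_iff[OF inj, of j k] that assms(6) l2 by auto
  qed (rule assms(2))
  then show "\<exists>(\<rho> :: nat \<Rightarrow> int \<Rightarrow> complex ^ 'm option ^ 'm option) \<rho>_lim \<Gamma>\<^sub>G.
            (\<forall>n. convex_cocompact SU herm_quad (\<rho> n)) \<and>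
            algebraically_converges \<rho> \<rho>_lim \<and>
            discrete_faithful SU \<rho>_lim \<and>
            geometric_limit SU (\<lambda>n. range (\<rho> n)) \<Gamma>\<^sub>G \<and>
            SU\<lparr>carrier := \<Gamma>\<^sub>G\<rparr> \<cong> product_group {..<l2 + 1} (\<lambda>_. integer_group)"
    using rotation_torus.geometric_limit_SU unfolding l2 Suc_eq_plus1 by blast
qed

end
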